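(* Let $d,e$ be coprime integers with $1\le e<d$ and let $X_{d,e}=\mathbb{A}^2/G_{d,e}$. If $e^2\not\equiv 1\mod d$ then $$\mathrm{Aut}(X_{d,e})\simeq \mathcal{N}_{d,e}^+/G_{d,e} *_{\mathbb{T}/G_{d,e}} \mathcal{N}_{d,e}^-/G_{d,e},$$ while for $e^2\equiv 1\mod d$ we have $$\mathrm{Aut}(X_{d,e})\simeq \mathcal{N}_{d,e}^+/G_{d,e} *_{N_{d,e}^+/G_{d,e}} N_{d,e}/G_{d,e}.$$
   Context: The base field is $\mathbb{C}$, and $\mathbb{A}^2$ has coordinates $(x,y)$. Let $\zeta=\exp(2\pi i/d)$; $G_{d,e}=\langle g\rangle\subseteq \mathrm{GL}(2,\mathbb{C})$ with $g:(x,y)\mapsto(\zeta^e x,\zeta y)$; $X_{d,e}=\mathrm{Spec}\,\mathbb{C}[x,y]^{G_{d,e}}$. $\mathrm{Jonq}^+(\mathbb{A}^2)$ is the group of transformations $(x,y)\mapsto(\alpha x+f(y),\beta y)$ and $\mathrm{Jonq}^-(\mathbb{A}^2)$ is the group of transformations $(x,y)\mapsto(\alpha x,\beta y+f(x))$, where $\alpha,\beta\in\mathbb{C}^\times$ and $f\in\mathbb{C}[t]$. $\mathbb{T}\subseteq\mathrm{GL}(2,\mathbb{C})$ is the torus of diagonal matrices. $N_{d,e}$ is the normalizer of $G_{d,e}$ in $\mathrm{GL}(2,\mathbb{C})$ and $\mathcal{N}_{d,e}$ is the normalizer of $G_{d,e}$ in $\mathrm{Aut}(\mathbb{A}^2)$.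 Set $N_{d,e}^\pm=N_{d,e}\cap\mathrm{Jonq}^\pm(\mathbb{A}^2)$ and $\mathcal{N}_{d,e}^\pm=\mathcal{N}_{d,e}\cap\mathrm{Jonq}^\pm(\mathbb{A}^2)$. $A*_C B$ denotes the free product of $A$ and $B$ amalgamated over the common subgroup $C$ (here via the natural inclusions). *)

theory Defs
  imports
    Complex_Main
    "HOL-Computational_Algebra.Polynomial"
    "HOL-Number_Theory.Cong"
    "HOL-Algebra.Bij"
    "HOL-Algebra.Generated_Groups"
    "HOL-Algebra.Group_Action"
begin

section \<open>Affine varieties over the complex numbers\<close>

text \<open>
  An affine variety is given by its set of (closed) points together with its set of global
  regular functions, the latter being extensional functions on the set of points.
  A map between affine varieties is a morphism iff it pulls regular functions back to regular
  functions; this is how automorphisms are defined here.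
\<close>

type_synonym 'p variety = "'p set \<times> ('p \<Rightarrow> complex) set"

definition endomorphisms :: "'p variety \<Rightarrow> ('p \<Rightarrow> 'p) set" where
  "endomorphisms V = (case V of (S, R) \<Rightarrow>
     {\<phi> \<in> S \<rightarrow>\<^sub>E S. \<forall>f\<in>R. compose S f \<phi> \<in> R})"

definition Aut :: "'p variety \<Rightarrow> ('p \<Rightarrow> 'p) monoid" where
  "Aut V = (BijGroup (fst V))\<lparr>carrier :=
     {\<phi> \<in> Bij (fst V). \<phi> \<in> endomorphisms V \<and> inv\<^bsub>BijGroup (fst V)\<^esub> \<phi> \<in> endomorphisms V}\<rparr>"

text \<open>
  The ring \<open>\<complex>[x,y]\<close> is the type \<^typ>\<open>complex poly poly\<close>, read as \<open>(\<complex>[x])[y]\<close>: specialising the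
  outer variable in \<^term>\<open>poly p [:y:]\<close> gives a polynomial in \<open>x\<close>.
\<close>

definition eval2 :: "complex poly poly \<Rightarrow> complex \<times> complex \<Rightarrow> complex" where
  "eval2 p = (\<lambda>(x, y). poly (poly p [:y:]) x)"

definition A2 :: "(complex \<times> complex) variety" where
  "A2 = (UNIV, range eval2)"

text \<open>
  The affine variety \<open>Spec A\<close> of a finitely generated \<open>\<complex>\<close>-subalgebra \<open>A\<close> of \<open>\<complex>[x,y]\<close>. By the
  Nullstellensatz its closed points are the \<open>\<complex>\<close>-algebra homomorphisms \<open>A \<rightarrow> \<complex>\<close>; an element of \<open>A\<close>
  is a regular function by evaluation at homomorphisms.
\<close>

definition closed_points :: "complex poly poly set \<Rightarrow> (complex poly poly \<Rightarrow> complex) set" where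
  "closed_points A = {h \<in> extensional A.
     (\<forall>c. h [:[:c:]:] = c) \<and>
     (\<forall>p\<in>A. \<forall>q\<in>A. h (p + q) = h p + h q \<and> h (p * q) = h p * h q)}"

definition Spec :: "complex poly poly set \<Rightarrow> (complex poly poly \<Rightarrow> complex) variety" where
  "Spec A = (closed_points A, (\<lambda>a. \<lambda>h\<in>closed_points A. h a) ` A)"


section \<open>The groups acting on the affine plane\<close>

abbreviation Aut_A2 :: "(complex \<times> complex \<Rightarrow> complex \<times> complex) monoid" where
  "Aut_A2 \<equiv> Aut A2"

definition GL2 :: "(complex \<times> complex \<Rightarrow> complex \<times> complex) set" where
  "GL2 = {\<lambda>(x, y). (a * x + b * y, c * x + d * y) | a b c d. a * d - b * c \<noteq> 0}"

definition Torus :: "(complex \<times> complex \<Rightarrow> complex \<times> complex) set" where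
  "Torus = {\<lambda>(x, y). (\<alpha> * x, \<beta> * y) | \<alpha> \<beta>. \<alpha> \<noteq> 0 \<and> \<beta> \<noteq> 0}"

definition Jonq_plus :: "(complex \<times> complex \<Rightarrow> complex \<times> complex) set" where
  "Jonq_plus = {\<lambda>(x, y). (\<alpha> * x + poly f y, \<beta> * y) | \<alpha> \<beta> f. \<alpha> \<noteq> 0 \<and> \<beta> \<noteq> 0}"

definition Jonq_minus :: "(complex \<times> complex \<Rightarrow> complex \<times> complex) set" where
  "Jonq_minus = {\<lambda>(x, y). (\<alpha> * x, \<beta> * y + poly f x) | \<alpha> \<beta> f. \<alpha> \<noteq> 0 \<and> \<beta> \<noteq> 0}"

definition root_of_unity :: "nat \<Rightarrow> complex" where
  "root_of_unity d = exp (2 * of_real pi * \<i> / of_nat d)"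

definition gen :: "nat \<Rightarrow> nat \<Rightarrow> complex \<times> complex \<Rightarrow> complex \<times> complex" where
  "gen d e = (\<lambda>(x, y). (root_of_unity d ^ e * x, root_of_unity d * y))"

definition G_grp :: "nat \<Rightarrow> nat \<Rightarrow> (complex \<times> complex \<Rightarrow> complex \<times> complex) set" where
  "G_grp d e = generate (Aut_A2\<lparr>carrier := GL2\<rparr>) {gen d e}"

definition invariant_ring ::
    "(complex \<times> complex \<Rightarrow> complex \<times> complex) set \<Rightarrow> complex poly poly set" where
  "invariant_ring H = {p. \<forall>g\<in>H. \<forall>v. eval2 p (g v) = eval2 p v}"

definition X_var :: "nat \<Rightarrow> nat \<Rightarrow> (complex poly poly \<Rightarrow> complex) variety" where
  "X_var d e = Spec (invariant_ring (G_grp d e))"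

definition N_lin :: "nat \<Rightarrow> nat \<Rightarrow> (complex \<times> complex \<Rightarrow> complex \<times> complex) set" where
  "N_lin d e = normalizer (Aut_A2\<lparr>carrier := GL2\<rparr>) (G_grp d e)"

definition N_aut :: "nat \<Rightarrow> nat \<Rightarrow> (complex \<times> complex \<Rightarrow> complex \<times> complex) set" where
  "N_aut d e = normalizer Aut_A2 (G_grp d e)"

definition N_lin_plus :: "nat \<Rightarrow> nat \<Rightarrow> (complex \<times> complex \<Rightarrow> complex \<times> complex) set" where
  "N_lin_plus d e = N_lin d e \<inter> Jonq_plus"

definition N_aut_plus :: "nat \<Rightarrow> nat \<Rightarrow> (complex \<times> complex \<Rightarrow> complex \<times> complex) set" where
  "N_aut_plus d e = N_aut d e \<inter> Jonq_plus"

definition N_aut_minus :: "nat \<Rightarrow> nat \<Rightarrow> (complex \<times> complex \<Rightarrow> complex \<times> complex) set" where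
  "N_aut_minus d e = N_aut d e \<inter> Jonq_minus"

text \<open>
  The quotient \<open>H / G\<^bsub>d,e\<^esub>\<close> of a subgroup \<open>H\<close> of \<open>Aut(\<bbbA>\<^sup>2)\<close>. Its elements are cosets, so
  \<open>H\<^sub>1 \<subseteq> H\<^sub>2\<close> makes \<open>H\<^sub>1 / G\<^bsub>d,e\<^esub>\<close> literally a subset of \<open>H\<^sub>2 / G\<^bsub>d,e\<^esub>\<close>.
\<close>

definition quot :: "(complex \<times> complex \<Rightarrow> complex \<times> complex) set \<Rightarrow> nat \<Rightarrow> nat
    \<Rightarrow> (complex \<times> complex \<Rightarrow> complex \<times> complex) set monoid" where
  "quot H d e = Aut_A2\<lparr>carrier := H\<rparr> Mod G_grp d e"


section \<open>Amalgamated free products\<close>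

text \<open>
  The free product of \<open>A\<close> and \<open>B\<close> amalgamated over a common subgroup \<open>C\<close>: words in the disjoint
  union of \<open>A\<close> and \<open>B\<close>, modulo the congruence generated by the multiplication tables of \<open>A\<close>
  and \<open>B\<close> and by the identification of the two copies of each element of \<open>C\<close>.
\<close>

definition amalg_words :: "'a monoid \<Rightarrow> 'a monoid \<Rightarrow> ('a + 'a) list set" where
  "amalg_words A B = lists (Inl ` carrier A \<union> Inr ` carrier B)"

inductive amalg_step :: "'a monoid \<Rightarrow> 'a monoid \<Rightarrow> 'a monoid
    \<Rightarrow> ('a + 'a) list \<Rightarrow> ('a + 'a) list \<Rightarrow> bool"
  for A B C :: "'a monoid" where
  one_left: "amalg_step A B C (u @ [Inl \<one>\<^bsub>A\<^esub>] @ v) (u @ v)"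
| one_right: "amalg_step A B C (u @ [Inr \<one>\<^bsub>B\<^esub>] @ v) (u @ v)"
| mult_left: "a \<in> carrier A \<Longrightarrow> a' \<in> carrier A \<Longrightarrow>
    amalg_step A B C (u @ [Inl a, Inl a'] @ v) (u @ [Inl (a \<otimes>\<^bsub>A\<^esub> a')] @ v)"
| mult_right: "b \<in> carrier B \<Longrightarrow> b' \<in> carrier B \<Longrightarrow>
    amalg_step A B C (u @ [Inr b, Inr b'] @ v) (u @ [Inr (b \<otimes>\<^bsub>B\<^esub> b')] @ v)"
| common: "c \<in> carrier C \<Longrightarrow> amalg_step A B C (u @ [Inl c] @ v) (u @ [Inr c] @ v)"

definition amalg_rel :: "'a monoid \<Rightarrow> 'a monoid \<Rightarrow> 'a monoid \<Rightarrow> ('a + 'a) list rel" where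
  "amalg_rel A B C = {(u, v). u \<in> amalg_words A B \<and> v \<in> amalg_words A B \<and>
     equivclp (amalg_step A B C) u v}"

definition amalg :: "'a monoid \<Rightarrow> 'a monoid \<Rightarrow> 'a monoid \<Rightarrow> ('a + 'a) list set monoid" where
  "amalg A C B =
    \<lparr>carrier = amalg_words A B // amalg_rel A B C,
     mult = (\<lambda>U V. \<Union>u\<in>U. \<Union>v\<in>V. amalg_rel A B C `` {u @ v}),
     one = amalg_rel A B C `` {[]}\<rparr>"

notation amalg (\<open>_ *\<^bsub>_\<^esub> _\<close> [66, 0, 66] 65)

end

theory Submission
  imports Defs
    "HOL-Computational_Algebra.Field_as_Ring"
    "HOL-Computational_Algebra.Polynomial_Factorial"
    "HOL-Computational_Algebra.Fundamental_Theorem_Algebra"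
begin

text \<open>
  Automorphisms of the quotient are algebra automorphisms \<open>\<sigma>\<close> of the invariant ring. The invariants
  \<open>x\<^sup>d\<close> and \<open>y\<^sup>d\<close> vanish simultaneously only at the image of the origin, so their images \<open>U\<close> and \<open>V\<close> under
  \<open>\<sigma>\<close> are coprime; since \<open>x y\<^bsup>d-e\<^esup>\<close> is invariant, \<open>U V\<^bsup>d-e\<^esup>\<close> is a \<open>d\<close>-th power, hence so are \<open>U\<close>
  and \<open>V\<close>, and their roots define a lift of \<open>\<sigma>\<close> to the plane. Lifts normalize \<open>G\<close> and are unique up to
  \<open>G\<close>.

  It remains to decompose the normalizer. The coordinates of a normalizing automorphism are
  semi-invariant, so the elementary maps in Jung's reduction (which lowers the sum of the degrees in
  \<open>y\<close>) automatically normalize \<open>G\<close>. Alternating words are nontrivial by a degree count along a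
  generic line through the origin.
\<close>

section \<open>Polynomials in two variables\<close>

text \<open>Leading coefficients in y are polynomials in x, not numbers, so comparing y-degrees does
  not yet cancel a leading term: the reduction must also show that one leading coefficient is a
  constant multiple of a power of the other. Whole leading monomials can then be compared. If f g =
  g^k f, the coordinates of f have characters e k and k; since k is invertible modulo d, the
  exponent s of the cancelling shear satisfies s = e or e s = 1 modulo d, which is exactly the
  condition for that shear to commute with g.

  The descent stops at a coordinate that does not involve y. If it is the first one, the map lies in
  \<open>N_aut_minus d e\<close>, translations being excluded because d does not divide e. If it is
  the second one, the characters force e^2 = 1 modulo d, which is also the condition for the swap of
  the coordinates to normalize G. This is the source of the two cases: with the swap available the
  two triangular factors are conjugate, and \<open>N_lin d e\<close> takes the place of the negative
  one.\<close>

type_synonym bipoly = "complex poly poly"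

abbreviation const2 :: "complex \<Rightarrow> bipoly" where "const2 c \<equiv> [:[:c:]:]"
abbreviation X2 :: bipoly where "X2 \<equiv> [:[:0, 1:]:]"
abbreviation Y2 :: bipoly where "Y2 \<equiv> [:0, 1:]"

lemma eval2_simps [simp]:
  "eval2 (p + q) v = eval2 p v + eval2 q v"
  "eval2 (p - q) v = eval2 p v - eval2 q v"
  "eval2 (- p) v = - eval2 p v"
  "eval2 (p * q) v = eval2 p v * eval2 q v"
  "eval2 (p ^ n) v = eval2 p v ^ n"
  "eval2 (pCons r p) v = poly r (fst v) + snd v * eval2 p v"
  "eval2 (smult r p) v = poly r (fst v) * eval2 p v"
  "eval2 0 v = 0"
  "eval2 1 v = 1"
  by (simp_all add: eval2_def split: prod.splits)

lemma eval2_sum [simp]: "eval2 (sum f A) v = (\<Sum>i\<in>A. eval2 (f i) v)"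
  by (induction A rule: infinite_finite_induct) auto

lemma eval2_prod [simp]: "eval2 (prod f A) v = (\<Prod>i\<in>A. eval2 (f i) v)"
  by (induction A rule: infinite_finite_induct) auto

lemma eval2_monom [simp]: "eval2 (monom r n) v = poly r (fst v) * snd v ^ n"
  by (induction n) (auto simp: monom_Suc monom_0)

text \<open>For fixed y the polynomial in x vanishes everywhere, hence is zero, so every constant
  \<open>[:y:]\<close> is a root of p. This is what allows identities in C[x,y] to be checked
  pointwise throughout.\<close>

lemma eval2_eq_0_imp: 
  assumes "\<And>v. eval2 p v = 0" shows "p = 0"
proof (rule ccontr)
  assume "p \<noteq> 0"
  have "poly p [:y:] = 0" for y
    using assms[of "(_, y)"] poly_all_0_iff_0[of "poly p [:y:]"] by (simp add: eval2_def)
  then have "range (\<lambda>y. [:y:]) \<subseteq> {z. poly p z = 0}" by auto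
  moreover have "infinite (range (\<lambda>y::complex. [:y:]))"
    by (subst finite_image_iff) (auto simp: inj_def infinite_UNIV_char_0)
  ultimately show False using poly_roots_finite[OF \<open>p \<noteq> 0\<close>] finite_subset by blast
qed

lemma eval2_eqI: "(\<And>v. eval2 p v = eval2 q v) \<Longrightarrow> p = q"
  using eval2_eq_0_imp[of "p - q"] by simp

text \<open>This is G(P, Q). The coefficients of G are polynomials in x, so each of them has to be
  evaluated at P before the outer variable is replaced by Q.\<close>

definition bisubst :: "bipoly \<Rightarrow> bipoly \<Rightarrow> bipoly \<Rightarrow> bipoly" where
  "bisubst G P Q = poly (map_poly (\<lambda>a. poly (map_poly const2 a) P) G) Q"

lemma bisubst_pCons: "bisubst (pCons a G) P Q = poly (map_poly const2 a) P + Q * bisubst G P Q"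
  by (simp add: bisubst_def map_poly_pCons)

lemma bisubst_0 [simp]: "bisubst 0 P Q = 0"
  by (simp add: bisubst_def)

lemma eval2_inner: "eval2 (poly (map_poly const2 a) P) v = poly a (eval2 P v)"
  by (induction a) (auto simp: map_poly_pCons)

lemma eval2_bisubst [simp]: "eval2 (bisubst G P Q) v = eval2 G (eval2 P v, eval2 Q v)"
  by (induction G) (auto simp: bisubst_pCons eval2_inner)

lemma bisubst_add: "bisubst (F + G) P Q = bisubst F P Q + bisubst G P Q"
  and bisubst_mult: "bisubst (F * G) P Q = bisubst F P Q * bisubst G P Q"
  and bisubst_power: "bisubst (F ^ n) P Q = bisubst F P Q ^ n"
  and bisubst_const: "bisubst (const2 c) P Q = const2 c"
  and bisubst_X2: "bisubst X2 P Q = P"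
  and bisubst_Y2: "bisubst Y2 P Q = Q"
  by (rule eval2_eqI; simp)+

lemma bisubst_sum: "bisubst (sum f A) P Q = (\<Sum>i\<in>A. bisubst (f i) P Q)"
  by (rule eval2_eqI; simp)

section \<open>The Jacobian derivation\<close>

abbreviation pderiv_x :: "bipoly \<Rightarrow> bipoly" where "pderiv_x p \<equiv> map_poly pderiv p"

lemma pderiv_x_pCons: "pderiv_x (pCons a p) = pCons (pderiv a) (pderiv_x p)"
  by (simp add: map_poly_pCons)

lemma pderiv_x_add: "pderiv_x (p + q) = pderiv_x p + pderiv_x q"
  by (rule poly_eqI) (simp add: coeff_map_poly pderiv_add)

lemma pderiv_x_smult: "pderiv_x (smult a q) = smult (pderiv a) q + smult a (pderiv_x q)"
  by (rule poly_eqI) (simp add: coeff_map_poly pderiv_mult algebra_simps)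

lemma pderiv_x_mult: "pderiv_x (p * q) = pderiv_x p * q + p * pderiv_x q"
  by (induction p) (auto simp: pderiv_x_pCons pderiv_x_add pderiv_x_smult smult_add_left algebra_simps)

text \<open>The Jacobian determinant of (P, f). For fixed P it is a derivation in f that annihilates
  C[P].\<close>

definition jac :: "bipoly \<Rightarrow> bipoly \<Rightarrow> bipoly" where
  "jac P f = pderiv_x P * pderiv f - pderiv P * pderiv_x f"

lemma jac_add: "jac P (f + g) = jac P f + jac P g"
  by (simp add: jac_def pderiv_x_add pderiv_add algebra_simps)

lemma jac_mult: "jac P (f * g) = jac P f * g + f * jac P g"
  by (simp add: jac_def pderiv_x_mult pderiv_mult algebra_simps)

lemma jac_self: "jac P P = 0"
  by (simp add: jac_def)

lemma jac_const: "jac P (const2 c) = 0"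
  by (simp add: jac_def pderiv_x_pCons pderiv_pCons)

lemma jac_inner: "jac P (poly (map_poly const2 a) P) = 0"
proof (induction a)
  case 0 then show ?case by (simp add: jac_def)
next
  case (pCons c a) then show ?case
    by (simp add: map_poly_pCons jac_add jac_mult jac_const jac_self)
qed

text \<open>The coefficients of G become polynomials in P, which the derivation \<open>jac P\<close>
  kills; only the powers of Q are differentiated.\<close>

lemma jac_bisubst: "jac P (bisubst G P Q) = bisubst (pderiv G) P Q * jac P Q"
proof (induction G)
  case 0 then show ?case by (simp add: jac_def)
next
  case (pCons a G) then show ?case
    by (simp add: bisubst_pCons jac_add jac_mult jac_inner pderiv_pCons bisubst_add bisubst_pCons[of 0] algebra_simps)
qed

text \<open>Each of the two products contains one derivative in y, and the derivative in x does not
  raise the degree in y.\<close>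

lemma degree_jac: 
  assumes "degree P \<ge> 1"
  shows "degree (jac P f) \<le> degree f + (degree P - 1)"
proof -
  have "degree (pderiv_x P) \<le> degree P" by (intro degree_le) (simp add: coeff_map_poly coeff_eq_0)
  moreover have "degree (pderiv_x f) \<le> degree f" by (intro degree_le) (simp add: coeff_map_poly coeff_eq_0)
  ultimately have 1: "degree (pderiv P * pderiv_x f) \<le> degree f + (degree P - 1)"
    using degree_mult_le[of "pderiv P" "pderiv_x f"] degree_pderiv[of P] by linarith
  have "degree (pderiv_x P * pderiv f) \<le> degree f + (degree P - 1)"
  \<comment> \<open>For \<open>degree f = 0\<close> the truncated \<open>degree f - 1\<close> would
    not record the loss of a degree; there the product is zero.\<close>
  proof (cases "degree f = 0")
    case True
    then have "pderiv f = 0" by (simp add: pderiv_eq_0_iff)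
    then show ?thesis by simp
  next
    case False
    then show ?thesis using degree_mult_le[of "pderiv_x P" "pderiv f"] degree_pderiv[of f] assms \<open>degree (pderiv_x P) \<le> degree P\<close>
      by linarith
  qed
  then show ?thesis unfolding jac_def using 1 by (rule degree_diff_le)
qed

text \<open>By the chain rule the image of the derivative of G, times the nonzero
  \<open>jac P Q\<close>, equals \<open>jac P\<close> of the image of G. Dropping that factor cannot
  raise the degree, so each derivative costs at most \<open>degree P - 1\<close>.\<close>

lemma degree_bisubst_pderiv:
  assumes "degree P \<ge> 1" "jac P Q \<noteq> 0"
  shows "degree (bisubst ((pderiv ^^ q) G) P Q) \<le> degree (bisubst G P Q) + q * (degree P - 1)"
proof (induction q)
  case (Suc q)
  let ?F = "(pderiv ^^ q) G"
  have "degree (bisubst (pderiv ?F) P Q) \<le> degree (bisubst ?F P Q) + (degree P - 1)"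
  proof (cases "bisubst (pderiv ?F) P Q = 0")
    case False
    have "degree (bisubst (pderiv ?F) P Q) \<le> degree (bisubst (pderiv ?F) P Q * jac P Q)"
      using False assms(2) by (simp add: degree_mult_eq)
    also have "\<dots> \<le> degree (bisubst ?F P Q) + (degree P - 1)"
      by (metis jac_bisubst degree_jac[OF assms(1)])
    finally show ?thesis .
  qed simp
  with Suc show ?case by simp
qed simp

section \<open>Weighted degrees and top forms\<close>

definition wdeg_le :: "nat \<Rightarrow> nat \<Rightarrow> nat \<Rightarrow> bipoly \<Rightarrow> bool" where
  "wdeg_le n m D F \<longleftrightarrow> (\<forall>i j. coeff (coeff F j) i \<noteq> 0 \<longrightarrow> n * i + m * j \<le> D)"

text \<open>
  For weights \<open>n\<close> of \<open>x\<close> and \<open>m\<close> of \<open>y\<close>, the following is the part of \<open>F\<close> of weighted degree \<open>D\<close> with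
  \<open>x\<close> set to \<open>1\<close>. The exponent of \<open>x\<close> is recovered from the exponent of \<open>y\<close>, so nothing is lost.
\<close>

definition top_form :: "nat \<Rightarrow> nat \<Rightarrow> nat \<Rightarrow> bipoly \<Rightarrow> complex poly" where
  "top_form n m D F = (\<Sum>j\<le>degree F. monom
     (if m * j \<le> D \<and> n dvd D - m * j then coeff (coeff F j) ((D - m * j) div n) else 0) j)"

lemma coeff_top_form:
  "coeff (top_form n m D F) j =
     (if m * j \<le> D \<and> n dvd D - m * j then coeff (coeff F j) ((D - m * j) div n) else 0)"
proof -
  have "coeff (top_form n m D F) j = (\<Sum>k\<le>degree F. if k = j then
    (if m * k \<le> D \<and> n dvd D - m * k then coeff (coeff F k) ((D - m * k) div n) else 0) else 0)"
    unfolding top_form_def coeff_sum by (rule sum.cong) (simp_all only: coeff_monom)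
  also have "\<dots> = (if j \<le> degree F then 
    (if m * j \<le> D \<and> n dvd D - m * j then coeff (coeff F j) ((D - m * j) div n) else 0) else 0)"
    by (simp only: sum.delta finite_atMost atMost_iff)
  finally show ?thesis by (auto simp: coeff_eq_0)
qed

lemma bipoly_expand: "p = (\<Sum>j\<le>degree p. \<Sum>i\<le>degree (coeff p j). monom (monom (coeff (coeff p j) i) i) j)"
proof -
  have "p = (\<Sum>j\<le>degree p. monom (\<Sum>i\<le>degree (coeff p j). monom (coeff (coeff p j) i) i) j)"
    by (simp add: poly_as_sum_of_monoms)
  also have "\<dots> = (\<Sum>j\<le>degree p. \<Sum>i\<le>degree (coeff p j). monom (monom (coeff (coeff p j) i) i) j)"
    by (simp only: monom_sum)
  finally show ?thesis .
qed

lemma bisubst_expand: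
  "bisubst F P Q = (\<Sum>j\<le>degree F. \<Sum>i\<le>degree (coeff F j). const2 (coeff (coeff F j) i) * (P ^ i * Q ^ j))"
  by (rule eval2_eqI, subst (1) bipoly_expand[of F])
     (simp add: bisubst_sum poly_monom algebra_simps del: mult_pCons_left)

text \<open>Only monomials of weight exactly D contribute to y^D, each through a product of powers
  of the leading coefficients a and b. Writing a(x) = \<tau>^n turns a^i b^j into \<tau>^D (b /
  \<tau>^m)^j, so the sum depends on one variable only.\<close>

lemma poly_coeff_bisubst_top:
  assumes w: "wdeg_le (degree P) (degree Q) D F" and n: "degree P \<ge> 1" and m: "degree Q \<ge> 1"
    and t: "\<tau> \<noteq> 0" "poly (lead_coeff P) x = \<tau> ^ degree P"
  shows "poly (coeff (bisubst F P Q) D) x = 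
     \<tau> ^ D * poly (top_form (degree P) (degree Q) D F) (poly (lead_coeff Q) x / \<tau> ^ degree Q)"
proof -
  define \<beta> where "\<beta> = poly (lead_coeff Q) x"
  let ?n = "degree P" and ?m = "degree Q"
  let ?c = "\<lambda>i j. coeff (coeff F j) i"
  have PQ: "P \<noteq> 0" "Q \<noteq> 0" using n m by auto
  have deg: "degree (P ^ i * Q ^ j) = ?n * i + ?m * j" for i j
    using PQ by (simp add: degree_mult_eq degree_power_eq algebra_simps)
  have trm: "coeff (const2 (?c i j) * (P ^ i * Q ^ j)) D =
      (if ?n * i + ?m * j = D then [:?c i j:] * (lead_coeff P ^ i * lead_coeff Q ^ j) else 0)" for i j
  proof (cases "?c i j = 0")
    case False
    then have le: "?n * i + ?m * j \<le> D" using w by (auto simp: wdeg_le_def)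
    show ?thesis
    proof (cases "?n * i + ?m * j = D")
      case True
      then have "coeff (P ^ i * Q ^ j) D = lead_coeff (P ^ i * Q ^ j)" using deg by simp
      also have "\<dots> = lead_coeff P ^ i * lead_coeff Q ^ j" by (simp only: lead_coeff_mult lead_coeff_power)
      finally show ?thesis using True by simp
    next
      case False
      then have "coeff (P ^ i * Q ^ j) D = 0" using le deg by (intro coeff_eq_0) auto
      then show ?thesis using False by simp
    qed
  qed simp
  have inner: "(\<Sum>i\<le>degree (coeff F j). poly (coeff (const2 (?c i j) * (P ^ i * Q ^ j)) D) x)
     = coeff (top_form ?n ?m D F) j * (\<tau> ^ D * (\<beta> / \<tau> ^ ?m) ^ j)" for j
  proof -
    have "(\<Sum>i\<le>degree (coeff F j). poly (coeff (const2 (?c i j) * (P ^ i * Q ^ j)) D) x) = 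
       (\<Sum>i\<le>degree (coeff F j). if ?n * i + ?m * j = D then ?c i j * (\<tau> ^ (?n * i) * \<beta> ^ j) else 0)"
      by (rule sum.cong, simp, simp only: trm) (simp add: t \<beta>_def power_mult)
    also have "\<dots> = coeff (top_form ?n ?m D F) j * (\<tau> ^ D * (\<beta> / \<tau> ^ ?m) ^ j)"
    proof (cases "?m * j \<le> D \<and> ?n dvd D - ?m * j")
      case True
      define i0 where "i0 = (D - ?m * j) div ?n"
      have i0: "?n * i0 + ?m * j = D" unfolding i0_def using True by auto
      have iff: "?n * i + ?m * j = D \<longleftrightarrow> i = i0" for i using i0 n by (metis add_right_cancel mult_cancel1 not_one_le_zero)
      have "\<tau> ^ D * (\<beta> / \<tau> ^ ?m) ^ j = \<tau> ^ (?n * i0) * \<beta> ^ j"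
        unfolding i0[symmetric] using t by (simp add: power_divide power_add power_mult)
      then show ?thesis using True by (auto simp: iff coeff_top_form i0_def[symmetric] coeff_eq_0)
    next
      case False
      then have "?n * i + ?m * j \<noteq> D" for i by auto
      then show ?thesis using False by (auto simp: coeff_top_form)
    qed
    finally show ?thesis .
  qed
  have dg: "degree (top_form ?n ?m D F) \<le> degree F"
    unfolding top_form_def by (intro degree_sum_le) (auto intro: order.trans[OF degree_monom_le])
  have "poly (coeff (bisubst F P Q) D) x = (\<Sum>j\<le>degree F. coeff (top_form ?n ?m D F) j * (\<tau> ^ D * (\<beta> / \<tau> ^ ?m) ^ j))"
    unfolding bisubst_expand by (simp add: coeff_sum poly_sum inner del: coeff_pCons mult_pCons_left)
  also have "\<dots> = (\<Sum>j\<le>degree (top_form ?n ?m D F). coeff (top_form ?n ?m D F) j * (\<tau> ^ D * (\<beta> / \<tau> ^ ?m) ^ j))"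
    using dg by (intro sum.mono_neutral_right) (auto simp: coeff_eq_0)
  also have "\<dots> = \<tau> ^ D * poly (top_form ?n ?m D F) (\<beta> / \<tau> ^ ?m)"
    by (simp add: poly_altdef sum_distrib_left algebra_simps)
  finally show ?thesis by (simp add: \<beta>_def)
qed

text \<open>Differentiation in y lowers every weight by m, the weight of y, and commutes with
  setting x to 1.\<close>

lemma top_form_pderiv:
  assumes "wdeg_le n m D F" "m \<le> D"
  shows "wdeg_le n m (D - m) (pderiv F)" "top_form n m (D - m) (pderiv F) = pderiv (top_form n m D F)"
proof -
  have c: "coeff ((1 + of_nat k) * p) i = (1 + of_nat k) * coeff p i" for k i and p :: "complex poly"
    by (simp add: of_nat_poly algebra_simps)
  show "wdeg_le n m (D - m) (pderiv F)" unfolding wdeg_le_def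
  proof (intro allI impI)
    fix i j assume "coeff (coeff (pderiv F) j) i \<noteq> 0"
    then have "coeff (coeff F (Suc j)) i \<noteq> 0" by (auto simp: coeff_pderiv c)
    then have "n * i + m * Suc j \<le> D" using assms unfolding wdeg_le_def by blast
    then show "n * i + m * j \<le> D - m" by simp
  qed
  show "top_form n m (D - m) (pderiv F) = pderiv (top_form n m D F)"
    using assms(2) by (intro poly_eqI) (auto simp: coeff_top_form coeff_pderiv c)
qed

lemma top_form_higher_pderiv:
  assumes "wdeg_le n m D F" "m * q \<le> D"
  shows "wdeg_le n m (D - m * q) ((pderiv ^^ q) F) \<and> 
    top_form n m (D - m * q) ((pderiv ^^ q) F) = (pderiv ^^ q) (top_form n m D F)"
  using assms(2)
proof (induction q)
  case (Suc q)
  then have q: "m * q \<le> D" "m \<le> D - m * q" by auto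
  have "D - m * Suc q = D - m * q - m" by simp
  then show ?case using top_form_pderiv[of n m "D - m * q" "(pderiv ^^ q) F"] Suc.IH q by simp
qed (use assms in auto)

section \<open>Orders of vanishing\<close>

lemma degree_ge_sum_order:
  assumes "p \<noteq> 0" "finite Z" "\<And>z. z \<in> Z \<Longrightarrow> k \<le> Polynomial.order z p" 
  shows "card Z * k \<le> degree (p :: 'a :: idom poly)"
proof (cases "k = 0")
  case False
  have "card Z * k \<le> (\<Sum>z\<in>Z. Polynomial.order z p)"
    using sum_bounded_below[of Z k "\<lambda>z. Polynomial.order z p"] assms by simp
  also have "\<dots> \<le> (\<Sum>z | poly p z = 0. Polynomial.order z p)"
  proof (rule sum_mono2)
    show "Z \<subseteq> {z. poly p z = 0}" using assms False by (force simp: order_root)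
  qed (use assms poly_roots_finite in auto)
  also have "\<dots> \<le> degree p" using assms by (intro sum_order_le_degree)
  finally show ?thesis .
qed simp

text \<open>In characteristic zero each derivative lowers a positive order at z by exactly
  one.\<close>

lemma poly_higher_pderiv_order:
  fixes p :: "complex poly"
  assumes "p \<noteq> 0" shows "poly ((pderiv ^^ Polynomial.order z p) p) z \<noteq> 0"
  using assms
proof (induction "Polynomial.order z p" arbitrary: p)
  case 0 then show ?case by (simp add: order_eq_0_iff order_0I)
next
  case (Suc k)
  have "poly p z = 0" using Suc by (metis nat.distinct(1) order_0I)
  then have "pderiv p \<noteq> 0" using Suc.prems by (metis pderiv_eq_0_iff degree_eq_zeroE poly_pCons poly_0 mult_zero_right add_0_right pCons_0_0)
  moreover have "Polynomial.order z p = Suc (Polynomial.order z (pderiv p))"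
    using Suc \<open>poly p z = 0\<close> \<open>pderiv p \<noteq> 0\<close> by (intro order_pderiv) auto
  ultimately show ?case using Suc(1)[of "pderiv p"] Suc(2) by (simp add: funpow_swap1)
qed

lemma pcompose_power: "pcompose (p ^ n) q = pcompose p q ^ n"
  by (induction n) (simp_all add: pcompose_mult pcompose_1)

text \<open>Replacing t by \<eta> t carries a factor (t - z)^k to a multiple of (t - z/\<eta>)^k,
  and by hypothesis it changes p only by a constant. It serves to spread a multiple root of a top
  form over a cycle of roots.\<close>

lemma order_pcompose_scale:
  fixes p :: "'a :: field poly"
  assumes p: "p \<noteq> 0" and \<eta>: "\<eta> \<noteq> 0" and c: "pcompose p [:0, \<eta>:] = smult c p" 
  shows "Polynomial.order z p \<le> Polynomial.order (z / \<eta>) p"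
proof -
  define k where "k = Polynomial.order z p"
  obtain r where r: "p = [:-z, 1:] ^ k * r" using order_1[of z p] unfolding k_def by (auto elim: dvdE)
  have "c \<noteq> 0"
  proof
    assume "c = 0"
    then have "p \<circ>\<^sub>p [:0, \<eta>:] = 0" using c by simp
    then show False using p \<eta> by (simp add: pcompose_eq_0_iff)
  qed
  have "[:-z, 1:] \<circ>\<^sub>p [:0, \<eta>:] = smult \<eta> [:-(z/\<eta>), 1:]" using \<eta> by (simp add: pcompose_pCons)
  then have "([:-z, 1:] ^ k * r) \<circ>\<^sub>p [:0, \<eta>:] = smult (\<eta> ^ k) ([:-(z/\<eta>), 1:] ^ k * (r \<circ>\<^sub>p [:0, \<eta>:]))"
    by (simp only: pcompose_mult pcompose_power smult_power mult_smult_left)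
  then have "[:-(z/\<eta>), 1:] ^ k dvd smult c p" unfolding c[symmetric] r[symmetric] by (metis dvd_smult dvd_triv_left)
  then have "[:-(z/\<eta>), 1:] ^ k dvd p" using \<open>c \<noteq> 0\<close> by (simp add: dvd_smult_iff)
  then show ?thesis using p by (simp add: order_divides k_def)
qed

text \<open>The product of a with all \<open>p - smult r q\<close> vanishes at every point, so one
  of its factors is zero: a ratio chosen pointwise from a finite set is constant.\<close>

lemma eq_smult_if_finitely_many_ratios:
  fixes p q :: "complex poly"
  assumes "a \<noteq> 0" "finite R" and "\<And>x. poly a x \<noteq> 0 \<Longrightarrow> \<exists>r\<in>R. poly p x = r * poly q x"
  shows "\<exists>r\<in>R. p = smult r q"
proof -
  have "poly (a * (\<Prod>r\<in>R. p - smult r q)) x = 0" for x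
    using assms by (auto simp: poly_prod)
  then have "a * (\<Prod>r\<in>R. p - smult r q) = 0" by (metis poly_all_0_iff_0)
  then show ?thesis using assms by auto
qed

lemma smult_one: "smult [:1:] p = (p :: bipoly)"
  by (rule poly_eqI) simp

text \<open>
  The reduction step of Jung's theorem. Let \<open>a\<close> and \<open>b\<close> be the leading coefficients of \<open>P\<close> and \<open>Q\<close>,
  give \<open>G\<close> the weights \<open>n = degree P\<close> and \<open>m = degree Q\<close>, and let \<open>g\<close> be its dehomogenized top form, of
  weighted degree \<open>D\<close>. At a point with \<open>a = \<tau>\<^sup>n\<close>, let \<open>q\<close> be the order of \<open>g\<close> at \<open>\<rho> = b / \<tau>\<^sup>m\<close>. Then the
  \<open>q\<close>-th derivative of \<open>G\<close> in \<open>y\<close>, evaluated at \<open>(P, Q)\<close>, has degree at least \<open>D - q m\<close>, whereas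
  applying \<open>q\<close> times the derivation \<open>jac P\<close> to \<open>G(P, Q) = x\<close> bounds this degree by \<open>q (n - 1)\<close>.
  Writing \<open>n = h p\<close> and \<open>m = h s\<close> with \<open>p\<close>, \<open>s\<close> coprime, \<open>g\<close> also vanishes to order \<open>q\<close> at the \<open>p\<close>
  points \<open>\<rho> / \<eta>\<close> with \<open>\<eta>\<^sup>p = 1\<close>, so \<open>D \<ge> m p q\<close>. Together these force \<open>p = 1\<close> or \<open>s = 1\<close>.
\<close>

theorem jung_step:
  assumes G: "bisubst G P Q = X2" and n: "degree P \<ge> 1" and m: "degree Q \<ge> 1"
  shows "\<exists>c s. (degree Q = degree P * s \<and> lead_coeff Q = smult c (lead_coeff P ^ s)) \<or>
               (degree P = degree Q * s \<and> lead_coeff P = smult c (lead_coeff Q ^ s))"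
proof -
  let ?n = "degree P" and ?m = "degree Q"
  define a where "a = lead_coeff P"
  define b where "b = lead_coeff Q"
  have ab: "a \<noteq> 0" "b \<noteq> 0" using n m by (auto simp: a_def b_def)
  have "pderiv P \<noteq> 0" using n by (simp add: pderiv_eq_0_iff)
  moreover have "jac P X2 = - pderiv P" by (simp add: jac_def pderiv_x_pCons pderiv_pCons smult_one)
  \<comment> \<open>If \<open>jac P Q\<close> vanished, the chain rule applied to G(P, Q) = x would
    give \<open>pderiv P = 0\<close>.\<close>
  ultimately have J: "jac P Q \<noteq> 0" using jac_bisubst[of P G Q] G by auto
  have "G \<noteq> 0" using G by auto
  define I where "I = {(i, j). coeff (coeff G j) i \<noteq> 0}"
  have "I \<subseteq> (\<Union>j\<in>{..degree G}. (\<lambda>i. (i, j)) ` {..degree (coeff G j)})"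
  proof safe
    fix i j assume "(i, j) \<in> I"
    then have c: "coeff (coeff G j) i \<noteq> 0" by (simp add: I_def)
    then have "coeff G j \<noteq> 0" by auto
    with c have "i \<le> degree (coeff G j)" "j \<le> degree G" by (auto intro: le_degree)
    then show "(i, j) \<in> (\<Union>j\<in>{..degree G}. (\<lambda>i. (i, j)) ` {..degree (coeff G j)})" by auto
  qed
  then have fin: "finite I" by (rule finite_subset) auto
  have "I \<noteq> {}" unfolding I_def using \<open>G \<noteq> 0\<close> by (auto simp: poly_eq_iff)
  define D where "D = Max ((\<lambda>(i, j). ?n * i + ?m * j) ` I)"
  have w: "wdeg_le ?n ?m D G" unfolding wdeg_le_def D_def using fin by (auto simp: I_def intro!: Max_ge)
  have "D \<in> (\<lambda>(i, j). ?n * i + ?m * j) ` I" unfolding D_def using fin \<open>I \<noteq> {}\<close> by (intro Max_in) auto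
  then obtain i0 j0 where ij: "D = ?n * i0 + ?m * j0" "coeff (coeff G j0) i0 \<noteq> 0" by (auto simp: I_def)
  define g where "g = top_form ?n ?m D G"
  have "coeff g j0 \<noteq> 0" using ij n by (simp add: g_def coeff_top_form)
  then have "g \<noteq> 0" by auto
  have Dpos: "D > 0"
  proof (rule ccontr)
    assume "\<not> D > 0"
    then have z: "coeff (coeff G j) i = 0" if "i \<noteq> 0 \<or> j \<noteq> 0" for i j using w that n m by (fastforce simp: wdeg_le_def)
    have "G = const2 (coeff (coeff G 0) 0)"
      by (intro poly_eqI) (auto simp: z coeff_pCons split: nat.splits)
    then have "bisubst G P Q = const2 (coeff (coeff G 0) 0)" using bisubst_const by metis
    then show False using G by auto
  qed
  obtain gg where gg: "gg = gcd ?n ?m" "gg > 0" using n by simp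
  obtain p s where ps: "?n = gg * p" "?m = gg * s" "coprime p s"
    using gcd_coprime_exists[of ?n ?m] gg by (metis mult.commute neq0_conv)
  have "p \<ge> 1" "s \<ge> 1" using ps n m by (auto simp: Suc_le_eq intro: Nat.gr0I)
  have main: "?m * (p * q) \<le> D \<and> D \<le> ?m * q + q * (?n - 1) \<and> q \<ge> 1"
    if x: "\<tau> \<noteq> 0" "poly a x = \<tau> ^ ?n" "poly b x \<noteq> 0" "q = Polynomial.order (poly b x / \<tau> ^ ?m) g" for x \<tau> q
  proof -
    define \<rho> where "\<rho> = poly b x / \<tau> ^ ?m"
    have "\<rho> \<noteq> 0" using x by (simp add: \<rho>_def)
    let ?Z = "(\<lambda>\<eta>. \<rho> / \<eta>) ` {\<eta>. \<eta> ^ p = 1}"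
    have fin: "finite {\<eta>::complex. \<eta> ^ p = 1}" using \<open>p \<ge> 1\<close> by (intro finite_roots_unity) auto
    have "card ?Z * q \<le> degree g"
    proof (rule degree_ge_sum_order[OF \<open>g \<noteq> 0\<close>])
      fix z assume "z \<in> ?Z"
      then obtain \<eta> where \<eta>: "\<eta> ^ p = 1" "z = \<rho> / \<eta>" by auto
      have "\<eta> \<noteq> 0" using \<eta>(1) \<open>p \<ge> 1\<close> by (auto simp: power_0_left)
      \<comment> \<open>Exponents j occurring in g satisfy m j = D modulo n; after division by
        gcd(n, m) they agree modulo p, so the substitution multiplies g by the single factor
        \<open>\<eta> ^ j0\<close>.\<close>
      have per: "\<eta> ^ j = \<eta> ^ k" if "coeff g j \<noteq> 0" "coeff g k \<noteq> 0" "j \<le> k" for j k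
      proof -
        have d: "?n dvd D - ?m * j" "?n dvd D - ?m * k" "?m * k \<le> D"
          using that by (auto simp: g_def coeff_top_form split: if_splits)
        have "?m * j \<le> ?m * k" using that(3) by simp
        then have "(D - ?m * j) - (D - ?m * k) = ?m * (k - j)" using d(3) by (simp add: diff_mult_distrib2)
        then have "?n dvd ?m * (k - j)" using dvd_diff_nat[OF d(1,2)] by simp
        then have "gg * p dvd gg * (s * (k - j))" using ps by (simp add: mult.assoc)
        then have "p dvd s * (k - j)" using gg(2) by simp
        then have "p dvd k - j" using ps(3) by (simp add: coprime_dvd_mult_right_iff)
        then obtain l where "k - j = p * l" ..
        then have "k = j + p * l" using that(3) by simp
        then show ?thesis using \<eta> by (simp add: power_add power_mult)
      qed
      have "coeff (g \<circ>\<^sub>p [:0, \<eta>:]) j = coeff (smult (\<eta> ^ j0) g) j" for j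
      proof (cases "coeff g j = 0")
        case False
        then have "\<eta> ^ j = \<eta> ^ j0" using per[of j j0] per[of j0 j] \<open>coeff g j0 \<noteq> 0\<close> by (metis nle_le)
        then show ?thesis by (simp add: coeff_pcompose_linear)
      qed (simp add: coeff_pcompose_linear)
      then have "g \<circ>\<^sub>p [:0, \<eta>:] = smult (\<eta> ^ j0) g" by (rule poly_eqI)
      from order_pcompose_scale[OF \<open>g \<noteq> 0\<close> \<open>\<eta> \<noteq> 0\<close> this, of \<rho>]
      show "q \<le> Polynomial.order z g" using x \<eta> by (simp add: \<rho>_def)
    qed (use fin in auto)
    moreover have "inj_on (\<lambda>\<eta>. \<rho> / \<eta>) {\<eta>. \<eta> ^ p = 1}"
      using \<open>\<rho> \<noteq> 0\<close> \<open>p \<ge> 1\<close> by (auto simp: inj_on_def divide_simps split: if_splits)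
    then have "card ?Z = p" using card_roots_unity_eq[of p] \<open>p \<ge> 1\<close> by (simp add: card_image)
    ultimately have "p * q \<le> degree g" by simp
    moreover have "coeff g (degree g) \<noteq> 0" using \<open>g \<noteq> 0\<close> by simp
    then have "?m * degree g \<le> D" by (auto simp: g_def coeff_top_form split: if_splits)
    ultimately have 1: "?m * (p * q) \<le> D" by (meson le_trans mult_le_mono2)
    then have mq: "?m * q \<le> D" using \<open>p \<ge> 1\<close> by (metis le_trans mult_le_mono2 mult.commute mult_1_right)
    let ?F = "(pderiv ^^ q) G"
    have "poly (coeff (bisubst ?F P Q) (D - ?m * q)) x = 
       \<tau> ^ (D - ?m * q) * poly ((pderiv ^^ q) g) \<rho>"
      using poly_coeff_bisubst_top[of P Q "D - ?m * q" ?F \<tau> x] top_form_higher_pderiv[OF w mq] n m x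
      by (simp add: a_def b_def \<rho>_def g_def)
    moreover have "poly ((pderiv ^^ q) g) \<rho> \<noteq> 0"
      using poly_higher_pderiv_order[OF \<open>g \<noteq> 0\<close>] x by (simp add: \<rho>_def)
    ultimately have "coeff (bisubst ?F P Q) (D - ?m * q) \<noteq> 0" using x(1) by auto
    then have "D - ?m * q \<le> degree (bisubst ?F P Q)" by (rule le_degree)
    also have "\<dots> \<le> degree (bisubst G P Q) + q * (?n - 1)" by (rule degree_bisubst_pderiv[OF n J])
    also have "degree (bisubst G P Q) = 0" by (simp add: G)
    finally have 2: "D \<le> ?m * q + q * (?n - 1)" by simp
    \<comment> \<open>With q = 0 the bound would read D = 0. Positivity of q means that \<rho> is a
      root of g, which the comparison of leading coefficients relies on.\<close>
    with Dpos have "q \<ge> 1" by (auto intro: Nat.gr0I simp: Suc_le_eq)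
    with 1 2 show ?thesis by simp
  qed
  have tau: "\<exists>\<tau>. \<tau> \<noteq> 0 \<and> poly a x = \<tau> ^ ?n" if "poly a x \<noteq> 0" for x
    using that n by (metis bot_nat_0.not_eq_extremum le_numeral_extra(2) nth_root_exists power_0_left not_one_le_zero)
  have "infinite (- {x. poly (a * b) x = 0})" 
    using ab poly_roots_finite[of "a * b"] by (metis Compl_eq_Diff_UNIV Diff_infinite_finite infinite_UNIV_char_0 mult_eq_0_iff)
  then have "- {x. poly (a * b) x = 0} \<noteq> {}" by (rule infinite_imp_nonempty)
  then obtain x where x: "poly a x \<noteq> 0" "poly b x \<noteq> 0" by auto
  obtain \<tau> where \<tau>: "\<tau> \<noteq> 0" "poly a x = \<tau> ^ ?n" using tau x by auto
  obtain q where q: "?m * (p * q) \<le> D" "D \<le> ?m * q + q * (?n - 1)" "q \<ge> 1" using main[OF \<tau> x(2) refl] by blast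
  \<comment> \<open>The two bounds on D give m p < m + n, that is s p < s + p after division by the
    gcd, which fails as soon as both numbers are at least 2.\<close>
  have small: "p = 1 \<or> s = 1"
  proof (rule ccontr)
    assume "\<not> (p = 1 \<or> s = 1)"
    then have "p \<ge> 2" "s \<ge> 2" using \<open>p \<ge> 1\<close> \<open>s \<ge> 1\<close> by auto
    have "q * (?m * p) \<le> q * (?m + (?n - 1))" using q(1,2) by (simp add: algebra_simps)
    then have "?m * p \<le> ?m + (?n - 1)" using q(3) by simp
    then have "?m * p < ?m + ?n" using n by linarith
    then have "gg * (s * p) < gg * (s + p)" unfolding ps by (simp add: algebra_simps)
    then have "s * p < s + p" by simp
    moreover obtain s' p' where "s = s' + 2" "p = p' + 2" using \<open>p \<ge> 2\<close> \<open>s \<ge> 2\<close> by (metis le_add_diff_inverse2)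
    ultimately show False by (simp add: algebra_simps)
  qed
  \<comment> \<open>Since m p = n s, the quotient b^p / a^s equals \<rho>^p at each good point x,
    whatever root \<tau> was taken. As \<rho> is a root of g, only finitely many values
    occur.\<close>
  have "\<exists>r\<in>(\<lambda>z. z ^ p) ` {z. poly g z = 0}. b ^ p = smult r (a ^ s)"
  proof (rule eq_smult_if_finitely_many_ratios[of "a * b"])
    fix x assume "poly (a * b) x \<noteq> 0"
    then have x: "poly a x \<noteq> 0" "poly b x \<noteq> 0" by auto
    obtain \<tau> where \<tau>: "\<tau> \<noteq> 0" "poly a x = \<tau> ^ ?n" using tau x by auto
    define \<rho> where "\<rho> = poly b x / \<tau> ^ ?m"
    have "Polynomial.order \<rho> g \<ge> 1" using main[OF \<tau> x(2) refl] by (simp add: \<rho>_def)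
    then have "poly g \<rho> = 0" by (simp add: order_root)
    moreover have "poly (b ^ p) x = \<rho> ^ p * poly (a ^ s) x"
    proof -
      have "(\<tau> ^ ?m) ^ p = (\<tau> ^ ?n) ^ s" by (simp add: ps power_mult[symmetric] mult_ac)
      then show ?thesis using \<tau> by (simp add: \<rho>_def power_divide)
    qed
    ultimately show "\<exists>r\<in>(\<lambda>z. z ^ p) ` {z. poly g z = 0}. poly (b ^ p) x = r * poly (a ^ s) x" by auto
  qed (use ab poly_roots_finite[OF \<open>g \<noteq> 0\<close>] in auto)
  then obtain r where r: "b ^ p = smult r (a ^ s)" by auto
  then have "r \<noteq> 0" using ab by (metis power_not_zero smult_0_left)
  show ?thesis
  proof (cases "p = 1")
    case True
    have "b = smult r (a ^ s)" "?m = ?n * s" using True r ps by auto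
    then have "?m = ?n * s \<and> lead_coeff Q = smult r (lead_coeff P ^ s)" unfolding a_def b_def by (rule conjI[rotated])
    then show ?thesis by (intro exI disjI1)
  next
    case False
    then have "s = 1" using small by simp
    then have "smult (1 / r) (b ^ p) = smult (1 / r) (smult r a)" using r by simp
    then have "a = smult (1 / r) (b ^ p)" using \<open>r \<noteq> 0\<close> by simp
    moreover have "?n = ?m * p" using ps \<open>s = 1\<close> by simp
    ultimately have "?n = ?m * p \<and> lead_coeff P = smult (1 / r) (lead_coeff Q ^ p)" unfolding a_def b_def by (rule conjI[rotated])
    then show ?thesis by (intro exI disjI2)
  qed
qed

section \<open>Polynomial automorphisms of the plane\<close>

lemma endomorphisms_compose:
  assumes "f \<in> endomorphisms V" "g \<in> endomorphisms V"
  shows "compose (fst V) f g \<in> endomorphisms V"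
proof -
  obtain S R where V: "V = (S, R)" by (cases V)
  have f: "f \<in> S \<rightarrow> S" and g: "g \<in> S \<rightarrow> S" using assms by (auto simp: V endomorphisms_def PiE_def)
  have "compose S r (compose S f g) \<in> R" if "r \<in> R" for r
    using assms that by (subst compose_assoc[OF g]) (auto simp: V endomorphisms_def)
  then show ?thesis using funcset_compose[OF g f] by (auto simp: V endomorphisms_def PiE_def)
qed

lemma mult_BijGroup: "f \<in> Bij S \<Longrightarrow> g \<in> Bij S \<Longrightarrow> f \<otimes>\<^bsub>BijGroup S\<^esub> g = compose S f g"
  by (simp add: BijGroup_def)

text \<open>Extensionality of the regular functions makes the restricted identity pull each of them
  back to itself; closure under products is composition of pullbacks.\<close>

lemma Aut_subgroup: 
  assumes R: "snd V \<subseteq> extensional (fst V)"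
  shows "subgroup (carrier (Aut V)) (BijGroup (fst V))"
proof -
  define S where "S = fst V"
  interpret B: group "BijGroup S" by (rule group_BijGroup)
  have c: "carrier (BijGroup S) = Bij S" by (simp add: BijGroup_def)
  have "compose S f (\<lambda>x\<in>S. x) = f" if "f \<in> extensional S" for f :: "_ \<Rightarrow> complex"
    using that by (auto simp: compose_def fun_eq_iff extensional_def)
  then have one: "\<one>\<^bsub>BijGroup S\<^esub> \<in> endomorphisms V"
    using R by (auto simp: S_def BijGroup_def endomorphisms_def split: prod.splits)
  have "subgroup {\<phi> \<in> Bij S. \<phi> \<in> endomorphisms V \<and> inv\<^bsub>BijGroup S\<^esub> \<phi> \<in> endomorphisms V} (BijGroup S)"
  proof
    fix f g
    assume f: "f \<in> {\<phi> \<in> Bij S. \<phi> \<in> endomorphisms V \<and> inv\<^bsub>BijGroup S\<^esub> \<phi> \<in> endomorphisms V}"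
      and g: "g \<in> {\<phi> \<in> Bij S. \<phi> \<in> endomorphisms V \<and> inv\<^bsub>BijGroup S\<^esub> \<phi> \<in> endomorphisms V}"
    have i: "inv\<^bsub>BijGroup S\<^esub> f \<in> Bij S" "inv\<^bsub>BijGroup S\<^esub> g \<in> Bij S"
      using f g B.inv_closed by (auto simp: c)
    have "f \<otimes>\<^bsub>BijGroup S\<^esub> g \<in> Bij S" using B.m_closed f g by (auto simp: c)
    moreover have "f \<otimes>\<^bsub>BijGroup S\<^esub> g \<in> endomorphisms V" 
      using f g endomorphisms_compose[of f V g] by (simp add: mult_BijGroup S_def)
    moreover have "inv\<^bsub>BijGroup S\<^esub> (f \<otimes>\<^bsub>BijGroup S\<^esub> g) \<in> endomorphisms V"
      using f g i endomorphisms_compose[of _ V] B.inv_mult_group[of f g] by (simp add: c[unfolded S_def] mult_BijGroup S_def)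
    ultimately show "f \<otimes>\<^bsub>BijGroup S\<^esub> g \<in> {\<phi> \<in> Bij S. \<phi> \<in> endomorphisms V \<and> inv\<^bsub>BijGroup S\<^esub> \<phi> \<in> endomorphisms V}"
      by simp
    show "inv\<^bsub>BijGroup S\<^esub> f \<in> {\<phi> \<in> Bij S. \<phi> \<in> endomorphisms V \<and> inv\<^bsub>BijGroup S\<^esub> \<phi> \<in> endomorphisms V}"
      using f i by (auto simp: c[symmetric])
  qed (use one B.one_closed in \<open>auto simp: c\<close>)
  then show ?thesis by (simp add: Aut_def S_def)
qed

lemma Aut_eq: "Aut V = (BijGroup (fst V))\<lparr>carrier := carrier (Aut V)\<rparr>"
  by (simp add: Aut_def)

lemma group_Aut: "snd V \<subseteq> extensional (fst V) \<Longrightarrow> group (Aut V)"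
  by (subst Aut_eq) (intro group.subgroup_imp_group group_BijGroup Aut_subgroup)

section \<open>Polynomial self-maps of the plane\<close>

definition polymap :: "bipoly \<Rightarrow> bipoly \<Rightarrow> complex \<times> complex \<Rightarrow> complex \<times> complex" where
  "polymap P Q = (\<lambda>v. (eval2 P v, eval2 Q v))"

lemma polymap_comp: "polymap P Q \<circ> polymap P' Q' = polymap (bisubst P P' Q') (bisubst Q P' Q')"
  by (auto simp: polymap_def)

lemma polymap_id: "polymap X2 Y2 = id"
  by (auto simp: polymap_def fun_eq_iff)

lemma polymap_inj: "polymap P Q = polymap P' Q' \<longleftrightarrow> P = P' \<and> Q = Q'"
  by (auto simp: polymap_def fun_eq_iff intro: eval2_eqI)

text \<open>P and Q are the pullbacks of the two coordinate functions; conversely, pulling back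
  along a polynomial map is substitution.\<close>

lemma endomorphisms_A2: "endomorphisms A2 = {polymap P Q | P Q. True}"
proof (intro equalityI subsetI)
  fix f assume f: "f \<in> endomorphisms A2"
  then have "compose UNIV (eval2 p) f \<in> range eval2" for p by (auto simp: endomorphisms_def A2_def)
  then have "\<exists>q. eval2 p \<circ> f = eval2 q" for p by (auto simp: compose_def comp_def restrict_UNIV)
  then obtain P Q where "eval2 X2 \<circ> f = eval2 P" "eval2 Y2 \<circ> f = eval2 Q" by metis
  then have "f = polymap P Q" by (auto simp: polymap_def fun_eq_iff prod_eq_iff)
  then show "f \<in> {polymap P Q | P Q. True}" by auto
next
  fix f assume "f \<in> {polymap P Q | P Q. True}"
  then obtain P Q where f: "f = polymap P Q" by auto
  have "compose UNIV (eval2 p) f = eval2 (bisubst p P Q)" for p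
    by (auto simp: f compose_def polymap_def)
  then show "f \<in> endomorphisms A2" by (auto simp: endomorphisms_def A2_def)
qed

lemma Bij_UNIV: "Bij UNIV = {f. bij f}"
  by (auto simp: Bij_def)

lemma carrier_Aut_A2: "f \<in> carrier Aut_A2 \<longleftrightarrow> (\<exists>P Q P' Q'. f = polymap P Q \<and> polymap P Q \<circ> polymap P' Q' = id \<and> polymap P' Q' \<circ> polymap P Q = id)"
proof -
  have "f \<in> carrier Aut_A2 \<longleftrightarrow> bij f \<and> (\<exists>P Q. f = polymap P Q) \<and> (\<exists>P Q. inv_into UNIV f = polymap P Q)"
    by (auto simp: Aut_def inv_BijGroup Bij_UNIV endomorphisms_A2 A2_def[THEN arg_cong, of fst] restrict_UNIV) blast+
  also have "\<dots> \<longleftrightarrow> (\<exists>P Q P' Q'. f = polymap P Q \<and> polymap P Q \<circ> polymap P' Q' = id \<and> polymap P' Q' \<circ> polymap P Q = id)"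
  proof safe
    fix P Q P' Q' assume *: "bij (polymap P Q)" "inv_into UNIV (polymap P Q) = polymap P' Q'"
    show "\<exists>Pa Qa P' Q'. polymap P Q = polymap Pa Qa \<and> polymap Pa Qa \<circ> polymap P' Q' = id \<and> polymap P' Q' \<circ> polymap Pa Qa = id"
      using *(1) by (intro exI[of _ P] exI[of _ Q] exI[of _ P'] exI[of _ Q'])
        (auto simp: *(2)[symmetric] bij_is_inj bij_is_surj surj_iff[symmetric])
  next
    fix P Q P' Q' assume *: "polymap P Q \<circ> polymap P' Q' = id" "polymap P' Q' \<circ> polymap P Q = id"
    then show "bij (polymap P Q)" using o_bij by blast
    from * have "inv_into UNIV (polymap P Q) = polymap P' Q'" using inv_unique_comp by blast
    then show "\<exists>Pa Qa. inv_into UNIV (polymap P Q) = polymap Pa Qa" by blast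
  qed auto
  finally show ?thesis .
qed

interpretation AG: group Aut_A2
  by (rule group_Aut) (simp add: A2_def)

lemma fst_A2 [simp]: "fst A2 = UNIV"
  by (simp add: A2_def)

lemma carrier_bij: "f \<in> carrier Aut_A2 \<Longrightarrow> bij f"
  by (simp add: Aut_def Bij_UNIV)

lemma one_Aut_A2 [simp]: "\<one>\<^bsub>Aut_A2\<^esub> = id"
  by (auto simp: Aut_def BijGroup_def)

lemma mult_Aut_A2: "f \<in> carrier Aut_A2 \<Longrightarrow> g \<in> carrier Aut_A2 \<Longrightarrow> f \<otimes>\<^bsub>Aut_A2\<^esub> g = f \<circ> g"
  using carrier_bij[of f] carrier_bij[of g] by (auto simp: Aut_def BijGroup_def Bij_UNIV compose_def)

lemma inv_Aut_A2I: "f \<in> carrier Aut_A2 \<Longrightarrow> g \<in> carrier Aut_A2 \<Longrightarrow> g \<circ> f = id \<Longrightarrow> inv\<^bsub>Aut_A2\<^esub> f = g"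
  by (intro AG.inv_equality) (auto simp: mult_Aut_A2)

lemma comp_closed: "f \<in> carrier Aut_A2 \<Longrightarrow> g \<in> carrier Aut_A2 \<Longrightarrow> f \<circ> g \<in> carrier Aut_A2"
  using AG.m_closed[of f g] by (simp add: mult_Aut_A2)

lemma inv_comp: 
  assumes "f \<in> carrier Aut_A2" 
  shows "inv\<^bsub>Aut_A2\<^esub> f \<circ> f = id" "f \<circ> inv\<^bsub>Aut_A2\<^esub> f = id"
  using assms AG.l_inv[of f] AG.r_inv[of f] by (auto simp: mult_Aut_A2)

lemma Aut_A2I: "f = polymap P Q \<Longrightarrow> g = polymap P' Q' \<Longrightarrow> f \<circ> g = id \<Longrightarrow> g \<circ> f = id \<Longrightarrow> f \<in> carrier Aut_A2"
  unfolding carrier_Aut_A2 by blast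

text \<open>Inverses taken inside H are polynomial again, so the elements of H are automatically
  automorphisms of the plane.\<close>

lemma subgroup_Aut_A2I:
  assumes "id \<in> H" and pm: "\<And>f. f \<in> H \<Longrightarrow> \<exists>P Q. f = polymap P Q" 
    and comp: "\<And>f g. f \<in> H \<Longrightarrow> g \<in> H \<Longrightarrow> f \<circ> g \<in> H"
    and inv: "\<And>f. f \<in> H \<Longrightarrow> \<exists>g\<in>H. f \<circ> g = id \<and> g \<circ> f = id"
  shows "subgroup H Aut_A2"
proof -
  have c: "f \<in> carrier Aut_A2" if "f \<in> H" for f
    using inv[OF that] pm that by (metis Aut_A2I)
  show ?thesis
  proof
    show "inv\<^bsub>Aut_A2\<^esub> f \<in> H" if "f \<in> H" for f
      using inv[OF that] inv_Aut_A2I[of f] c that by force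
  qed (use assms c in \<open>auto simp: mult_Aut_A2\<close>)
qed

section \<open>Linear and triangular subgroups\<close>

definition linear_map :: "complex \<Rightarrow> complex \<Rightarrow> complex \<Rightarrow> complex \<Rightarrow> complex \<times> complex \<Rightarrow> complex \<times> complex" where
  "linear_map a b c d = (\<lambda>(x, y). (a * x + b * y, c * x + d * y))"

lemma linear_map_polymap: "linear_map a b c d = polymap (const2 a * X2 + const2 b * Y2) (const2 c * X2 + const2 d * Y2)"
  by (auto simp: linear_map_def polymap_def)

lemma GL2_linear_map: "GL2 = {linear_map a b c d | a b c d. a * d - b * c \<noteq> 0}"
  by (simp add: GL2_def linear_map_def)

lemma subgroup_GL2: "subgroup GL2 Aut_A2"
proof (rule subgroup_Aut_A2I)
  show "id \<in> GL2" unfolding GL2_linear_map by (intro CollectI exI[of _ 1] exI[of _ 0]) (auto simp: linear_map_def fun_eq_iff)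
  show "\<exists>P Q. f = polymap P Q" if "f \<in> GL2" for f using that by (auto simp: GL2_linear_map linear_map_polymap)
next
  fix f g assume "f \<in> GL2" "g \<in> GL2"
  then obtain a b c d a' b' c' d' where f: "f = linear_map a b c d" "a * d - b * c \<noteq> 0" and g: "g = linear_map a' b' c' d'" "a' * d' - b' * c' \<noteq> 0"
    by (auto simp: GL2_linear_map)
  have "f \<circ> g = linear_map (a * a' + b * c') (a * b' + b * d') (c * a' + d * c') (c * b' + d * d')"
    by (auto simp: f g linear_map_def fun_eq_iff algebra_simps)
  moreover have "(a * a' + b * c') * (c * b' + d * d') - (a * b' + b * d') * (c * a' + d * c') = (a * d - b * c) * (a' * d' - b' * c')"
    by (simp add: algebra_simps)
  ultimately show "f \<circ> g \<in> GL2" using f g unfolding GL2_linear_map by (metis (mono_tags, lifting) CollectI mult_eq_0_iff)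
next
  fix f assume "f \<in> GL2"
  then obtain a b c d where f: "f = linear_map a b c d" and D: "a * d - b * c \<noteq> 0" by (auto simp: GL2_linear_map)
  define D where "D = a * d - b * c"
  have D0: "D \<noteq> 0" "a * d = D + b * c" using D by (auto simp: D_def)
  let ?g = "linear_map (d / D) (- b / D) (- c / D) (a / D)"
  have "(d / D) * (a / D) - (- b / D) * (- c / D) = 1 / D" using D0 by (simp add: field_simps)
  then have "?g \<in> GL2" unfolding GL2_linear_map using D0 by (metis (mono_tags, lifting) CollectI divide_eq_0_iff one_neq_zero)
  moreover have "f \<circ> ?g = id" "?g \<circ> f = id" using D0(1)
    by (auto simp: f linear_map_def fun_eq_iff field_simps) (use D0(2) in \<open>simp_all add: algebra_simps\<close>)
  ultimately show "\<exists>g\<in>GL2. f \<circ> g = id \<and> g \<circ> f = id" by blast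
qed

definition jonq_p :: "complex \<Rightarrow> complex poly \<Rightarrow> complex \<Rightarrow> complex \<times> complex \<Rightarrow> complex \<times> complex" where
  "jonq_p a f b = (\<lambda>(x, y). (a * x + poly f y, b * y))"
definition jonq_m :: "complex \<Rightarrow> complex poly \<Rightarrow> complex \<Rightarrow> complex \<times> complex \<Rightarrow> complex \<times> complex" where
  "jonq_m a f b = (\<lambda>(x, y). (a * x, b * y + poly f x))"

lemma eval2_in_y: "eval2 (map_poly (\<lambda>c. [:c:]) f) v = poly f (snd v)"
  by (induction f) (auto simp: map_poly_pCons)

lemma jonq_p_polymap: "jonq_p a f b = polymap (const2 a * X2 + map_poly (\<lambda>c. [:c:]) f) (const2 b * Y2)"
  by (auto simp: jonq_p_def polymap_def eval2_in_y)

lemma jonq_m_polymap: "jonq_m a f b = polymap (const2 a * X2) (const2 b * Y2 + [:f:])"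
  by (auto simp: jonq_m_def polymap_def)

lemma Jonq_plus_jonq_p: "Jonq_plus = {jonq_p a f b | a f b. a \<noteq> 0 \<and> b \<noteq> 0}"
  by (auto simp: Jonq_plus_def jonq_p_def)
lemma Jonq_minus_jonq_m: "Jonq_minus = {jonq_m a f b | a f b. a \<noteq> 0 \<and> b \<noteq> 0}"
  by (auto simp: Jonq_minus_def jonq_m_def)

lemma jonq_p_comp: "jonq_p a f b \<circ> jonq_p a' f' b' = jonq_p (a * a') (smult a f' + f \<circ>\<^sub>p [:0, b':]) (b * b')"
  by (auto simp: jonq_p_def fun_eq_iff poly_pcompose algebra_simps)
lemma jonq_m_comp: "jonq_m a f b \<circ> jonq_m a' f' b' = jonq_m (a * a') (smult b f' + f \<circ>\<^sub>p [:0, a':]) (b * b')"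
  by (auto simp: jonq_m_def fun_eq_iff poly_pcompose algebra_simps)

lemma subgroup_Jonq_plus: "subgroup Jonq_plus Aut_A2"
proof (rule subgroup_Aut_A2I)
  show "id \<in> Jonq_plus" unfolding Jonq_plus_jonq_p by (intro CollectI exI[of _ 1] exI[of _ 0]) (auto simp: jonq_p_def fun_eq_iff)
  show "\<exists>P Q. f = polymap P Q" if "f \<in> Jonq_plus" for f using that by (auto simp: Jonq_plus_jonq_p jonq_p_polymap)
  show "f \<circ> g \<in> Jonq_plus" if "f \<in> Jonq_plus" "g \<in> Jonq_plus" for f g
    using that unfolding Jonq_plus_jonq_p by (auto simp: jonq_p_comp) (metis no_zero_divisors)
next
  fix f assume "f \<in> Jonq_plus"
  then obtain a p b where f: "f = jonq_p a p b" "a \<noteq> 0" "b \<noteq> 0" by (auto simp: Jonq_plus_jonq_p)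
  let ?g = "jonq_p (1 / a) (smult (- 1 / a) (p \<circ>\<^sub>p [:0, 1 / b:])) (1 / b)"
  have "?g \<in> Jonq_plus" unfolding Jonq_plus_jonq_p using f(2,3) by (intro CollectI exI conjI) (rule refl, auto)
  moreover have "f \<circ> ?g = id" "?g \<circ> f = id" using f(2,3)
    by (auto simp: f(1) jonq_p_def fun_eq_iff poly_pcompose field_simps)
  ultimately show "\<exists>g\<in>Jonq_plus. f \<circ> g = id \<and> g \<circ> f = id" by blast
qed

lemma subgroup_Jonq_minus: "subgroup Jonq_minus Aut_A2"
proof (rule subgroup_Aut_A2I)
  show "id \<in> Jonq_minus" unfolding Jonq_minus_jonq_m by (intro CollectI exI[of _ 1] exI[of _ 0]) (auto simp: jonq_m_def fun_eq_iff)
  show "\<exists>P Q. f = polymap P Q" if "f \<in> Jonq_minus" for f using that by (auto simp: Jonq_minus_jonq_m jonq_m_polymap)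
  show "f \<circ> g \<in> Jonq_minus" if "f \<in> Jonq_minus" "g \<in> Jonq_minus" for f g
    using that unfolding Jonq_minus_jonq_m by (auto simp: jonq_m_comp) (metis no_zero_divisors)
next
  fix f assume "f \<in> Jonq_minus"
  then obtain a p b where f: "f = jonq_m a p b" "a \<noteq> 0" "b \<noteq> 0" by (auto simp: Jonq_minus_jonq_m)
  let ?g = "jonq_m (1 / a) (smult (- 1 / b) (p \<circ>\<^sub>p [:0, 1 / a:])) (1 / b)"
  have "?g \<in> Jonq_minus" unfolding Jonq_minus_jonq_m using f(2,3) by (intro CollectI exI conjI) (rule refl, auto)
  moreover have "f \<circ> ?g = id" "?g \<circ> f = id" using f(2,3)
    by (auto simp: f(1) jonq_m_def fun_eq_iff poly_pcompose field_simps)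
  ultimately show "\<exists>g\<in>Jonq_minus. f \<circ> g = id \<and> g \<circ> f = id" by blast
qed

section \<open>The cyclic group and its normalizer\<close>

definition scale_vars :: "complex \<Rightarrow> complex \<Rightarrow> bipoly \<Rightarrow> bipoly" where
  "scale_vars a b p = map_poly (\<lambda>r. r \<circ>\<^sub>p [:0, a:]) p \<circ>\<^sub>p [:0, [:b:]:]"

lemma eval2_scale_vars: "eval2 (scale_vars a b p) v = eval2 p (a * fst v, b * snd v)"
  by (induction p) (auto simp: scale_vars_def map_poly_pCons pcompose_pCons poly_pcompose mult_ac)

lemma coeff_scale_vars: "coeff (coeff (scale_vars a b p) j) i = a ^ i * b ^ j * coeff (coeff p j) i"
  by (simp add: scale_vars_def coeff_pcompose_linear coeff_map_poly poly_const_pow)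

text \<open>A diagonal map acts on each monomial by a scalar, so semi-invariance can be tested
  monomial by monomial.\<close>

lemma eval2_scale_vars_eq_iff:
  "(\<forall>v. eval2 p (a * fst v, b * snd v) = c * eval2 p v) \<longleftrightarrow>
   (\<forall>i j. coeff (coeff p j) i \<noteq> 0 \<longrightarrow> a ^ i * b ^ j = c)"
proof -
  have "(\<forall>v. eval2 p (a * fst v, b * snd v) = c * eval2 p v) \<longleftrightarrow> scale_vars a b p = const2 c * p"
    using eval2_eqI[of "scale_vars a b p" "const2 c * p"] eval2_scale_vars[of a b p] by (auto simp del: mult_pCons_left)
  also have "\<dots> \<longleftrightarrow> (\<forall>i j. coeff (coeff (scale_vars a b p) j) i = coeff (coeff (const2 c * p) j) i)"
    by (auto simp: poly_eq_iff)
  also have "\<dots> \<longleftrightarrow> (\<forall>i j. coeff (coeff p j) i \<noteq> 0 \<longrightarrow> a ^ i * b ^ j = c)"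
    by (auto simp: coeff_scale_vars)
  finally show ?thesis .
qed

locale cyclic_quotient =
  fixes d e :: nat
  assumes cop: "coprime d e" and e1: "1 \<le> e" and ed: "e < d"
begin

definition zeta :: complex where "zeta = root_of_unity d"

lemma d_pos: "d > 0" using ed by simp

lemma zeta_power: "zeta ^ n = cis (2 * pi * real n / real d)"
  by (simp add: zeta_def root_of_unity_def cis_conv_exp exp_of_nat_mult[symmetric] field_simps)

lemma zeta_d [simp]: "zeta ^ d = 1"
  using d_pos by (simp add: zeta_power)

lemma zeta_power_mod: "zeta ^ (n mod d) = zeta ^ n"
proof -
  have "zeta ^ n = zeta ^ (d * (n div d) + n mod d)" by simp
  also have "\<dots> = zeta ^ (n mod d)" unfolding power_add power_mult by simp
  finally show ?thesis by simp
qed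

lemma zeta_eq_1_iff: "zeta ^ n = 1 \<longleftrightarrow> d dvd n"
proof
  assume "zeta ^ n = 1"
  then have "cis (2 * pi * real (n mod d) / real d) = cis (2 * pi * real 0 / real d)" using zeta_power[of "n mod d"] by (simp add: zeta_power_mod)
  then have "n mod d = 0" using d_pos
    by (intro inj_onD[OF bij_betw_imp_inj_on[OF bij_betw_roots_unity[OF d_pos]]]) auto
  then show "d dvd n" by auto
qed (auto simp: power_mult)

lemma zeta_nonzero [simp]: "zeta \<noteq> 0"
  using zeta_d d_pos by (metis power_0_left one_neq_zero neq0_conv)

lemma zeta_eq_iff: "zeta ^ m = zeta ^ n \<longleftrightarrow> [m = n] (mod d)"
proof (induction m n rule: linorder_wlog)
  case (le m n)
  have "zeta ^ n = zeta ^ m * zeta ^ (n - m)" using le by (simp flip: power_add)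
  then have "zeta ^ m = zeta ^ n \<longleftrightarrow> zeta ^ (n - m) = 1" by auto
  also have "\<dots> \<longleftrightarrow> [m = n] (mod d)" using le zeta_eq_1_iff cong_altdef_nat[of m n d] by (auto simp: cong_sym_eq)
  finally show ?case .
qed (metis cong_sym)

lemma roots_of_unity: "w ^ d = 1 \<Longrightarrow> \<exists>k. w = zeta ^ k"
  using bij_betw_imp_surj_on[OF bij_betw_roots_unity[OF d_pos]] by (auto simp: zeta_power)

lemma d_not_dvd_e: "\<not> d dvd e"
  using e1 ed by (auto dest: dvd_imp_le)

definition gen_pow :: "nat \<Rightarrow> complex \<times> complex \<Rightarrow> complex \<times> complex" where
  "gen_pow k = (\<lambda>v. (zeta ^ (e * k) * fst v, zeta ^ k * snd v))"

lemma gen_pow_linear_map: "gen_pow k = linear_map (zeta ^ (e * k)) 0 0 (zeta ^ k)"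
  by (auto simp: gen_pow_def linear_map_def)

lemma gen_pow_comp: "gen_pow k \<circ> gen_pow l = gen_pow (k + l)"
  by (auto simp: gen_pow_def power_add algebra_simps)

lemma gen_pow_0 [simp]: "gen_pow 0 = id" by (auto simp: gen_pow_def)

lemma gen_pow_eq_iff: "gen_pow k = gen_pow l \<longleftrightarrow> [k = l] (mod d)"
proof
  assume "gen_pow k = gen_pow l"
  then have "gen_pow k (1, 1) = gen_pow l (1, 1)" by simp
  then show "[k = l] (mod d)" by (simp add: gen_pow_def zeta_eq_iff)
next
  assume *: "[k = l] (mod d)"
  then have "[e * k = e * l] (mod d)" by (intro cong_mult cong_refl)
  with * have "zeta ^ (e * k) = zeta ^ (e * l)" "zeta ^ k = zeta ^ l" by (simp_all only: zeta_eq_iff)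
  then show "gen_pow k = gen_pow l" by (auto simp: gen_pow_def)
qed

lemma gen_gen_pow: "gen d e = gen_pow 1"
  by (auto simp: gen_def gen_pow_def zeta_def)

lemma gen_pow_GL2: "gen_pow k \<in> GL2"
  unfolding GL2_linear_map gen_pow_linear_map by (intro CollectI exI conjI) (rule refl, simp)

lemma gen_pow_carrier: "gen_pow k \<in> carrier Aut_A2"
  using gen_pow_GL2 subgroup.mem_carrier[OF subgroup_GL2] by blast

text \<open>Exponents are natural numbers, and k (d - 1) represents -k modulo d.\<close>

lemma gen_pow_inv: "gen_pow k \<circ> gen_pow (k * (d - 1)) = id" "gen_pow (k * (d - 1)) \<circ> gen_pow k = id"
proof -
  have "k + k * (d - 1) = k * d" using d_pos by (metis Suc_pred' mult_Suc_right One_nat_def)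
  then have "gen_pow (k + k * (d - 1)) = gen_pow 0" by (simp only: gen_pow_eq_iff) (simp add: cong_0_iff)
  then show "gen_pow k \<circ> gen_pow (k * (d - 1)) = id" "gen_pow (k * (d - 1)) \<circ> gen_pow k = id"
    by (simp_all add: gen_pow_comp add.commute)
qed

lemma subgroup_range_gen_pow: "subgroup (range gen_pow) Aut_A2"
proof (rule subgroup_Aut_A2I)
  show "id \<in> range gen_pow" by (metis gen_pow_0 rangeI)
  show "\<exists>P Q. f = polymap P Q" if "f \<in> range gen_pow" for f using that by (auto simp: gen_pow_linear_map linear_map_polymap)
  show "f \<circ> g \<in> range gen_pow" if "f \<in> range gen_pow" "g \<in> range gen_pow" for f g using that by (auto simp: gen_pow_comp)
  show "\<exists>g\<in>range gen_pow. f \<circ> g = id \<and> g \<circ> f = id" if "f \<in> range gen_pow" for f using that gen_pow_inv by blast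
qed

lemma G_eq: "G_grp d e = range gen_pow"
proof
  interpret L: group "Aut_A2\<lparr>carrier := GL2\<rparr>" by (rule AG.subgroup_imp_group[OF subgroup_GL2])
  have "subgroup (range gen_pow) (Aut_A2\<lparr>carrier := GL2\<rparr>)"
    by (rule AG.subgroup_incl[OF subgroup_range_gen_pow subgroup_GL2]) (auto intro: gen_pow_GL2)
  then show "G_grp d e \<subseteq> range gen_pow" unfolding G_grp_def by (intro L.generate_subgroup_incl) (auto simp: gen_gen_pow)
  have "gen_pow k \<in> G_grp d e" for k
  proof (induction k)
    case 0
    have "\<one>\<^bsub>Aut_A2\<lparr>carrier := GL2\<rparr>\<^esub> \<in> G_grp d e" unfolding G_grp_def by (rule generate.one)
    then show ?case by (simp add: id_def)
  next
    case (Suc k)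
    have "gen_pow 1 \<in> G_grp d e" unfolding G_grp_def gen_gen_pow by (rule generate.incl) simp
    with Suc have "gen_pow k \<otimes>\<^bsub>Aut_A2\<lparr>carrier := GL2\<rparr>\<^esub> gen_pow 1 \<in> G_grp d e" unfolding G_grp_def by (intro generate.eng)
    then show ?case by (simp add: mult_Aut_A2 gen_pow_carrier gen_pow_comp)
  qed
  then show "range gen_pow \<subseteq> G_grp d e" by blast
qed

lemma finite_G: "finite (range gen_pow)"
proof -
  have "range gen_pow \<subseteq> gen_pow ` {..<d}"
  proof safe
    fix k
    have "gen_pow k = gen_pow (k mod d)" unfolding gen_pow_eq_iff by (simp add: cong_def)
    then show "gen_pow k \<in> gen_pow ` {..<d}" using d_pos by auto
  qed
  then show ?thesis by (rule finite_subset) simp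
qed

lemma conj_power: 
  assumes k: "f \<circ> gen_pow 1 = gen_pow k \<circ> f" shows "f \<circ> gen_pow j = gen_pow (k * j) \<circ> f"
proof (induction j)
  case (Suc j)
  have "f \<circ> gen_pow (Suc j) = (f \<circ> gen_pow j) \<circ> gen_pow 1" unfolding comp_assoc gen_pow_comp by simp
  also have "\<dots> = gen_pow (k * j) \<circ> (f \<circ> gen_pow 1)" unfolding Suc comp_assoc ..
  also have "\<dots> = gen_pow (k * j + k) \<circ> f" unfolding k gen_pow_comp[symmetric] comp_assoc ..
  finally show ?case by (simp add: add.commute)
qed simp

text \<open>If f carries the generator to a power of it, conjugation maps G into itself; being
  injective on a finite set, it is then onto.\<close>

lemma normalizer_iff:
  assumes L: "subgroup L Aut_A2" and G: "range gen_pow \<subseteq> L"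
  shows "f \<in> normalizer (Aut_A2\<lparr>carrier := L\<rparr>) (range gen_pow) \<longleftrightarrow> f \<in> L \<and> (\<exists>k. f \<circ> gen_pow 1 = gen_pow k \<circ> f)"
proof (cases "f \<in> L")
  case True
  then have fc: "f \<in> carrier Aut_A2" using subgroup.mem_carrier[OF L] by blast
  define f' where "f' = inv\<^bsub>Aut_A2\<^esub> f"
  have f'c: "f' \<in> carrier Aut_A2" using fc by (simp add: f'_def)
  have ff': "f' \<circ> f = id" "f \<circ> f' = id" using inv_comp[OF fc] by (auto simp: f'_def)
  have "f <#\<^bsub>Aut_A2\<lparr>carrier := L\<rparr>\<^esub> range gen_pow #>\<^bsub>Aut_A2\<lparr>carrier := L\<rparr>\<^esub> inv\<^bsub>Aut_A2\<lparr>carrier := L\<rparr>\<^esub> f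
      = (\<lambda>g. f \<circ> g \<circ> f') ` range gen_pow"
    using AG.m_inv_consistent[OF L True] fc f'c gen_pow_carrier
    by (auto simp: l_coset_def r_coset_def mult_Aut_A2 comp_closed f'_def[symmetric])
  then have "f \<in> normalizer (Aut_A2\<lparr>carrier := L\<rparr>) (range gen_pow) \<longleftrightarrow> (\<lambda>g. f \<circ> g \<circ> f') ` range gen_pow = range gen_pow"
    using True G by (simp add: normalizer_def stabilizer_def)
  also have "\<dots> \<longleftrightarrow> (\<exists>k. f \<circ> gen_pow 1 = gen_pow k \<circ> f)"
  proof
    assume "(\<lambda>g. f \<circ> g \<circ> f') ` range gen_pow = range gen_pow"
    then obtain k where "f \<circ> gen_pow 1 \<circ> f' = gen_pow k" by blast
    then have "gen_pow k \<circ> f = f \<circ> gen_pow 1" using ff' by (metis comp_assoc comp_id)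
    then show "\<exists>k. f \<circ> gen_pow 1 = gen_pow k \<circ> f" by metis
  next
    assume "\<exists>k. f \<circ> gen_pow 1 = gen_pow k \<circ> f"
    then obtain k where k: "f \<circ> gen_pow 1 = gen_pow k \<circ> f" by blast
    have "f \<circ> gen_pow j \<circ> f' = gen_pow (k * j)" for j using ff' unfolding conj_power[OF k] comp_assoc by simp
    then have into: "(\<lambda>g. f \<circ> g \<circ> f') ` range gen_pow \<subseteq> range gen_pow" by auto
    have "inj_on (\<lambda>g. f \<circ> g \<circ> f') (range gen_pow)"
    proof (rule inj_on_inverseI)
      fix g show "f' \<circ> (f \<circ> g \<circ> f') \<circ> f = g" using ff' by (metis comp_assoc comp_id id_comp)
    qed
    then show "(\<lambda>g. f \<circ> g \<circ> f') ` range gen_pow = range gen_pow" using endo_inj_surj[OF finite_G into] by blast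
  qed
  finally show ?thesis using True by simp
qed (auto simp: normalizer_def stabilizer_def)

lemma N_aut_iff: "f \<in> N_aut d e \<longleftrightarrow> f \<in> carrier Aut_A2 \<and> (\<exists>k. f \<circ> gen_pow 1 = gen_pow k \<circ> f)"
  using normalizer_iff[OF AG.subgroup_self] gen_pow_carrier by (simp add: N_aut_def G_eq image_subset_iff)

lemma N_lin_eq: "N_lin d e = N_aut d e \<inter> GL2"
  using normalizer_iff[OF subgroup_GL2] gen_pow_GL2 subgroup.mem_carrier[OF subgroup_GL2]
  by (auto simp: N_lin_def G_eq N_aut_iff image_subset_iff)

lemma subgroup_N_aut: "subgroup (N_aut d e) Aut_A2"
  unfolding N_aut_def G_eq by (rule AG.normalizer_imp_subgroup) (auto intro: gen_pow_carrier)

lemma gen_pow_N_aut: "gen_pow k \<in> N_aut d e"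
  unfolding N_aut_iff using gen_pow_carrier by (auto simp: gen_pow_comp intro!: exI[of _ 1])

text \<open>For j = d / gcd(k, d) the exponent k j is divisible by d, so f conjugates g^j to the
  identity and d divides j. Invertibility of k is what permits cancelling it in the congruences
  between characters.\<close>

lemma N_aut_coprime:
  assumes f: "f \<in> carrier Aut_A2" and k: "f \<circ> gen_pow 1 = gen_pow k \<circ> f"
  shows "coprime k d"
proof -
  let ?j = "d div gcd k d"
  have "d dvd k * ?j" by (metis div_mult_swap dvd_triv_right gcd_dvd1 gcd_dvd2 mult.commute dvd_mult_div_cancel dvd_mult)
  then have "gen_pow (k * ?j) = gen_pow 0" unfolding gen_pow_eq_iff by (simp add: cong_0_iff)
  then have "f \<circ> gen_pow ?j = f \<circ> gen_pow 0" using conj_power[OF k, of ?j] by simp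
  then have "gen_pow ?j = gen_pow 0" using bij_is_inj[OF carrier_bij[OF f]] by (simp add: fun.inj_map_strong fun_eq_iff inj_eq)
  then have "d dvd ?j" by (simp only: gen_pow_eq_iff cong_0_iff)
  moreover have "?j > 0" using d_pos by (simp add: div_greater_zero_iff dvd_imp_le)
  ultimately have "d \<le> ?j" by (rule dvd_imp_le)
  then have "gcd k d = 1" using d_pos by (metis One_nat_def Suc_lessI div_less_dividend gcd_pos_nat leD neq0_conv)
  then show ?thesis by (simp add: coprime_iff_gcd_eq_1)
qed

text \<open>Reading f g = g^k f coordinatewise, P and Q are semi-invariants of characters e k and k,
  while g acts on x^i y^j by \<open>zeta ^ (e * i + j)\<close>.\<close>

lemma semi_inv_coeff:
  assumes "polymap P Q \<circ> gen_pow 1 = gen_pow k \<circ> polymap P Q"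
  shows "coeff (coeff P j) i \<noteq> 0 \<Longrightarrow> [e * i + j = e * k] (mod d)"
    "coeff (coeff Q j) i \<noteq> 0 \<Longrightarrow> [e * i + j = k] (mod d)"
proof -
  have v: "polymap P Q (gen_pow 1 v) = gen_pow k (polymap P Q v)" for v using assms by (metis comp_apply)
  have "\<forall>v. eval2 P (zeta ^ e * fst v, zeta * snd v) = zeta ^ (e * k) * eval2 P v" using v by (auto simp: polymap_def gen_pow_def)
  moreover have "\<forall>v. eval2 Q (zeta ^ e * fst v, zeta * snd v) = zeta ^ k * eval2 Q v" using v by (auto simp: polymap_def gen_pow_def)
  ultimately show "coeff (coeff P j) i \<noteq> 0 \<Longrightarrow> [e * i + j = e * k] (mod d)"
    "coeff (coeff Q j) i \<noteq> 0 \<Longrightarrow> [e * i + j = k] (mod d)"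
    unfolding eval2_scale_vars_eq_iff by (auto simp: zeta_eq_iff[symmetric] power_add power_mult)
qed

lemma invariant_ring_iff:
  "p \<in> invariant_ring (G_grp d e) \<longleftrightarrow> (\<forall>i j. coeff (coeff p j) i \<noteq> 0 \<longrightarrow> d dvd e * i + j)"
proof -
  have "p \<in> invariant_ring (G_grp d e) \<longleftrightarrow> (\<forall>k v. eval2 p (gen_pow k v) = eval2 p v)"
    by (auto simp: invariant_ring_def G_eq)
  also have "\<dots> \<longleftrightarrow> (\<forall>v. eval2 p (gen_pow 1 v) = eval2 p v)"
  proof safe
    fix k v assume *: "\<forall>v. eval2 p (gen_pow 1 v) = eval2 p v"
    show "eval2 p (gen_pow k v) = eval2 p v"
    proof (induction k arbitrary: v)
      case (Suc k)
      have "gen_pow (Suc k) v = gen_pow k (gen_pow 1 v)" by (simp flip: comp_apply[of "gen_pow k"] add: gen_pow_comp)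
      then show ?case using Suc[of "gen_pow 1 v"] *[rule_format, of v] by metis
    qed simp
  qed blast
  also have "\<dots> \<longleftrightarrow> (\<forall>v. eval2 p (zeta ^ e * fst v, zeta * snd v) = 1 * eval2 p v)" by (simp add: gen_pow_def)
  also have "\<dots> \<longleftrightarrow> (\<forall>i j. coeff (coeff p j) i \<noteq> 0 \<longrightarrow> (zeta ^ e) ^ i * zeta ^ j = 1)"
    by (rule eval2_scale_vars_eq_iff)
  also have "\<dots> \<longleftrightarrow> (\<forall>i j. coeff (coeff p j) i \<noteq> 0 \<longrightarrow> d dvd e * i + j)"
    by (simp add: zeta_eq_1_iff flip: power_mult power_add)
  finally show ?thesis .
qed

end

section \<open>Generators of the normalizer\<close>

context cyclic_quotient
begin

lemma swap_N_lin: "[e ^ 2 = 1] (mod d) \<Longrightarrow> prod.swap \<in> N_lin d e"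
proof -
  assume e2: "[e ^ 2 = 1] (mod d)"
  have l: "prod.swap = linear_map 0 1 1 0" by (auto simp: linear_map_def fun_eq_iff)
  have GL: "prod.swap \<in> GL2" unfolding l GL2_linear_map by (intro CollectI exI conjI) (rule refl, simp)
  have "zeta ^ (e * e) = zeta ^ 1" using e2 unfolding zeta_eq_iff power2_eq_square .
  then have "prod.swap \<circ> gen_pow 1 = gen_pow e \<circ> prod.swap" by (auto simp: gen_pow_def fun_eq_iff)
  then show ?thesis using GL subgroup.mem_carrier[OF subgroup_GL2 GL] unfolding N_lin_eq Int_iff N_aut_iff by (intro conjI exI)
qed

text \<open>When P = p(x), the derivation \<open>jac P\<close> is p' times the derivative in y.
  Applied to Q'(P, Q) = y it shows that the derivative of Q in y divides 1, hence is a nonzero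
  constant.\<close>

lemma degree_0_coordinate:
  assumes "polymap [:p:] Q \<in> carrier Aut_A2"
  shows "\<exists>\<alpha> \<gamma> \<beta> q. \<alpha> \<noteq> 0 \<and> \<beta> \<noteq> 0 \<and> p = [:\<gamma>, \<alpha>:] \<and> Q = [:q, [:\<beta>:]:]"
proof -
  let ?P = "[:p:]"
  obtain P' Q' where inv: "polymap ?P Q \<circ> polymap P' Q' = id" "polymap P' Q' \<circ> polymap ?P Q = id"
    using assms unfolding carrier_Aut_A2 polymap_inj by blast
  have s: "bisubst P' ?P Q = X2" "bisubst Q' ?P Q = Y2" using inv(2) unfolding polymap_comp polymap_id[symmetric] polymap_inj by auto
  have s': "bisubst ?P P' Q' = X2" using inv(1) unfolding polymap_comp polymap_id[symmetric] polymap_inj by auto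
  have J: "jac ?P f = [:pderiv p:] * pderiv f" for f
    by (simp add: jac_def pderiv_x_pCons pderiv_pCons)
  have "pderiv p \<noteq> 0"
  proof
    assume "pderiv p = 0"
    then obtain c where "p = [:c:]" by (metis pderiv_eq_0_iff degree_eq_zeroE)
    then have "X2 = const2 c" using s' bisubst_const[of c] by simp
    then show False by simp
  qed
  have "[:pderiv p:] * 1 = jac ?P Y2" unfolding J by (simp add: pderiv_pCons)
  also have "\<dots> = [:pderiv p:] * (bisubst (pderiv Q') ?P Q * pderiv Q)"
    using jac_bisubst[of ?P Q' Q] unfolding s(2) J by (simp only: mult_ac)
  finally have "1 = bisubst (pderiv Q') ?P Q * pderiv Q" 
    using \<open>pderiv p \<noteq> 0\<close> by (metis mult_left_cancel pCons_eq_0_iff)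
  then have "pderiv Q dvd 1" by (metis dvd_triv_right)
  then obtain b where b: "pderiv Q = [:b:]" "b dvd 1" by (auto simp: is_unit_poly_iff)
  then obtain \<beta> where "b = [:\<beta>:]" "\<beta> dvd 1" by (auto simp: is_unit_poly_iff)
  then have \<beta>: "b = [:\<beta>:]" "\<beta> \<noteq> 0" by auto
  have Q: "Q = [:coeff Q 0, [:\<beta>:]:]"
  proof (rule poly_eqI)
    fix n show "coeff Q n = coeff [:coeff Q 0, [:\<beta>:]:] n"
    proof (cases n)
      case (Suc m)
      have "coeff (pderiv Q) m = of_nat (Suc m) * coeff Q n" by (simp add: coeff_pderiv Suc)
      moreover have "(of_nat (Suc m) :: complex poly) \<noteq> 0" by (simp only: of_nat_eq_0_iff)
      ultimately show ?thesis using b \<beta> Suc by (cases m) auto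
    qed simp
  qed
  \<comment> \<open>On the curve Q = 0, which is a graph over x because \<beta> is nonzero, the
    inverse recovers x from p(x) alone. So p has a polynomial left inverse and must have degree
    one.\<close>
  have "poly (coeff P' 0 \<circ>\<^sub>p p) x = poly [:0, 1:] x" for x
  proof -
    define q where "q = coeff Q 0"
    have "eval2 (bisubst P' ?P Q) (x, - poly q x / \<beta>) = x" by (simp add: s)
    moreover have "eval2 Q (x, - poly q x / \<beta>) = 0" using \<beta> by (subst Q) (simp add: q_def)
    ultimately have "eval2 P' (poly p x, 0) = x" by simp
    then show ?thesis by (simp add: eval2_def poly_pcompose flip: poly_0_coeff_0)
  qed
  then have "coeff P' 0 \<circ>\<^sub>p p = [:0, 1:]" by (intro poly_eqI_degree poly_ext) (metis poly_eq_poly_eq_iff ext)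
  then have "degree (coeff P' 0) * degree p = 1" by (metis degree_pcompose degree_pCons_eq_if degree_pCons_0 one_neq_zero pCons_eq_0_iff One_nat_def)
  then have "degree p = 1" by simp
  then have "p = [:coeff p 0, coeff p 1:]"
    by (intro poly_eqI) (auto simp: coeff_pCons coeff_eq_0 split: nat.splits)
  moreover have "coeff p 1 \<noteq> 0" using \<open>degree p = 1\<close> by (metis degree_0 leading_coeff_0_iff zero_neq_one)
  ultimately obtain \<gamma> \<alpha> where "p = [:\<gamma>, \<alpha>:]" "\<alpha> \<noteq> 0" by blast
  then show ?thesis using Q \<beta> by blast
qed

lemma e_dvd_contra: "[0 = m] (mod d) \<Longrightarrow> [e = m] (mod d) \<Longrightarrow> False"
  using d_not_dvd_e by (metis cong_0_iff cong_trans cong_sym)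

lemma N_aut_degree_0:
  assumes "polymap P Q \<in> N_aut d e" "degree P = 0"
  shows "polymap P Q \<in> N_aut_minus d e"
proof -
  obtain p where P: "P = [:p:]" using assms(2) by (metis degree_eq_zeroE)
  obtain k where k: "polymap P Q \<circ> gen_pow 1 = gen_pow k \<circ> polymap P Q" and c: "polymap P Q \<in> carrier Aut_A2" using assms by (auto simp: N_aut_iff)
  obtain \<alpha> \<gamma> \<beta> q where *: "\<alpha> \<noteq> 0" "\<beta> \<noteq> 0" "p = [:\<gamma>, \<alpha>:]" "Q = [:q, [:\<beta>:]:]"
    using degree_0_coordinate[of p Q] c P by blast
  \<comment> \<open>A constant has character 0 and x has character e; they differ because d does not
    divide e.\<close>
  have "\<gamma> = 0"
  proof (rule ccontr)
    assume "\<gamma> \<noteq> 0"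
    then have "[e * 0 + 0 = e * k] (mod d)" by (intro semi_inv_coeff(1)[OF k]) (simp add: P *)
    moreover have "[e * 1 + 0 = e * k] (mod d)" by (intro semi_inv_coeff(1)[OF k]) (simp add: P *)
    ultimately show False using e_dvd_contra by simp
  qed
  then have "polymap P Q = jonq_m \<alpha> q \<beta>" by (auto simp: polymap_def jonq_m_def P * fun_eq_iff)
  then have "polymap P Q \<in> Jonq_minus" unfolding Jonq_minus_jonq_m using * by blast
  then show ?thesis using assms by (simp add: N_aut_minus_def)
qed

text \<open>After a swap the preceding analysis applies: Q contains x and P contains y. Their
  characters give k = e and e k = 1 modulo d.\<close>

lemma N_aut_degree_snd_0:
  assumes "polymap P Q \<in> N_aut d e" "degree Q = 0"
  shows "[e ^ 2 = 1] (mod d)"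
proof -
  obtain q where Q: "Q = [:q:]" using assms(2) by (metis degree_eq_zeroE)
  obtain k where k: "polymap P Q \<circ> gen_pow 1 = gen_pow k \<circ> polymap P Q" and c: "polymap P Q \<in> carrier Aut_A2" using assms by (auto simp: N_aut_iff)
  have l: "prod.swap = linear_map 0 1 1 0" by (auto simp: linear_map_def fun_eq_iff)
  have "prod.swap \<in> GL2" unfolding l GL2_linear_map by (intro CollectI exI conjI) (rule refl, simp)
  then have "prod.swap \<circ> polymap P Q \<in> carrier Aut_A2" using subgroup.mem_carrier[OF subgroup_GL2] c by (intro comp_closed)
  moreover have "prod.swap \<circ> polymap P Q = polymap [:q:] P" by (auto simp: polymap_def Q fun_eq_iff)
  ultimately obtain \<alpha> \<gamma> \<beta> p where *: "\<alpha> \<noteq> 0" "\<beta> \<noteq> 0" "q = [:\<gamma>, \<alpha>:]" "P = [:p, [:\<beta>:]:]"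
    using degree_0_coordinate[of q P] by auto
  have 1: "[e * 1 + 0 = k] (mod d)" by (intro semi_inv_coeff(2)[OF k]) (simp add: Q *)
  have "[e * 0 + 1 = e * k] (mod d)" by (intro semi_inv_coeff(1)[OF k]) (simp add: *)
  then have "[1 = e * e] (mod d)" using 1 cong_mult[OF cong_refl[of e] 1] by (auto intro: cong_trans cong_sym)
  then show ?thesis by (simp add: power2_eq_square cong_sym_eq)
qed

text \<open>The top coefficients cancel. The bound \<open>n \<ge> 1\<close> covers the zero
  difference, whose degree is 0.\<close>

lemma degree_reduce:
  assumes "degree (F :: 'a :: idom poly) = n" "degree G \<le> n" "coeff G n = lead_coeff F" "n \<ge> 1"
  shows "degree (F - G) < n"
proof -
  have "degree (F - G) \<le> n" using assms by (intro degree_diff_le) auto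
  moreover have "degree (F - G) \<noteq> n"
  proof
    assume *: "degree (F - G) = n"
    then have "lead_coeff (F - G) = 0" using assms by simp
    then show False using * assms(4) by (metis degree_0 leading_coeff_0_iff not_one_le_zero)
  qed
  ultimately show ?thesis by simp
qed

text \<open>When p = e modulo d, both x and y^p have character e, so the shear commutes with g.
  Likewise y and x^s share the character 1 in the companion statement.\<close>

lemma elementary_plus: 
  assumes "[p = e] (mod d)" shows "jonq_p 1 (monom c p) 1 \<in> N_aut_plus d e"
proof -
  have "jonq_p 1 (monom c p) 1 \<in> Jonq_plus" unfolding Jonq_plus_jonq_p by (intro CollectI exI conjI) (rule refl, auto)
  moreover have "zeta ^ p = zeta ^ e" using assms by (simp only: zeta_eq_iff)
  then have "jonq_p 1 (monom c p) 1 \<circ> gen_pow 1 = gen_pow 1 \<circ> jonq_p 1 (monom c p) 1"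
    by (auto simp: jonq_p_def gen_pow_def fun_eq_iff poly_monom power_mult_distrib algebra_simps)
  ultimately show ?thesis using subgroup.mem_carrier[OF subgroup_Jonq_plus] by (auto simp: N_aut_plus_def N_aut_iff)
qed

lemma elementary_minus: 
  assumes "[e * s = 1] (mod d)" shows "jonq_m 1 (monom c s) 1 \<in> N_aut_minus d e"
proof -
  have "jonq_m 1 (monom c s) 1 \<in> Jonq_minus" unfolding Jonq_minus_jonq_m by (intro CollectI exI conjI) (rule refl, auto)
  moreover have "zeta ^ (e * s) = zeta ^ 1" using assms by (simp only: zeta_eq_iff)
  then have "jonq_m 1 (monom c s) 1 \<circ> gen_pow 1 = gen_pow 1 \<circ> jonq_m 1 (monom c s) 1"
    by (auto simp: jonq_m_def gen_pow_def fun_eq_iff poly_monom power_mult_distrib algebra_simps power_mult)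
  ultimately show ?thesis using subgroup.mem_carrier[OF subgroup_Jonq_minus] by (auto simp: N_aut_minus_def N_aut_iff)
qed

text \<open>The arbitrary subgroup \<open>M\<close> lets the induction on
  \<open>degree P + degree Q\<close> proceed with nothing but closure under composition. The linear
  normalizer enters through the swap, which reduces a second coordinate free of y to a first
  one.\<close>

theorem N_aut_generated:
  assumes M: "subgroup M Aut_A2" and plus: "N_aut_plus d e \<subseteq> M" and minus: "N_aut_minus d e \<subseteq> M"
    and linM: "[e ^ 2 = 1] (mod d) \<Longrightarrow> N_lin d e \<subseteq> M"
  shows "N_aut d e \<subseteq> M"
proof -
  have Mc: "f \<circ> g \<in> M" if "f \<in> M" "g \<in> M" for f g
    using subgroup.m_closed[OF M that] subgroup.mem_carrier[OF M] that by (simp add: mult_Aut_A2)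
  have Nc: "f \<circ> g \<in> N_aut d e" if "f \<in> N_aut d e" "g \<in> N_aut d e" for f g
    using subgroup.m_closed[OF subgroup_N_aut that] subgroup.mem_carrier[OF subgroup_N_aut] that by (simp add: mult_Aut_A2)
  have "polymap P Q \<in> M" if "polymap P Q \<in> N_aut d e" for P Q
    using that
  proof (induction "degree P + degree Q" arbitrary: P Q rule: less_induct)
    case less
    obtain k where k: "polymap P Q \<circ> gen_pow 1 = gen_pow k \<circ> polymap P Q" and c: "polymap P Q \<in> carrier Aut_A2" using less.prems by (auto simp: N_aut_iff)
    have cop_k: "coprime k d" using N_aut_coprime[OF c k] .
    consider "degree P = 0" | "degree Q = 0" | "degree P \<ge> 1" "degree Q \<ge> 1" by linarith
    then show ?case
    proof cases
      case 1
      then show ?thesis using N_aut_degree_0 less.prems minus by blast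
    next
      case 2
      have e2: "[e ^ 2 = 1] (mod d)" using N_aut_degree_snd_0 less.prems 2 by blast
      have sw: "prod.swap \<in> N_lin d e" "prod.swap \<in> N_aut d e" using swap_N_lin[OF e2] by (auto simp: N_lin_eq)
      have "prod.swap \<circ> polymap P Q \<in> N_aut d e" using sw less.prems by (intro Nc)
      moreover have "prod.swap \<circ> polymap P Q = polymap Q P" by (auto simp: polymap_def)
      ultimately have "polymap Q P \<in> M" using N_aut_degree_0[of Q P] 2 minus by auto
      then have "prod.swap \<circ> polymap Q P \<in> M" using sw linM[OF e2] by (intro Mc) auto
      moreover have "prod.swap \<circ> polymap Q P = polymap P Q" by (auto simp: polymap_def)
      ultimately show ?thesis by simp
    next
      case 3
      obtain P' Q' where "polymap P' Q' \<circ> polymap P Q = id" using c unfolding carrier_Aut_A2 polymap_inj by blast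
      then have G: "bisubst P' P Q = X2" unfolding polymap_comp polymap_id[symmetric] polymap_inj by auto
      define a where "a = lead_coeff P"
      define b where "b = lead_coeff Q"
      have ab: "a \<noteq> 0" "b \<noteq> 0" using 3 by (auto simp: a_def b_def)
      have A: "[e * degree a + degree P = e * k] (mod d)" using ab by (intro semi_inv_coeff(1)[OF k]) (simp add: a_def)
      have B: "[e * degree b + degree Q = k] (mod d)" using ab by (intro semi_inv_coeff(2)[OF k]) (simp add: b_def)
      have PQ: "P \<noteq> 0" "Q \<noteq> 0" using 3 by auto
      from jung_step[OF G 3] obtain c s where cs: "degree Q = degree P * s \<and> b = smult c (a ^ s) \<or> degree P = degree Q * s \<and> a = smult c (b ^ s)"
        unfolding a_def b_def by blast
      then show ?thesis
      proof
        assume *: "degree Q = degree P * s \<and> b = smult c (a ^ s)"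
        then have "c \<noteq> 0" using ab by auto
        then have "degree b = degree a * s" using * ab by (simp add: degree_power_eq mult.commute)
        then have "[s * (e * degree a + degree P) = k] (mod d)" using B * by (simp add: algebra_simps)
        moreover have "[s * (e * degree a + degree P) = s * (e * k)] (mod d)" using A by (intro cong_mult cong_refl)
        ultimately have "[s * (e * k) = k] (mod d)" by (metis cong_trans cong_sym)
        \<comment> \<open>The leading monomial of Q is, up to a constant, the s-th power of that of
          P. Comparing characters gives s e k = k, and k cancels; the result is the hypothesis of
          \<open>elementary_minus\<close>.\<close>
        then have "[(e * s) * k = 1 * k] (mod d)" by (simp add: mult_ac)
        then have es: "[e * s = 1] (mod d)" using cop_k by (simp only: cong_mult_rcancel_nat)
        let ?Q = "Q - const2 c * P ^ s"
        have "degree ?Q < degree Q"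
        proof (rule degree_reduce)
          have dg: "degree (P ^ s) = degree Q" using * PQ by (simp add: degree_power_eq mult.commute)
          show "degree (const2 c * P ^ s) \<le> degree Q" using dg by (simp add: degree_smult_le)
          have "coeff (P ^ s) (degree Q) = a ^ s" unfolding dg[symmetric] lead_coeff_power a_def ..
          then have "coeff (const2 c * P ^ s) (degree Q) = smult c (a ^ s)" by simp
          also have "\<dots> = lead_coeff Q" using * unfolding b_def by metis
          finally show "coeff (const2 c * P ^ s) (degree Q) = lead_coeff Q" .
        qed (use 3 in auto)
        moreover have comp: "jonq_m 1 (monom (- c) s) 1 \<circ> polymap P Q = polymap P ?Q"
          by (auto simp: jonq_m_def polymap_def fun_eq_iff poly_monom)
        have "polymap P ?Q \<in> N_aut d e" unfolding comp[symmetric]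
          using elementary_minus[OF es, of "-c"] less.prems by (intro Nc) (auto simp: N_aut_minus_def)
        ultimately have "polymap P ?Q \<in> M" using less.hyps[of P ?Q] by simp
        then have "jonq_m 1 (monom c s) 1 \<circ> polymap P ?Q \<in> M" using elementary_minus[OF es, of c] minus by (intro Mc) auto
        moreover have "jonq_m 1 (monom c s) 1 \<circ> polymap P ?Q = polymap P Q" by (auto simp: jonq_m_def polymap_def fun_eq_iff poly_monom)
        ultimately show ?thesis by simp
      next
        assume *: "degree P = degree Q * s \<and> a = smult c (b ^ s)"
        then have "c \<noteq> 0" using ab by auto
        then have "degree a = degree b * s" using * ab by (simp add: degree_power_eq mult.commute)
        then have "[s * (e * degree b + degree Q) = e * k] (mod d)" using A * by (simp add: algebra_simps)
        moreover have "[s * (e * degree b + degree Q) = s * k] (mod d)" using B by (intro cong_mult cong_refl)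
        ultimately have "[s * k = e * k] (mod d)" by (metis cong_trans cong_sym)
        then have es: "[s = e] (mod d)" using cop_k by (simp only: cong_mult_rcancel_nat)
        let ?P = "P - const2 c * Q ^ s"
        have "degree ?P < degree P"
        proof (rule degree_reduce)
          have dg: "degree (Q ^ s) = degree P" using * PQ by (simp add: degree_power_eq mult.commute)
          show "degree (const2 c * Q ^ s) \<le> degree P" using dg by (simp add: degree_smult_le)
          have "coeff (Q ^ s) (degree P) = b ^ s" unfolding dg[symmetric] lead_coeff_power b_def ..
          then have "coeff (const2 c * Q ^ s) (degree P) = smult c (b ^ s)" by simp
          also have "\<dots> = lead_coeff P" using * unfolding a_def by metis
          finally show "coeff (const2 c * Q ^ s) (degree P) = lead_coeff P" .
        qed (use 3 in auto)
        moreover have comp: "jonq_p 1 (monom (- c) s) 1 \<circ> polymap P Q = polymap ?P Q"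
          by (auto simp: jonq_p_def polymap_def fun_eq_iff poly_monom)
        have "polymap ?P Q \<in> N_aut d e" unfolding comp[symmetric]
          using elementary_plus[OF es, of "-c"] less.prems by (intro Nc) (auto simp: N_aut_plus_def)
        ultimately have "polymap ?P Q \<in> M" using less.hyps[of ?P Q] by simp
        then have "jonq_p 1 (monom c s) 1 \<circ> polymap ?P Q \<in> M" using elementary_plus[OF es, of c] plus by (intro Mc) auto
        moreover have "jonq_p 1 (monom c s) 1 \<circ> polymap ?P Q = polymap P Q" by (auto simp: jonq_p_def polymap_def fun_eq_iff poly_monom)
        ultimately show ?thesis by simp
      qed
    qed
  qed
  moreover have "\<exists>P Q. f = polymap P Q" if "f \<in> N_aut d e" for f
    using that unfolding N_aut_iff carrier_Aut_A2 by blast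
  ultimately show ?thesis by blast
qed

end

section \<open>Automorphisms of the quotient\<close>

text \<open>At each point the two values differ by some n-th root of unity, so the product of all p
  - w q vanishes identically and one factor is zero.\<close>

lemma root_of_power_eq:
  fixes p q :: bipoly
  assumes "p ^ n = q ^ n" "n > 0"
  shows "\<exists>w. w ^ n = 1 \<and> p = const2 w * q"
proof -
  let ?R = "{w::complex. w ^ n = 1}"
  have fin: "finite ?R" using assms by (intro finite_roots_unity) auto
  have "\<exists>w\<in>?R. eval2 p v = w * eval2 q v" for v
  proof -
    have e: "eval2 p v ^ n = eval2 q v ^ n" using assms(1) by (metis eval2_simps(5))
    show ?thesis
    proof (cases "eval2 q v = 0")
      case True
      then show ?thesis using e assms(2) by (intro bexI[of _ 1]) (auto simp: power_0_left)
    next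
      case False
      then show ?thesis using e by (intro bexI[of _ "eval2 p v / eval2 q v"]) (auto simp: power_divide)
    qed
  qed
  then have "eval2 (\<Prod>w\<in>?R. p - const2 w * q) v = 0" for v
    using fin by (auto simp: prod_zero_iff)
  then have "(\<Prod>w\<in>?R. p - const2 w * q) = 0" by (rule eval2_eq_0_imp)
  then show ?thesis using fin by (auto simp: prod_zero_iff)
qed

lemma unit_bipoly: "p dvd 1 \<longleftrightarrow> (\<exists>c. c \<noteq> 0 \<and> p = const2 c)"
proof
  assume "p dvd 1"
  then obtain r where r: "p = [:r:]" "r dvd 1" by (auto simp: is_unit_poly_iff)
  then obtain c where "r = [:c:]" "c dvd 1" by (auto simp: is_unit_poly_iff)
  then show "\<exists>c. c \<noteq> 0 \<and> p = const2 c" using r by (intro exI[of _ c]) auto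
next
  assume "\<exists>c. c \<noteq> 0 \<and> p = const2 c"
  then obtain c where "c \<noteq> 0" "p = const2 c" by blast
  then have "p * const2 (1 / c) = 1" by (simp add: one_pCons)
  then show "p dvd 1" by (metis dvd_triv_left)
qed

text \<open>A polynomial in x alone vanishes on a vertical line. Otherwise every x outside the zeros
  of the leading coefficient can be completed to a zero.\<close>

lemma infinite_zeros:
  assumes "\<not> p dvd 1" shows "infinite {v. eval2 p v = 0}"
proof (cases "degree p = 0")
  case True
  then obtain r where r: "p = [:r:]" by (metis degree_eq_zeroE)
  have "\<exists>x. poly r x = 0"
  proof (rule ccontr)
    assume *: "\<nexists>x. poly r x = 0"
    then have "degree r = 0" using fundamental_theorem_of_algebra[of r] by (auto simp: constant_degree)
    then obtain c where c: "r = [:c:]" by (metis degree_eq_zeroE)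
    then show False using * assms unit_bipoly r by auto
  qed
  then obtain x where "poly r x = 0" by blast
  then have "range (\<lambda>y. (x, y)) \<subseteq> {v. eval2 p v = 0}" by (auto simp: r)
  moreover have "infinite (range (\<lambda>y::complex. (x, y)))"
    by (subst finite_image_iff) (auto simp: inj_def infinite_UNIV_char_0)
  ultimately show ?thesis using finite_subset by blast
next
  case False
  then have "p \<noteq> 0" by auto
  have "\<exists>y. eval2 p (x, y) = 0" if "poly (lead_coeff p) x \<noteq> 0" for x
  proof -
    let ?q = "map_poly (\<lambda>r. poly r x) p"
    have q: "poly ?q y = eval2 p (x, y)" for y
      by (induction p) (auto simp: map_poly_pCons)
    have "degree ?q = degree p" using that by (intro map_poly_degree_eq) auto
    then have "\<not> constant (poly ?q)" using False by (simp add: constant_degree)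
    then obtain y where "poly ?q y = 0" using fundamental_theorem_of_algebra by blast
    then show ?thesis using q by auto
  qed
  then have "{x. poly (lead_coeff p) x \<noteq> 0} \<subseteq> fst ` {v. eval2 p v = 0}" by force
  moreover have "infinite (- {x. poly (lead_coeff p) x = 0})"
    using \<open>p \<noteq> 0\<close> poly_roots_finite[of "lead_coeff p"]
    by (metis Compl_eq_Diff_UNIV Diff_infinite_finite infinite_UNIV_char_0 leading_coeff_0_iff)
  then have "infinite {x. poly (lead_coeff p) x \<noteq> 0}" by (simp add: Collect_neg_eq)
  ultimately show ?thesis using finite_subset finite_imageI by metis
qed

text \<open>The n-th power of gcd(a, w) is gcd(a^n, a b), which is a up to a unit since a and b are
  coprime. Units are nonzero constants, and these have n-th roots.\<close>

lemma coprime_power_product: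
  fixes a b w :: bipoly
  assumes "coprime a b" "a * b = w ^ n" "n > 0" "a \<noteq> 0"
  shows "\<exists>h. a = h ^ n"
proof -
  have n: "a ^ n = a * a ^ (n - 1)" using assms(3) by (metis power_eq_if neq0_conv)
  have "gcd a w ^ n = gcd (a * a ^ (n - 1)) (a * b)"
    unfolding n[symmetric] assms(2) by (rule gcd_exp[symmetric])
  also have "\<dots> = normalize a" using assms(1) by (simp only: gcd_mult_left) simp
  finally have "a = unit_factor a * gcd a w ^ n" by simp
  moreover obtain c where c: "c \<noteq> 0" "unit_factor a = const2 c" 
    using unit_bipoly unit_factor_is_unit[OF assms(4)] by blast
  moreover obtain c0 where "c0 ^ n = c" using nth_root_exists[of n c] assms(3) by auto
  then have "const2 c = const2 c0 ^ n" by (simp add: poly_const_pow)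
  ultimately have "a = (const2 c0 * gcd a w) ^ n" by (simp only: power_mult_distrib)
  then show ?thesis ..
qed

context cyclic_quotient
begin

section \<open>The ring of invariants\<close>

abbreviation "A \<equiv> invariant_ring (G_grp d e)"

lemma A_iff: "p \<in> A \<longleftrightarrow> (\<forall>k v. eval2 p (gen_pow k v) = eval2 p v)"
  by (auto simp: invariant_ring_def G_eq)

lemma A_add: "p \<in> A \<Longrightarrow> q \<in> A \<Longrightarrow> p + q \<in> A" 
  and A_mult: "p \<in> A \<Longrightarrow> q \<in> A \<Longrightarrow> p * q \<in> A" 
  and A_power: "p \<in> A \<Longrightarrow> p ^ n \<in> A" 
  and A_const: "const2 c \<in> A"
  by (auto simp: A_iff)

lemma coeff_monomial: "coeff (coeff (X2 ^ i * Y2 ^ j) j') i' = (if i' = i \<and> j' = j then 1 else 0)"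
proof -
  have "X2 ^ i * Y2 ^ j = monom (monom 1 i) j"
    by (rule eval2_eqI) (simp add: poly_monom)
  then show ?thesis by auto
qed

lemma A_monomial: "d dvd e * i + j \<Longrightarrow> X2 ^ i * Y2 ^ j \<in> A"
  unfolding invariant_ring_iff coeff_monomial by auto

lemma A_power_d: "X2 ^ d \<in> A" "Y2 ^ d \<in> A"
  using A_monomial[of d 0] A_monomial[of 0 d] by simp_all

text \<open>Invariance is a condition on the monomials that occur, so A is spanned by the monomials
  it contains.\<close>

lemma A_induct [consumes 1, case_names add monomial]:
  assumes p: "p \<in> A"
    and add: "\<And>p q. p \<in> A \<Longrightarrow> q \<in> A \<Longrightarrow> Pr p \<Longrightarrow> Pr q \<Longrightarrow> Pr (p + q)"
    and mon: "\<And>c i j. d dvd e * i + j \<Longrightarrow> Pr (const2 c * (X2 ^ i * Y2 ^ j))"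
  shows "Pr p"
proof -
  define T where "T = {p \<in> A. Pr p}"
  have zero: "0 \<in> T" using mon[of 0 0 0] A_const[of 0] by (simp add: T_def)
  have sum: "(\<Sum>i\<in>I. f i) \<in> T" if "\<And>i. i \<in> I \<Longrightarrow> f i \<in> T" for I and f :: "nat \<Rightarrow> bipoly"
    using that
  proof (induction I rule: infinite_finite_induct)
    case (insert x F)
    then show ?case using add A_add by (simp add: T_def)
  qed (use zero in auto)
  have "const2 (coeff (coeff p j) i) * (X2 ^ i * Y2 ^ j) \<in> T" for i j
  proof (cases "coeff (coeff p j) i = 0")
    case False
    then have "d dvd e * i + j" using p by (simp add: invariant_ring_iff)
    then show ?thesis unfolding T_def using mon A_mult[OF A_const A_monomial] by simp
  qed (use zero in simp)
  then have "bisubst p X2 Y2 \<in> T" unfolding bisubst_expand[of p X2 Y2] by (intro sum)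
  moreover have "bisubst p X2 Y2 = p" by (rule eval2_eqI) simp
  ultimately show ?thesis by (simp add: T_def)
qed

text \<open>Fixing x^d and y^d makes the map diagonal, with d-th roots of unity w and w' as entries;
  fixing x y^(d-e) then forces w = w'^e.\<close>

lemma fixes_invariants_imp_gen_pow:
  assumes "\<And>a v. a \<in> A \<Longrightarrow> eval2 a (polymap P Q v) = eval2 a v"
  shows "\<exists>j. polymap P Q = gen_pow j"
proof -
  note XA = A_power_d(1) and YA = A_power_d(2)
  have "P ^ d = X2 ^ d" using assms[OF XA] by (intro eval2_eqI) (simp add: polymap_def)
  then obtain w where w: "w ^ d = 1" "P = const2 w * X2" using root_of_power_eq d_pos by blast
  have "Q ^ d = Y2 ^ d" using assms[OF YA] by (intro eval2_eqI) (simp add: polymap_def)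
  then obtain w' where w': "w' ^ d = 1" "Q = const2 w' * Y2" using root_of_power_eq d_pos by blast
  have "d dvd e * 1 + (d - e)" using ed by simp
  then have m: "X2 ^ 1 * Y2 ^ (d - e) \<in> A" by (rule A_monomial)
  have one: "w * w' ^ (d - e) = 1" using assms[OF m, of "(1, 1)"] by (simp add: polymap_def w w')
  have "w = w * (w' ^ (d - e) * w' ^ e)" using w'(1) ed by (simp flip: power_add)
  also have "\<dots> = w' ^ e" using one by (simp add: mult.assoc[symmetric])
  finally have "w = w' ^ e" .
  moreover obtain j where "w' = zeta ^ j" using roots_of_unity[OF w'(1)] by blast
  ultimately have "polymap P Q = gen_pow j" by (auto simp: polymap_def gen_pow_def w w' power_mult[symmetric] mult.commute)
  then show ?thesis ..
qed

text \<open>The map is total on C[x,y], but only its values on A are constrained.\<close>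

definition alg_endo :: "(bipoly \<Rightarrow> bipoly) \<Rightarrow> bool" where
  "alg_endo \<sigma> \<longleftrightarrow> (\<forall>p\<in>A. \<sigma> p \<in> A) \<and> (\<forall>c. \<sigma> (const2 c) = const2 c) \<and>
     (\<forall>p\<in>A. \<forall>q\<in>A. \<sigma> (p + q) = \<sigma> p + \<sigma> q \<and> \<sigma> (p * q) = \<sigma> p * \<sigma> q)"

lemma alg_endo_power: "alg_endo \<sigma> \<Longrightarrow> p \<in> A \<Longrightarrow> \<sigma> (p ^ n) = \<sigma> p ^ n"
proof (induction n)
  case 0
  then show ?case unfolding alg_endo_def by (metis one_pCons power_0)
next
  case (Suc n)
  then show ?case using A_power by (simp add: alg_endo_def)
qed

text \<open>The d-th power of an invariant monomial is a product of powers of x^d and y^d, so h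
  kills every nonconstant invariant monomial.\<close>

lemma character_vanishing_is_origin:
  assumes h: "\<And>c. h (const2 c) = c" "\<And>p q. p \<in> A \<Longrightarrow> q \<in> A \<Longrightarrow> h (p + q) = h p + h q \<and> h (p * q) = h p * h q"
    and XY: "h (X2 ^ d) = 0" "h (Y2 ^ d) = (0::complex)" and a: "a \<in> A"
  shows "h a = eval2 a (0, 0)"
  using a
proof (induction a rule: A_induct)
  case (add p q)
  then show ?case using h by simp
next
  case (monomial c i j)
  have hp: "h (p ^ n) = h p ^ n" if "p \<in> A" for p n
  proof (induction n)
    case 0
    show ?case using h(1)[of 1] by (simp flip: one_pCons)
  next
    case (Suc n)
    then show ?case using h(2)[OF that A_power[OF that]] by simp
  qed
  have m: "X2 ^ i * Y2 ^ j \<in> A" using monomial by (rule A_monomial)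
  note XA = A_power_d(1) and YA = A_power_d(2)
  have "(X2 ^ i * Y2 ^ j) ^ d = (X2 ^ d) ^ i * (Y2 ^ d) ^ j"
    by (simp add: power_mult_distrib mult.commute flip: power_mult)
  then have "h (X2 ^ i * Y2 ^ j) ^ d = 0 ^ i * 0 ^ j"
    using hp[OF m] hp[OF XA] hp[OF YA] h(2)[OF A_power[OF XA] A_power[OF YA]] XY by metis
  then have "h (X2 ^ i * Y2 ^ j) = 0 ^ i * 0 ^ j" if "i > 0 \<or> j > 0"
    using that d_pos by (auto simp: power_0_left split: if_splits)
  moreover have "h (const2 c * (X2 ^ i * Y2 ^ j)) = c * h (X2 ^ i * Y2 ^ j)"
    using h(2)[OF A_const m] h(1) by metis
  ultimately show ?case using h(1)[of 1] by (cases "i > 0 \<or> j > 0") (auto simp del: mult_pCons_left simp flip: one_pCons)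
qed

text \<open>
  A nonconstant common factor would vanish at infinitely many points, all of which \<open>\<sigma>\<close> sends to the
  origin of the quotient.
\<close>

lemma coprime_images:
  assumes \<sigma>: "alg_endo \<sigma>" and \<sigma>': "alg_endo \<sigma>'" and inv: "\<And>p. p \<in> A \<Longrightarrow> \<sigma> (\<sigma>' p) = p"
    and nz: "\<sigma> (X2 ^ d) \<noteq> 0"
  shows "coprime (\<sigma> (X2 ^ d)) (\<sigma> (Y2 ^ d))"
proof (rule ccontr)
  assume "\<not> coprime (\<sigma> (X2 ^ d)) (\<sigma> (Y2 ^ d))"
  then obtain p where p: "p dvd \<sigma> (X2 ^ d)" "p dvd \<sigma> (Y2 ^ d)" "\<not> p dvd 1"
    by (auto simp: coprime_def)
  note XA = A_power_d(1) and YA = A_power_d(2)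
  let ?c1 = "eval2 (\<sigma>' (X2 ^ d)) (0, 0)" and ?c2 = "eval2 (\<sigma>' (Y2 ^ d)) (0, 0)"
  \<comment> \<open>Evaluating \<sigma> (\<sigma>' a) = a at a zero v of p, for a = x^d and a = y^d,
    pins both powers to the values of \<sigma>' a at the origin. Only finitely many v
    remain.\<close>
  have "fst v ^ d = ?c1 \<and> snd v ^ d = ?c2" if "eval2 p v = 0" for v
  proof -
    have "eval2 (\<sigma> a) v = eval2 a (0, 0)" if "a \<in> A" for a
    proof (rule character_vanishing_is_origin[OF _ _ _ _ that])
      show "eval2 (\<sigma> (const2 c)) v = c" for c using \<sigma> by (simp add: alg_endo_def)
      show "eval2 (\<sigma> (p + q)) v = eval2 (\<sigma> p) v + eval2 (\<sigma> q) v \<and> eval2 (\<sigma> (p * q)) v = eval2 (\<sigma> p) v * eval2 (\<sigma> q) v"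
        if "p \<in> A" "q \<in> A" for p q using \<sigma> that by (simp add: alg_endo_def)
      show "eval2 (\<sigma> (X2 ^ d)) v = 0" "eval2 (\<sigma> (Y2 ^ d)) v = 0"
        using p(1,2) \<open>eval2 p v = 0\<close> by (auto elim!: dvdE)
    qed
    then have "eval2 (\<sigma> (\<sigma>' a)) v = eval2 (\<sigma>' a) (0, 0)" if "a \<in> A" for a
      using \<sigma>' that by (simp add: alg_endo_def)
    from this[OF XA] this[OF YA] show ?thesis using inv[OF XA] inv[OF YA] by simp
  qed
  then have "{v. eval2 p v = 0} \<subseteq> {x. x ^ d = ?c1} \<times> {y. y ^ d = ?c2}" by auto
  moreover have "finite ({x. x ^ d = ?c1} \<times> {y. y ^ d = ?c2})"
    using finite_nth_roots[OF d_pos] by (intro finite_cartesian_product)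
  ultimately show False using infinite_zeros[OF p(3)] finite_subset by blast
qed

lemma lift_endo:
  assumes \<sigma>: "alg_endo \<sigma>" and \<sigma>': "alg_endo \<sigma>'" 
    and inv: "\<And>p. p \<in> A \<Longrightarrow> \<sigma> (\<sigma>' p) = p" "\<And>p. p \<in> A \<Longrightarrow> \<sigma>' (\<sigma> p) = p"
  shows "\<exists>P Q. \<forall>a\<in>A. \<sigma> a = bisubst a P Q"
proof -
  have mul: "\<sigma> (p * q) = \<sigma> p * \<sigma> q" if "p \<in> A" "q \<in> A" for p q using \<sigma> that by (simp add: alg_endo_def)
  have pow: "\<sigma> (p ^ n) = \<sigma> p ^ n" if "p \<in> A" for p n by (rule alg_endo_power[OF \<sigma> that])
  define k where "k = d - e"
  have k: "e + k = d" using ed by (simp add: k_def)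
  obtain x where x: "[e * x = 1] (mod d)" using cong_solve_coprime_nat[of e d] cop by (auto simp: coprime_commute)
  \<comment> \<open>The choice makes e l = -1 modulo d, so x^l y is invariant. It is the mirror
    image of x y^(d-e) and shows that V, too, is a d-th power.\<close>
  define l where "l = x * (d - 1)"
  have "[e * l + 1 = 1 * (d - 1) + 1] (mod d)" unfolding l_def mult.assoc[symmetric] using x by (intro cong_add cong_mult cong_refl)
  then have l: "d dvd e * l + 1" using d_pos by (simp add: cong_def mod_0_imp_dvd)
  note XA = A_power_d(1) and YA = A_power_d(2)
  define W0 where "W0 = X2 ^ 1 * Y2 ^ k"
  define W1 where "W1 = X2 ^ l * Y2 ^ 1"
  have WA: "W0 \<in> A" "W1 \<in> A" unfolding W0_def W1_def using k l by (intro A_monomial; simp)+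
  have nz: "\<sigma> p \<noteq> 0" if "p \<in> A" "p \<noteq> 0" for p
  proof
    assume "\<sigma> p = 0"
    moreover have "0 \<in> A" using A_const[of 0] by simp
    then have "\<sigma> 0 = 0" using \<sigma> unfolding alg_endo_def by (metis add.right_neutral add_cancel_left_left)
    ultimately have "\<sigma>' (\<sigma> p) = \<sigma>' (\<sigma> 0)" by simp
    then show False using inv(2)[OF that(1)] inv(2)[OF \<open>0 \<in> A\<close>] that(2) by simp
  qed
  define U where "U = \<sigma> (X2 ^ d)"
  define V where "V = \<sigma> (Y2 ^ d)"
  have UV0: "U \<noteq> 0" "V \<noteq> 0" unfolding U_def V_def using nz XA YA by auto
  have cp: "coprime U V" unfolding U_def V_def using coprime_images[OF \<sigma> \<sigma>' inv(1)] UV0 by (simp add: U_def)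
  have sw: "(a * b ^ r) ^ d = a ^ d * (b ^ d) ^ r" for a b :: bipoly and r
    by (simp add: power_mult_distrib mult.commute flip: power_mult)
  have "W0 ^ d = X2 ^ d * (Y2 ^ d) ^ k" "W1 ^ d = (X2 ^ d) ^ l * Y2 ^ d"
    unfolding W0_def W1_def power_one_right by (rule sw) (metis sw mult.commute)
  then have "\<sigma> (X2 ^ d * (Y2 ^ d) ^ k) = \<sigma> (W0 ^ d)" "\<sigma> ((X2 ^ d) ^ l * Y2 ^ d) = \<sigma> (W1 ^ d)" by metis+
  then have W: "U * V ^ k = \<sigma> W0 ^ d" "V * U ^ l = \<sigma> W1 ^ d"
    using mul[OF XA A_power[OF YA]] mul[OF A_power[OF XA] YA] pow WA XA YA unfolding U_def V_def by (simp_all only: mult.commute)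
  obtain h1 where h1: "U = h1 ^ d" using coprime_power_product[OF _ W(1) d_pos UV0(1)] cp by auto
  obtain h2 where h2: "V = h2 ^ d" using coprime_power_product[OF _ W(2) d_pos UV0(2)] cp by (auto simp: coprime_commute)
  have "\<sigma> W0 ^ d = (h1 * h2 ^ k) ^ d" unfolding W(1)[symmetric] h1 h2 by (rule sw[symmetric])
  then obtain w where w: "w ^ d = 1" "\<sigma> W0 = const2 w * (h1 * h2 ^ k)" using root_of_power_eq d_pos by blast
  \<comment> \<open>The root h1 is determined up to a d-th root of unity only; w corrects it so that
    \<sigma> (x y^k) = h h2^k holds exactly.\<close>
  define h where "h = const2 w * h1"
  have h: "\<sigma> W0 = h * h2 ^ k" unfolding w(2) h_def by (simp only: mult.assoc)
  have mono: "\<sigma> (X2 ^ i * Y2 ^ j) = h ^ i * h2 ^ j" if "d dvd e * i + j" for i j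
  proof -
    have "[e * i + j = e * i + k * i] (mod d)" using that k by (metis cong_0_iff cong_sym cong_trans dvd_triv_left distrib_right)
    then have "[j = k * i] (mod d)" by (simp only: cong_add_lcancel_nat)
    \<comment> \<open>Multiplied by a power of y^d, an invariant monomial x^i y^j becomes W0^i times
      another such power. Two natural exponents s and t stand for a difference of either sign; V^t
      is cancelled at the end.\<close>
    then obtain s t where st: "k * i + s * d = j + t * d" unfolding cong_iff_lin_nat by blast
    have mA: "X2 ^ i * Y2 ^ j \<in> A" using that by (rule A_monomial)
    have "(X2 ^ i * Y2 ^ j) * (Y2 ^ d) ^ t = X2 ^ i * Y2 ^ (j + t * d)"
      by (simp only: power_add power_mult mult.commute[of t] mult.assoc)
    also have "\<dots> = W0 ^ i * (Y2 ^ d) ^ s"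
      unfolding st[symmetric] W0_def by (simp only: power_add power_mult power_mult_distrib mult.commute[of s] mult.assoc power_one_right)
    finally have "\<sigma> (X2 ^ i * Y2 ^ j) * V ^ t = \<sigma> W0 ^ i * V ^ s"
      using mul[OF mA A_power[OF YA, of t]] mul[OF A_power[OF WA(1), of i] A_power[OF YA, of s]] pow[OF YA] pow[OF WA(1)]
      unfolding V_def by metis
    also have "\<dots> = h ^ i * h2 ^ (k * i + s * d)"
      unfolding h h2 by (simp only: power_add power_mult power_mult_distrib mult.commute[of s] mult.assoc)
    also have "\<dots> = h ^ i * h2 ^ j * V ^ t" unfolding st h2 by (simp only: power_add power_mult mult.commute[of t] mult.assoc)
    finally show ?thesis using UV0(2) by simp
  qed
  have "\<sigma> a = bisubst a h h2" if "a \<in> A" for a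
    using that
  proof (induction a rule: A_induct)
    case (add p q)
    then show ?case using \<sigma> by (simp add: alg_endo_def bisubst_add)
  next
    case (monomial c i j)
    have "\<sigma> (const2 c * (X2 ^ i * Y2 ^ j)) = const2 c * (h ^ i * h2 ^ j)"
      using mul[OF A_const A_monomial[OF monomial]] mono[OF monomial] \<sigma> by (metis alg_endo_def)
    also have "\<dots> = bisubst (const2 c * (X2 ^ i * Y2 ^ j)) h h2"
      by (simp only: bisubst_mult bisubst_const bisubst_power bisubst_X2 bisubst_Y2)
    finally show ?case .
  qed
  then show ?thesis by blast
qed

lemma gen_pow_polymap: "\<exists>P Q. gen_pow k = polymap P Q"
  by (auto simp: gen_pow_linear_map linear_map_polymap)

lemma lift_auto:
  assumes \<sigma>: "alg_endo \<sigma>" and \<sigma>': "alg_endo \<sigma>'" 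
    and inv: "\<And>p. p \<in> A \<Longrightarrow> \<sigma> (\<sigma>' p) = p" "\<And>p. p \<in> A \<Longrightarrow> \<sigma>' (\<sigma> p) = p"
  shows "\<exists>\<tau>\<in>N_aut d e. \<forall>a\<in>A. \<forall>v. eval2 (\<sigma> a) v = eval2 a (\<tau> v)"
proof -
  obtain P Q where PQ: "\<sigma> a = bisubst a P Q" if "a \<in> A" for a using lift_endo[OF assms] by blast
  obtain P' Q' where PQ': "\<sigma>' a = bisubst a P' Q'" if "a \<in> A" for a using lift_endo[OF \<sigma>' \<sigma> inv(2,1)] by blast
  define \<tau> where "\<tau> = polymap P Q"
  define \<tau>' where "\<tau>' = polymap P' Q'"
  have e: "eval2 a (\<tau> v) = eval2 (\<sigma> a) v" "eval2 a (\<tau>' v) = eval2 (\<sigma>' a) v" if "a \<in> A" for a v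
    using that by (auto simp: \<tau>_def \<tau>'_def polymap_def PQ PQ')
  have s: "\<sigma> a \<in> A" "\<sigma>' a \<in> A" if "a \<in> A" for a using \<sigma> \<sigma>' that by (auto simp: alg_endo_def)
  have "\<exists>j. \<tau> \<circ> \<tau>' = gen_pow j"
    unfolding \<tau>_def \<tau>'_def polymap_comp 
    by (rule fixes_invariants_imp_gen_pow) (simp add: polymap_comp[symmetric] e[unfolded \<tau>_def \<tau>'_def] s inv)
  then obtain j where j: "\<tau> \<circ> \<tau>' = gen_pow j" ..
  have "\<exists>l. \<tau>' \<circ> \<tau> = gen_pow l"
    unfolding \<tau>_def \<tau>'_def polymap_comp 
    by (rule fixes_invariants_imp_gen_pow) (simp add: polymap_comp[symmetric] e[unfolded \<tau>_def \<tau>'_def] s inv)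
  then obtain l where l: "\<tau>' \<circ> \<tau> = gen_pow l" ..
  \<comment> \<open>Lifts are unique up to G only, so \<tau> \<tau>' is a power of g. Correcting
    \<tau>' by the inverse power yields a genuine inverse of \<tau>.\<close>
  define r where "r = \<tau>' \<circ> gen_pow (j * (d - 1))"
  have r1: "\<tau> \<circ> r = id" unfolding r_def comp_assoc[symmetric] j by (rule gen_pow_inv)
  have "gen_pow (l * (d - 1)) \<circ> \<tau>' \<circ> \<tau> = id" unfolding comp_assoc l by (rule gen_pow_inv)
  then have r2: "r \<circ> \<tau> = id" using r1 by (metis comp_assoc comp_id id_comp)
  obtain P1 Q1 where "gen_pow (j * (d - 1)) = polymap P1 Q1" using gen_pow_polymap by blast
  then have rp: "r = polymap (bisubst P' P1 Q1) (bisubst Q' P1 Q1)" by (simp add: r_def \<tau>'_def polymap_comp)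
  have \<tau>c: "\<tau> \<in> carrier Aut_A2" by (rule Aut_A2I[OF \<tau>_def rp r1 r2])
  obtain P2 Q2 where P2: "gen_pow 1 = polymap P2 Q2" using gen_pow_polymap by blast
  have eq: "\<tau> \<circ> gen_pow 1 \<circ> r = polymap (bisubst (bisubst P P2 Q2) (bisubst P' P1 Q1) (bisubst Q' P1 Q1)) (bisubst (bisubst Q P2 Q2) (bisubst P' P1 Q1) (bisubst Q' P1 Q1))"
    unfolding P2 \<tau>_def rp polymap_comp ..
  \<comment> \<open>The conjugate of g by \<tau> fixes every invariant a because \<sigma> a is
    itself G-invariant; hence it is a power of g.\<close>
  have "\<exists>k. \<tau> \<circ> gen_pow 1 \<circ> r = gen_pow k" unfolding eq
  proof (rule fixes_invariants_imp_gen_pow, unfold eq[symmetric])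
    fix a v assume a: "a \<in> A"
    have "eval2 a ((\<tau> \<circ> gen_pow 1 \<circ> r) v) = eval2 (\<sigma> a) (gen_pow 1 (r v))" using e a by simp
    also have "\<dots> = eval2 (\<sigma> a) (r v)" using s(1)[OF a] unfolding A_iff by metis
    also have "\<dots> = eval2 a ((\<tau> \<circ> r) v)" using e a by simp
    finally show "eval2 a ((\<tau> \<circ> gen_pow 1 \<circ> r) v) = eval2 a v" by (simp add: r1)
  qed
  then obtain k where "\<tau> \<circ> gen_pow 1 \<circ> r = gen_pow k" ..
  then have "\<tau> \<circ> gen_pow 1 = gen_pow k \<circ> \<tau>" using r2 by (metis comp_assoc comp_id)
  then have "\<tau> \<in> N_aut d e" using \<tau>c by (auto simp: N_aut_iff)
  then show ?thesis using e(1)[symmetric] by blast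
qed

section \<open>Automorphisms induced on the spectrum\<close>

abbreviation "X \<equiv> closed_points A"

lemma X_var_eq: "X_var d e = (X, (\<lambda>a. \<lambda>h\<in>X. h a) ` A)"
  by (simp add: X_var_def Spec_def)

definition point :: "complex \<times> complex \<Rightarrow> bipoly \<Rightarrow> complex" where
  "point v = (\<lambda>p\<in>A. eval2 p v)"

lemma point_X: "point v \<in> X"
  by (auto simp: closed_points_def point_def A_add A_mult A_const)

lemma point_apply [simp]: "p \<in> A \<Longrightarrow> point v p = eval2 p v"
  by (simp add: point_def)

text \<open>The polynomial representing p after \<phi>; it exists since automorphisms of the plane
  are polynomial maps, and it is unique since \<open>eval2\<close> is injective.\<close>

definition pullback :: "(complex \<times> complex \<Rightarrow> complex \<times> complex) \<Rightarrow> bipoly \<Rightarrow> bipoly" where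
  "pullback \<phi> p = inv_into UNIV eval2 (eval2 p \<circ> \<phi>)"

lemma eval2_pullback:
  assumes "\<phi> \<in> carrier Aut_A2" shows "eval2 (pullback \<phi> p) v = eval2 p (\<phi> v)"
proof -
  obtain P Q where \<phi>: "\<phi> = polymap P Q" using assms unfolding carrier_Aut_A2 by blast
  have "eval2 p \<circ> \<phi> = eval2 (bisubst p P Q)" by (auto simp: \<phi> polymap_def)
  then have "eval2 p \<circ> \<phi> \<in> range eval2" by simp
  then have "eval2 (pullback \<phi> p) = eval2 p \<circ> \<phi>" unfolding pullback_def by (rule f_inv_into_f)
  then show ?thesis by simp
qed

lemma pullback_A: 
  assumes "\<phi> \<in> N_aut d e" "p \<in> A" shows "pullback \<phi> p \<in> A"
proof -
  obtain k where c: "\<phi> \<in> carrier Aut_A2" and k: "\<phi> \<circ> gen_pow 1 = gen_pow k \<circ> \<phi>" using assms by (auto simp: N_aut_iff)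
  have "\<phi> (gen_pow j v) = gen_pow (k * j) (\<phi> v)" for j v using conj_power[OF k, of j] by (metis comp_apply)
  then show ?thesis using assms(2) unfolding A_iff eval2_pullback[OF c] by metis
qed

text \<open>Two contravariant passages, to polynomials and then to characters, make this covariant:
  evaluation at v goes to evaluation at \<phi> v.\<close>

definition induced :: "(complex \<times> complex \<Rightarrow> complex \<times> complex) \<Rightarrow> (bipoly \<Rightarrow> complex) \<Rightarrow> bipoly \<Rightarrow> complex" where
  "induced \<phi> = (\<lambda>h\<in>X. \<lambda>p\<in>A. h (pullback \<phi> p))"

lemma N_aut_carrier: "\<phi> \<in> N_aut d e \<Longrightarrow> \<phi> \<in> carrier Aut_A2"
  by (simp add: N_aut_iff)

lemma induced_X:
  assumes "\<phi> \<in> N_aut d e" "h \<in> X" shows "induced \<phi> h \<in> X"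
proof -
  note ev = eval2_pullback[OF N_aut_carrier[OF assms(1)]]
  have "pullback \<phi> (const2 c) = const2 c" "pullback \<phi> (p + q) = pullback \<phi> p + pullback \<phi> q"
    "pullback \<phi> (p * q) = pullback \<phi> p * pullback \<phi> q" for c p q
    by (rule eval2_eqI; simp add: ev)+
  then show ?thesis using assms pullback_A[OF assms(1)]
    by (auto simp: closed_points_def induced_def A_add A_mult A_const)
qed

lemma induced_comp:
  assumes "\<phi> \<in> N_aut d e" "\<psi> \<in> N_aut d e"
  shows "induced (\<phi> \<circ> \<psi>) = compose X (induced \<phi>) (induced \<psi>)"
proof -
  have c: "\<phi> \<in> carrier Aut_A2" "\<psi> \<in> carrier Aut_A2" using assms by (auto simp: N_aut_iff)
  have "pullback (\<phi> \<circ> \<psi>) p = pullback \<psi> (pullback \<phi> p)" for p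
    by (rule eval2_eqI) (simp add: eval2_pullback c comp_closed)
  then show ?thesis using pullback_A[OF assms(1)] induced_X[OF assms(2)]
    by (auto simp: compose_def induced_def fun_eq_iff)
qed

lemma induced_id: "induced id = (\<lambda>h\<in>X. h)"
proof -
  have "id \<in> carrier Aut_A2" using AG.one_closed by simp
  then have "pullback id p = p" for p by (intro eval2_eqI) (simp add: eval2_pullback)
  then show ?thesis by (auto simp: induced_def closed_points_def fun_eq_iff extensional_def)
qed

lemma induced_endo:
  assumes "\<phi> \<in> N_aut d e" shows "induced \<phi> \<in> endomorphisms (X_var d e)"
proof -
  have "compose X (\<lambda>h\<in>X. h a) (induced \<phi>) = (\<lambda>h\<in>X. h (pullback \<phi> a))" if "a \<in> A" for a
    using induced_X[OF assms] that by (auto simp: compose_def induced_def fun_eq_iff)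
  then show ?thesis using induced_X[OF assms] pullback_A[OF assms]
    by (auto simp: X_var_eq endomorphisms_def induced_def)
qed

lemma N_aut_inverse:
  assumes "\<phi> \<in> N_aut d e" 
  shows "inv\<^bsub>Aut_A2\<^esub> \<phi> \<in> N_aut d e" "\<phi> \<circ> inv\<^bsub>Aut_A2\<^esub> \<phi> = id" "inv\<^bsub>Aut_A2\<^esub> \<phi> \<circ> \<phi> = id"
  using assms subgroup.m_inv_closed[OF subgroup_N_aut] inv_comp N_aut_carrier by auto

lemma induced_Bij:
  assumes "\<phi> \<in> N_aut d e" shows "induced \<phi> \<in> Bij X"
proof -
  note i = N_aut_inverse[OF assms]
  have "bij_betw (induced \<phi>) X X"
  proof (rule bij_betw_byWitness[where f' = "induced (inv\<^bsub>Aut_A2\<^esub> \<phi>)"])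
    have "compose X (induced (inv\<^bsub>Aut_A2\<^esub> \<phi>)) (induced \<phi>) = (\<lambda>h\<in>X. h)" "compose X (induced \<phi>) (induced (inv\<^bsub>Aut_A2\<^esub> \<phi>)) = (\<lambda>h\<in>X. h)"
      using induced_comp[OF assms i(1)] induced_comp[OF i(1) assms] i induced_id by simp_all
    then show "\<forall>a\<in>X. induced (inv\<^bsub>Aut_A2\<^esub> \<phi>) (induced \<phi> a) = a" "\<forall>a\<in>X. induced \<phi> (induced (inv\<^bsub>Aut_A2\<^esub> \<phi>) a) = a"
      by (metis compose_eq restrict_apply')+
  qed (use induced_X assms i in auto)
  then show ?thesis by (auto simp: Bij_def induced_def)
qed

lemma X_extensional: "snd (X_var d e) \<subseteq> extensional (fst (X_var d e))"
  by (auto simp: X_var_eq)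

lemma induced_Aut:
  assumes "\<phi> \<in> N_aut d e" shows "induced \<phi> \<in> carrier (Aut (X_var d e))"
proof -
  note i = N_aut_inverse[OF assms]
  interpret B: group "BijGroup X" by (rule group_BijGroup)
  have B: "induced \<phi> \<in> Bij X" "induced (inv\<^bsub>Aut_A2\<^esub> \<phi>) \<in> Bij X" using induced_Bij assms i by auto
  have "inv\<^bsub>BijGroup X\<^esub> (induced \<phi>) = induced (inv\<^bsub>Aut_A2\<^esub> \<phi>)"
  proof (rule B.inv_equality)
    show "induced (inv\<^bsub>Aut_A2\<^esub> \<phi>) \<otimes>\<^bsub>BijGroup X\<^esub> induced \<phi> = \<one>\<^bsub>BijGroup X\<^esub>"
      using B by (simp add: mult_BijGroup induced_comp[symmetric] assms i induced_id) (simp add: BijGroup_def)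
  qed (use B in \<open>simp_all add: BijGroup_def\<close>)
  then show ?thesis using B induced_endo assms i by (simp add: Aut_def X_var_eq)
qed

text \<open>Pulling regular functions back along F and along its inverse gives maps \<sigma> and
  \<sigma>' of A. Identities in A can be tested on the characters \<open>point v\<close>, which
  shows that these maps are algebra endomorphisms inverse to each other, so \<sigma> lifts.\<close>

lemma induced_surj:
  assumes F: "F \<in> carrier (Aut (X_var d e))" shows "\<exists>\<phi>\<in>N_aut d e. induced \<phi> = F"
proof -
  interpret B: group "BijGroup X" by (rule group_BijGroup)
  define F' where "F' = inv\<^bsub>BijGroup X\<^esub> F"
  have FB: "F \<in> Bij X" "F \<in> endomorphisms (X_var d e)" "F' \<in> endomorphisms (X_var d e)"
    using F by (auto simp: Aut_def X_var_eq F'_def)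
  have car: "carrier (BijGroup X) = Bij X" and one: "\<one>\<^bsub>BijGroup X\<^esub> = (\<lambda>h\<in>X. h)" by (simp_all add: BijGroup_def)
  have F'B: "F' \<in> Bij X" using B.inv_closed[of F, unfolded car, OF FB(1)] unfolding F'_def .
  have "F \<otimes>\<^bsub>BijGroup X\<^esub> F' = (\<lambda>h\<in>X. h)" "F' \<otimes>\<^bsub>BijGroup X\<^esub> F = (\<lambda>h\<in>X. h)"
    unfolding F'_def using B.r_inv[of F, unfolded car one, OF FB(1)] B.l_inv[of F, unfolded car one, OF FB(1)] .
  then have "compose X F F' = (\<lambda>h\<in>X. h)" "compose X F' F = (\<lambda>h\<in>X. h)"
    by (simp_all only: mult_BijGroup FB F'B)
  then have FF': "F (F' h) = h" "F' (F h) = h" if "h \<in> X" for h using that by (metis compose_eq restrict_apply')+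
  have dual: "\<exists>\<sigma>. alg_endo \<sigma> \<and> (\<forall>a\<in>A. \<forall>h\<in>X. f h a = h (\<sigma> a))" if f: "f \<in> endomorphisms (X_var d e)" for f
  proof -
    have fX: "f h \<in> X" if "h \<in> X" for h using f that by (auto simp: X_var_eq endomorphisms_def)
    have "\<exists>b\<in>A. \<forall>h\<in>X. f h a = h b" if a: "a \<in> A" for a
    proof -
      have "compose X (\<lambda>h\<in>X. h a) f \<in> (\<lambda>a. \<lambda>h\<in>X. h a) ` A" using f a by (auto simp: X_var_eq endomorphisms_def)
      then obtain b where b: "b \<in> A" "compose X (\<lambda>h\<in>X. h a) f = (\<lambda>h\<in>X. h b)" by auto
      have "f h a = h b" if "h \<in> X" for h using fun_cong[OF b(2), of h] that fX[OF that] by (simp add: compose_def)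
      then show ?thesis using b by blast
    qed
    then obtain \<sigma> where \<sigma>: "\<And>a. a \<in> A \<Longrightarrow> \<sigma> a \<in> A" "\<And>a h. a \<in> A \<Longrightarrow> h \<in> X \<Longrightarrow> f h a = h (\<sigma> a)" by metis
    have ev: "eval2 (\<sigma> a) v = f (point v) a" if "a \<in> A" for a v using \<sigma>(2)[OF that point_X, of v] \<sigma>(1)[OF that] by simp
    have f1: "f (point v) (const2 c) = c" "p \<in> A \<Longrightarrow> q \<in> A \<Longrightarrow> f (point v) (p + q) = f (point v) p + f (point v) q"
       "p \<in> A \<Longrightarrow> q \<in> A \<Longrightarrow> f (point v) (p * q) = f (point v) p * f (point v) q" for v c p q
      using fX[OF point_X, of v] by (simp_all add: closed_points_def)
    have "alg_endo \<sigma>" unfolding alg_endo_def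
    proof (intro conjI ballI allI)
      show "\<sigma> (const2 c) = const2 c" for c by (rule eval2_eqI) (simp add: ev A_const f1)
      show "\<sigma> (p + q) = \<sigma> p + \<sigma> q" "\<sigma> (p * q) = \<sigma> p * \<sigma> q" if "p \<in> A" "q \<in> A" for p q
        by (rule eval2_eqI; simp add: ev A_add A_mult f1 that)+
    qed (rule \<sigma>(1))
    then show ?thesis using \<sigma> by blast
  qed
  obtain \<sigma> where \<sigma>: "alg_endo \<sigma>" "\<And>a h. a \<in> A \<Longrightarrow> h \<in> X \<Longrightarrow> F h a = h (\<sigma> a)" using dual[OF FB(2)] by blast
  obtain \<sigma>' where \<sigma>': "alg_endo \<sigma>'" "\<And>a h. a \<in> A \<Longrightarrow> h \<in> X \<Longrightarrow> F' h a = h (\<sigma>' a)" using dual[OF FB(3)] by blast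
  have FX: "F h \<in> X" "F' h \<in> X" if "h \<in> X" for h using FB(1) F'B that Bij_imp_funcset by blast+
  have sA: "\<sigma> a \<in> A" "\<sigma>' a \<in> A" if "a \<in> A" for a using \<sigma> \<sigma>' that by (auto simp: alg_endo_def)
  have inv: "\<sigma> (\<sigma>' p) = p" "\<sigma>' (\<sigma> p) = p" if p: "p \<in> A" for p
  proof -
    have "eval2 (\<sigma> (\<sigma>' p)) v = eval2 p v" for v
      using \<sigma>(2)[OF sA(2)[OF p] point_X, of v] \<sigma>'(2)[OF p FX(1)[OF point_X], of v] FF'(2)[OF point_X, of v] p sA by simp
    then show "\<sigma> (\<sigma>' p) = p" by (rule eval2_eqI)
    have "eval2 (\<sigma>' (\<sigma> p)) v = eval2 p v" for v
      using \<sigma>'(2)[OF sA(1)[OF p] point_X, of v] \<sigma>(2)[OF p FX(2)[OF point_X], of v] FF'(1)[OF point_X, of v] p sA by simp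
    then show "\<sigma>' (\<sigma> p) = p" by (rule eval2_eqI)
  qed
  obtain \<tau> where \<tau>: "\<tau> \<in> N_aut d e" "\<And>a v. a \<in> A \<Longrightarrow> eval2 (\<sigma> a) v = eval2 a (\<tau> v)" 
    using lift_auto[OF \<sigma>(1) \<sigma>'(1) inv] by blast
  have pb: "pullback \<tau> a = \<sigma> a" if "a \<in> A" for a
    by (rule eval2_eqI) (simp add: eval2_pullback N_aut_carrier \<tau> that)
  have "induced \<tau> h = F h" for h
  proof (cases "h \<in> X")
    case True
    then have "induced \<tau> h p = F h p" for p
      using FX(1)[OF True] by (cases "p \<in> A") (auto simp: induced_def pb \<sigma>(2) closed_points_def extensional_def)
    then show ?thesis by blast
  next
    case False
    then show ?thesis using Bij_imp_extensional[OF FB(1)] by (simp add: induced_def extensional_def)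
  qed
  then show ?thesis using \<tau>(1) by blast
qed

lemma induced_kernel:
  assumes "\<phi> \<in> N_aut d e" shows "induced \<phi> = (\<lambda>h\<in>X. h) \<longleftrightarrow> \<phi> \<in> range gen_pow"
proof
  assume *: "induced \<phi> = (\<lambda>h\<in>X. h)"
  obtain P Q where \<phi>: "\<phi> = polymap P Q" using N_aut_carrier[OF assms] unfolding carrier_Aut_A2 by blast
  have "eval2 a (polymap P Q v) = eval2 a v" if a: "a \<in> A" for a v
  proof -
    have "induced \<phi> (point v) a = point v a" using * point_X by simp
    then show ?thesis using a pullback_A[OF assms a] point_X eval2_pullback[OF N_aut_carrier[OF assms], of a v]
      by (simp add: induced_def \<phi>)
  qed
  then show "\<phi> \<in> range gen_pow" using fixes_invariants_imp_gen_pow[of P Q] \<phi> by auto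
next
  assume "\<phi> \<in> range gen_pow"
  then obtain k where k: "\<phi> = gen_pow k" by blast
  have "pullback (gen_pow k) p = p" if "p \<in> A" for p
    using that unfolding A_iff by (intro eval2_eqI) (metis eval2_pullback gen_pow_carrier)
  then show "induced \<phi> = (\<lambda>h\<in>X. h)" unfolding k
    by (auto simp: induced_def closed_points_def fun_eq_iff extensional_def)
qed

theorem quot_N_aut_iso: "quot (N_aut d e) d e \<cong> Aut (X_var d e)"
proof -
  let ?N = "Aut_A2\<lparr>carrier := N_aut d e\<rparr>"
  interpret N: group ?N by (rule AG.subgroup_imp_group[OF subgroup_N_aut])
  interpret AX: group "Aut (X_var d e)" by (rule group_Aut[OF X_extensional])
  have one: "\<one>\<^bsub>Aut (X_var d e)\<^esub> = (\<lambda>h\<in>X. h)" by (simp add: Aut_def BijGroup_def X_var_eq)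
  have mA: "f \<otimes>\<^bsub>Aut (X_var d e)\<^esub> g = f \<otimes>\<^bsub>BijGroup X\<^esub> g" for f g by (simp add: Aut_def X_var_eq)
  interpret group_hom ?N "Aut (X_var d e)" induced
  proof
    show "induced \<in> hom ?N (Aut (X_var d e))"
    proof (rule homI)
      fix f g assume "f \<in> carrier ?N" "g \<in> carrier ?N"
      then have fg: "f \<in> N_aut d e" "g \<in> N_aut d e" by auto
      show "induced (f \<otimes>\<^bsub>?N\<^esub> g) = induced f \<otimes>\<^bsub>Aut (X_var d e)\<^esub> induced g"
        using fg by (simp add: mA mult_Aut_A2 N_aut_carrier induced_comp mult_BijGroup induced_Bij)
    qed (use induced_Aut in auto)
  qed
  have "kernel ?N (Aut (X_var d e)) induced = G_grp d e"
    using induced_kernel gen_pow_N_aut by (auto simp: kernel_def one G_eq)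
  moreover have "induced ` carrier ?N = carrier (Aut (X_var d e))"
    using induced_Aut induced_surj by force
  ultimately show ?thesis unfolding quot_def using FactGroup_iso by simp
qed

end

section \<open>Amalgamated free products\<close>

fun word_val :: "'a monoid \<Rightarrow> ('a + 'a) list \<Rightarrow> 'a" where
  "word_val K [] = \<one>\<^bsub>K\<^esub>"
| "word_val K (l # w) = case_sum id id l \<otimes>\<^bsub>K\<^esub> word_val K w"

text \<open>Naming the factor by a boolean, \<open>True\<close> for the left one, allows one
  argument to serve both sides.\<close>

definition letter :: "bool \<Rightarrow> 'a \<Rightarrow> 'a + 'a" where
  "letter s = (if s then Inl else Inr)"

lemma letter_simps [simp]: "letter True = Inl" "letter False = Inr" "isl (letter s x) = s" "case_sum f f (letter s x) = f x"
  by (simp_all add: letter_def)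

lemma letter_cases: obtains s x where "l = letter s x"
  by (cases l) (metis letter_simps(1), metis letter_simps(2))

text \<open>Alternating words. The empty word is excluded, since its value is the identity.\<close>

fun reduced :: "(bool \<Rightarrow> 'a set) \<Rightarrow> ('a + 'a) list \<Rightarrow> bool" where
  "reduced R [] \<longleftrightarrow> False"
| "reduced R [l] \<longleftrightarrow> case_sum id id l \<in> R (isl l)"
| "reduced R (l # l' # w) \<longleftrightarrow> case_sum id id l \<in> R (isl l) \<and> isl l \<noteq> isl l' \<and> reduced R (l' # w)"

text \<open>The internal characterization of an amalgamated product: A and B generate, and no
  alternating word with letters outside C is trivial. Generation is phrased through subgroups
  M.\<close>

locale amalgamated_pair = group K for K :: "'a monoid" (structure) +
  fixes A B C :: "'a set"
  assumes subA: "subgroup A K" and subB: "subgroup B K" and C: "C = A \<inter> B"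
    and no_relation: "\<And>w. reduced (\<lambda>s. (if s then A else B) - C) w \<Longrightarrow> word_val K w \<noteq> \<one>"
    and generates: "\<And>M. subgroup M K \<Longrightarrow> A \<subseteq> M \<Longrightarrow> B \<subseteq> M \<Longrightarrow> M = carrier K"
begin

abbreviation "Words \<equiv> amalg_words (K\<lparr>carrier := A\<rparr>) (K\<lparr>carrier := B\<rparr>)"
abbreviation "Step \<equiv> amalg_step (K\<lparr>carrier := A\<rparr>) (K\<lparr>carrier := B\<rparr>) (K\<lparr>carrier := C\<rparr>)"
abbreviation word_equiv (infix "\<approx>" 50) where "u \<approx> v \<equiv> equivclp Step u v"
abbreviation "S \<equiv> \<lambda>s. if s then A else B"

lemma Words_Cons [simp]: "l # w \<in> Words \<longleftrightarrow> case_sum id id l \<in> S (isl l) \<and> w \<in> Words"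
  by (cases l) (auto simp: amalg_words_def)

lemma Words_Nil [simp]: "[] \<in> Words"
  by (simp add: amalg_words_def)

lemma Words_append [simp]: "u @ v \<in> Words \<longleftrightarrow> u \<in> Words \<and> v \<in> Words"
  by (induction u) auto

lemma S_carrier: "x \<in> S s \<Longrightarrow> x \<in> carrier K"
  using subgroup.mem_carrier[OF subA] subgroup.mem_carrier[OF subB] by (auto split: if_splits)

lemma S_closed: "x \<in> S s \<Longrightarrow> y \<in> S s \<Longrightarrow> x \<otimes> y \<in> S s"
  using subgroup.m_closed[OF subA] subgroup.m_closed[OF subB] by (auto split: if_splits)

lemma S_inv: "x \<in> S s \<Longrightarrow> inv x \<in> S s"
  using subgroup.m_inv_closed[OF subA] subgroup.m_inv_closed[OF subB] by (auto split: if_splits)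

lemma S_one: "\<one> \<in> S s"
  using subgroup.one_closed[OF subA] subgroup.one_closed[OF subB] by auto

lemma C_S: "x \<in> C \<Longrightarrow> x \<in> S s"
  by (auto simp: C)

lemma subC: "subgroup C K"
  unfolding C by (rule subgroups_Inter_pair[OF subA subB])

lemma word_val_carrier [simp]: "w \<in> Words \<Longrightarrow> word_val K w \<in> carrier K"
  by (induction w) (auto intro: S_carrier)

lemma word_val_append: "u \<in> Words \<Longrightarrow> v \<in> Words \<Longrightarrow> word_val K (u @ v) = word_val K u \<otimes> word_val K v"
  by (induction u) (auto simp: m_assoc S_carrier)

text \<open>The steps allow arbitrary lists as context and are used in both directions, so
  membership in \<open>Words\<close> has to be carried along as an equivalence.\<close>

lemma Step_sound:
  assumes "Step u v" shows "(u \<in> Words \<longleftrightarrow> v \<in> Words) \<and> (u \<in> Words \<longrightarrow> word_val K u = word_val K v)"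
  using assms
proof cases
  case (common c u' v') then show ?thesis using C_S[of c True] C_S[of c False]
    by (auto simp: word_val_append)
qed (use S_one[of True] S_one[of False] S_closed[of _ True] S_closed[of _ False] in 
      \<open>auto simp: word_val_append m_assoc S_carrier[of _ True, simplified] S_carrier[of _ False, simplified]\<close>)

lemma equiv_sound:
  assumes "u \<approx> v" shows "(u \<in> Words \<longleftrightarrow> v \<in> Words) \<and> (u \<in> Words \<longrightarrow> word_val K u = word_val K v)"
  using assms
proof (induction rule: equivclp_induct)
  case (step y z) then show ?case using Step_sound[of y z] Step_sound[of z y] by auto
qed auto

lemma Step_context: "Step u v \<Longrightarrow> Step (a @ u @ b) (a @ v @ b)"
proof (induction rule: amalg_step.induct)
  case (one_left u v)
  have "Step ((a @ u) @ [Inl \<one>\<^bsub>K\<lparr>carrier := A\<rparr>\<^esub>] @ (v @ b)) ((a @ u) @ (v @ b))" by (rule amalg_step.one_left)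
  then show ?case by simp
next
  case (one_right u v)
  have "Step ((a @ u) @ [Inr \<one>\<^bsub>K\<lparr>carrier := B\<rparr>\<^esub>] @ (v @ b)) ((a @ u) @ (v @ b))" by (rule amalg_step.one_right)
  then show ?case by simp
next
  case (mult_left x y u v)
  then have "Step ((a @ u) @ [Inl x, Inl y] @ (v @ b)) ((a @ u) @ [Inl (x \<otimes>\<^bsub>K\<lparr>carrier := A\<rparr>\<^esub> y)] @ (v @ b))" by (rule amalg_step.mult_left)
  then show ?case by simp
next
  case (mult_right x y u v)
  then have "Step ((a @ u) @ [Inr x, Inr y] @ (v @ b)) ((a @ u) @ [Inr (x \<otimes>\<^bsub>K\<lparr>carrier := B\<rparr>\<^esub> y)] @ (v @ b))" by (rule amalg_step.mult_right)
  then show ?case by simp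
next
  case (common c u v)
  then have "Step ((a @ u) @ [Inl c] @ (v @ b)) ((a @ u) @ [Inr c] @ (v @ b))" by (rule amalg_step.common)
  then show ?case by simp
qed

lemma equiv_context: "u \<approx> v \<Longrightarrow> a @ u @ b \<approx> a @ v @ b"
proof (induction rule: equivclp_induct)
  case (step y z) 
  then have "a @ y @ b \<approx> a @ z @ b" using Step_context[of y z a b] Step_context[of z y a b] by (auto intro: r_into_equivclp converse_r_into_equivclp)
  with step.IH show ?case by (rule equivclp_trans)
qed simp

lemma equiv_Cons: "u \<approx> v \<Longrightarrow> l # u \<approx> l # v"
  using equiv_context[of u v "[l]" "[]"] by simp

lemma letter_mult:
  assumes "x \<in> S s" "y \<in> S s" shows "letter s x # letter s y # w \<approx> letter s (x \<otimes> y) # w"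
proof (cases s)
  case True
  with assms have "Step ([] @ [Inl x, Inl y] @ w) ([] @ [Inl (x \<otimes>\<^bsub>K\<lparr>carrier := A\<rparr>\<^esub> y)] @ w)"
    by (intro amalg_step.mult_left) auto
  from r_into_equivclp[of Step, OF this] True show ?thesis by simp
next
  case False
  with assms have "Step ([] @ [Inr x, Inr y] @ w) ([] @ [Inr (x \<otimes>\<^bsub>K\<lparr>carrier := B\<rparr>\<^esub> y)] @ w)"
    by (intro amalg_step.mult_right) auto
  from r_into_equivclp[of Step, OF this] False show ?thesis by simp
qed

lemma letter_one: "letter s \<one> # w \<approx> w"
proof (cases s)
  case True
  have "Step ([] @ [Inl \<one>\<^bsub>K\<lparr>carrier := A\<rparr>\<^esub>] @ w) ([] @ w)" by (rule amalg_step.one_left)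
  from r_into_equivclp[of Step, OF this] True show ?thesis by simp
next
  case False
  have "Step ([] @ [Inr \<one>\<^bsub>K\<lparr>carrier := B\<rparr>\<^esub>] @ w) ([] @ w)" by (rule amalg_step.one_right)
  from r_into_equivclp[of Step, OF this] False show ?thesis by simp
qed

lemma letter_common:
  assumes "c \<in> C" shows "letter s c # w \<approx> letter s' c # w"
proof -
  have "Step ([] @ [Inl c] @ w) ([] @ [Inr c] @ w)" using assms by (intro amalg_step.common) auto
  from r_into_equivclp[of Step, OF this] have 1: "Inl c # w \<approx> Inr c # w" by simp
  show ?thesis using 1 equivclp_sym[OF 1] by (auto simp: letter_def)
qed

abbreviation "Red \<equiv> reduced (\<lambda>s. S s - C)"

lemma Red_head:
  assumes "Red (letter s x # w)" "y \<in> S s - C" shows "Red (letter s y # w)"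
  using assms by (cases w) auto

text \<open>Elements of C, the identity included, are represented by a single left letter.\<close>

definition normal_form :: "('a + 'a) list \<Rightarrow> bool" where
  "normal_form w \<longleftrightarrow> (\<exists>c\<in>C. w = [Inl c]) \<or> Red w"

text \<open>An element of C lies in both factors, so it can change to the side of the first letter
  and merge with it; the product stays outside C.\<close>

lemma absorb: 
  assumes c: "c \<in> C" and w: "Red w" shows "\<exists>w'. letter s c # w \<approx> w' \<and> Red w'"
proof -
  obtain t x v where wv: "w = letter t x # v" using w by (metis letter_cases reduced.simps(1) neq_Nil_conv)
  then have x: "x \<in> S t - C" using w by (cases v) auto
  have "letter s c # w \<approx> letter t c # w" by (rule letter_common[OF c])
  also have "letter t c # w \<approx> letter t (c \<otimes> x) # v" unfolding wv using x C_S[OF c] by (intro letter_mult) auto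
  finally have 1: "letter s c # w \<approx> letter t (c \<otimes> x) # v" .
  have "c \<otimes> x \<notin> C"
  proof
    assume "c \<otimes> x \<in> C"
    then have "inv c \<otimes> (c \<otimes> x) \<in> C" using subC c by (metis subgroup.m_closed subgroup.m_inv_closed)
    then show False using x c C_S[OF c, of t] S_carrier[of _ t] by (simp add: m_assoc[symmetric])
  qed
  moreover have "c \<otimes> x \<in> S t" using x C_S[OF c] by (intro S_closed) blast+
  ultimately have "Red (letter t (c \<otimes> x) # v)" by (intro Red_head[OF w[unfolded wv] DiffI])
  with 1 show ?thesis by blast
qed

lemma ex_normal_form_trans:
  assumes "u \<approx> v" "\<exists>w. v \<approx> w \<and> normal_form w" shows "\<exists>w. u \<approx> w \<and> normal_form w"
proof -
  obtain w where w: "v \<approx> w" "normal_form w" using assms(2) by blast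
  have "u \<approx> w" by (rule equivclp_trans[OF assms(1) w(1)])
  then show ?thesis using w(2) by (intro exI conjI)
qed

lemma normal_form_single: assumes "x \<in> S s" shows "\<exists>w'. [letter s x] \<approx> w' \<and> normal_form w'"
proof (cases "x \<in> C")
  case True
  then show ?thesis using letter_common[OF True, of s "[]" True] unfolding normal_form_def by auto
next
  case False
  then have "normal_form [letter s x]" using assms by (auto simp: normal_form_def)
  then show ?thesis using equivclp_refl by metis
qed

text \<open>A new letter either alternates with the first one or merges with it. If the merged
  letter falls into C, it is absorbed by what follows.\<close>

lemma normal_form_Cons:
  assumes x: "x \<in> S s" and w: "normal_form w" shows "\<exists>w'. letter s x # w \<approx> w' \<and> normal_form w'"
  using w unfolding normal_form_def[of w]
proof
  assume "\<exists>c\<in>C. w = [Inl c]"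
  then obtain c where c: "c \<in> C" "w = [letter True c]" by (auto simp: letter_def)
  have "letter s x # w \<approx> letter s x # letter s c # []" unfolding c by (intro equiv_Cons letter_common c)
  also have "\<dots> \<approx> [letter s (x \<otimes> c)]" using x C_S[OF c(1)] by (intro letter_mult)
  finally have 1: "letter s x # w \<approx> [letter s (x \<otimes> c)]" .
  have "x \<otimes> c \<in> S s" using x C_S[OF c(1)] by (intro S_closed)
  from normal_form_single[OF this] show ?thesis by (rule ex_normal_form_trans[OF 1])
next
  assume w: "Red w"
  show ?thesis
  proof (cases "x \<in> C")
    case True
    then show ?thesis using absorb[OF True w, of s] unfolding normal_form_def by blast
  next
    case False
    obtain t y v where wv: "w = letter t y # v" using w by (metis letter_cases reduced.simps(1) neq_Nil_conv)
    then have y: "y \<in> S t - C" using w by (cases v) auto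
    show ?thesis
    proof (cases "s = t")
      case neq: False
      then have "Red (letter s x # w)" using x False w unfolding wv by (simp del: if_split)
      then have "normal_form (letter s x # w)" by (simp add: normal_form_def)
      then show ?thesis using equivclp_refl by metis
    next
      case True
      have 1: "letter s x # w \<approx> letter s (x \<otimes> y) # v" unfolding wv True using x y True by (intro letter_mult) auto
      have xy: "x \<otimes> y \<in> S s" using x y True by (intro S_closed) auto
      show ?thesis
      proof (cases "v = []")
        case True
        then show ?thesis using ex_normal_form_trans[OF 1] normal_form_single[OF xy] by simp
      next
        case v: False
        show ?thesis
        proof (cases "x \<otimes> y \<in> C")
          case False
          have "Red (letter s y # v)" using w unfolding wv \<open>s = t\<close> .
          then have "Red (letter s (x \<otimes> y) # v)" by (rule Red_head) (use xy False in blast)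
          then have "normal_form (letter s (x \<otimes> y) # v)" unfolding normal_form_def by (rule disjI2)
          with 1 show ?thesis by (intro exI conjI)
        next
          case c: True
          have "Red v" using w v unfolding wv by (cases v) auto
          then have "\<exists>w. letter s (x \<otimes> y) # v \<approx> w \<and> normal_form w" using absorb[OF c, of v s] unfolding normal_form_def by blast
          then show ?thesis by (rule ex_normal_form_trans[OF 1])
        qed
      qed
    qed
  qed
qed

lemma normal_form_exists: "w \<in> Words \<Longrightarrow> \<exists>w'. w \<approx> w' \<and> normal_form w'"
proof (induction w)
  case Nil
  have "[] \<approx> [letter True \<one>]" by (rule equivclp_sym[OF letter_one])
  moreover have "normal_form [letter True \<one>]" using subgroup.one_closed[OF subC] by (auto simp: normal_form_def)
  ultimately show ?case by blast
next
  case (Cons l w)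
  obtain s x where l: "l = letter s x" by (rule letter_cases)
  obtain w' where w': "w \<approx> w'" "normal_form w'" using Cons by auto
  have "x \<in> S s" using Cons.prems by (simp add: l del: if_split)
  from normal_form_Cons[OF this w'(2)] show ?case unfolding l by (rule ex_normal_form_trans[OF equiv_Cons[OF w'(1)]])
qed

text \<open>By \<open>no_relation\<close> the normal form of a word of value 1 is not reduced, so it
  is a letter from C of value 1.\<close>

lemma word_val_one_imp: 
  assumes "w \<in> Words" "word_val K w = \<one>" shows "w \<approx> []"
proof -
  obtain w' where w': "w \<approx> w'" "normal_form w'" using normal_form_exists assms by blast
  then have "w' \<in> Words" "word_val K w' = \<one>" using equiv_sound[OF w'(1)] assms by auto
  then obtain c where "c \<in> C" "w' = [Inl c]" using w'(2) no_relation by (auto simp: normal_form_def)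
  then have "w' = [letter True \<one>]" using \<open>word_val K w' = \<one>\<close> C_S[of c True] S_carrier[of c True] by simp
  then show ?thesis using w'(1) letter_one[of True "[]"] by (metis equivclp_trans)
qed

text \<open>Words are lists and have no inverses of their own; these ones reduce equality of two
  values to triviality of one word.\<close>

lemma inv_word_ex: "v \<in> Words \<Longrightarrow> \<exists>u\<in>Words. word_val K u = inv (word_val K v) \<and> u @ v \<approx> []"
proof (induction v)
  case Nil
  then show ?case by (intro bexI[of _ "[]"]) auto
next
  case (Cons l v)
  obtain s x where l: "l = letter s x" by (rule letter_cases)
  obtain u where u: "u \<in> Words" "word_val K u = inv (word_val K v)" "u @ v \<approx> []" using Cons by auto
  have x: "x \<in> S s" using Cons.prems by (simp add: l del: if_split)
  have xc: "x \<in> carrier K" using x by (rule S_carrier)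
  let ?u = "u @ [letter s (inv x)]"
  have W: "?u \<in> Words" using u x S_inv[OF x] by (simp del: if_split)
  have v: "v \<in> Words" using Cons.prems by simp
  have "word_val K ?u = inv (word_val K (l # v))" using u W v xc
    by (simp add: word_val_append inv_mult_group l del: if_split)
  moreover have "?u @ l # v \<approx> []" 
  proof (rule word_val_one_imp)
    have "word_val K (?u @ l # v) = word_val K ?u \<otimes> word_val K (l # v)" using W Cons.prems by (intro word_val_append)
    also have "\<dots> = \<one>" using \<open>word_val K ?u = inv (word_val K (l # v))\<close> Cons.prems by (simp del: word_val.simps)
    finally show "word_val K (?u @ l # v) = \<one>" .
  qed (use W Cons.prems in simp)
  ultimately show ?case using W by blast
qed

lemma equiv_iff:
  assumes "u \<in> Words" "v \<in> Words" shows "u \<approx> v \<longleftrightarrow> word_val K u = word_val K v"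
proof
  assume eq: "word_val K u = word_val K v"
  obtain v' where v': "v' \<in> Words" "word_val K v' = inv (word_val K v)" "v' @ v \<approx> []" using inv_word_ex assms by blast
  have "u @ v' \<approx> []" using v' assms eq by (intro word_val_one_imp) (auto simp: word_val_append)
  from equiv_context[OF this, of "[]" v] have "u @ v' @ v \<approx> v" by simp
  moreover have "u @ v' @ v \<approx> u" using equiv_context[OF v'(3), of u "[]"] by simp
  ultimately show "u \<approx> v" by (metis equivclp_trans equivclp_sym)
qed (use assms equiv_sound in blast)

lemma word_val_surj: assumes "k \<in> carrier K" shows "\<exists>w\<in>Words. word_val K w = k"
proof -
  let ?M = "word_val K ` Words"
  have "subgroup ?M K"
  proof
    show "?M \<subseteq> carrier K" by auto
    show "\<one> \<in> ?M" using image_eqI[of "\<one>" "word_val K" "[]" Words] by simp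
    show "x \<otimes> y \<in> ?M" if "x \<in> ?M" "y \<in> ?M" for x y
      using that word_val_append by (auto simp: image_iff) (metis Words_append)
    show "inv x \<in> ?M" if "x \<in> ?M" for x using that inv_word_ex by (auto simp: image_iff) metis
  qed
  moreover have "A \<subseteq> ?M" using S_carrier[of _ True] by (force intro: image_eqI[of _ _ "[Inl _]"])
  moreover have "B \<subseteq> ?M" using S_carrier[of _ False] by (force intro: image_eqI[of _ _ "[Inr _]"])
  ultimately have "?M = carrier K" by (rule generates)
  then have "k \<in> ?M" using assms by simp
  then obtain w where w: "k = word_val K w" "w \<in> Words" by (rule imageE)
  show ?thesis using w(1)[symmetric] w(2) by (rule bexI)
qed

theorem iso_amalg: "K \<cong> amalg (K\<lparr>carrier := A\<rparr>) (K\<lparr>carrier := C\<rparr>) (K\<lparr>carrier := B\<rparr>)"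
proof -
  let ?P = "amalg (K\<lparr>carrier := A\<rparr>) (K\<lparr>carrier := C\<rparr>) (K\<lparr>carrier := B\<rparr>)"
  let ?R = "amalg_rel (K\<lparr>carrier := A\<rparr>) (K\<lparr>carrier := B\<rparr>) (K\<lparr>carrier := C\<rparr>)"
  \<comment> \<open>The set of all words of value k is exactly one equivalence class, by
    \<open>equiv_iff\<close>, so h is the inverse of evaluation.\<close>
  define h where "h k = {w \<in> Words. word_val K w = k}" for k
  have R: "?R `` {u} = h (word_val K u)" if "u \<in> Words" for u
    using that equiv_iff by (auto simp: amalg_rel_def h_def)
  have carr: "carrier ?P = h ` carrier K"
  proof -
    have "carrier ?P = (\<lambda>u. ?R `` {u}) ` Words" by (auto simp: amalg_def quotient_def)
    also have "\<dots> = (\<lambda>u. h (word_val K u)) ` Words" using R by (intro image_cong refl)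
    also have "\<dots> = h ` carrier K" proof safe
      fix k assume "k \<in> carrier K"
      then obtain w where w: "w \<in> Words" "word_val K w = k" using word_val_surj by blast
      show "h k \<in> (\<lambda>u. h (word_val K u)) ` Words" by (rule image_eqI[of _ _ w]) (simp_all add: w)
    qed auto
    finally show ?thesis .
  qed
  have "h x \<otimes>\<^bsub>?P\<^esub> h y = h (x \<otimes> y)" if xc: "x \<in> carrier K" and yc: "y \<in> carrier K" for x y
  proof -
    obtain u v where uv: "u \<in> h x" "v \<in> h y" using word_val_surj[OF xc] word_val_surj[OF yc] unfolding h_def by blast
    have "h x \<otimes>\<^bsub>?P\<^esub> h y = (\<Union>u\<in>h x. \<Union>v\<in>h y. ?R `` {u @ v})" by (simp add: amalg_def)
    also have "\<dots> = (\<Union>u\<in>h x. \<Union>v\<in>h y. h (x \<otimes> y))"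
    proof (intro SUP_cong refl)
      fix u v assume "u \<in> h x" "v \<in> h y"
      then have "u @ v \<in> Words" "word_val K (u @ v) = x \<otimes> y" by (auto simp: h_def word_val_append)
      then show "?R `` {u @ v} = h (x \<otimes> y)" using R by simp
    qed
    also have "\<dots> = h (x \<otimes> y)" using uv by blast
    finally show ?thesis .
  qed
  moreover have "inj_on h (carrier K)"
  proof (rule inj_onI)
    fix x y assume "x \<in> carrier K" "h x = h y"
    then show "x = y" using word_val_surj[of x] unfolding h_def by blast
  qed
  ultimately have "h \<in> iso K ?P" unfolding iso_def hom_def bij_betw_def using carr by auto
  then show ?thesis unfolding is_iso_def by blast
qed

end

section \<open>The normalizer as an amalgamated product\<close>

definition curve :: "complex poly \<Rightarrow> complex poly \<Rightarrow> complex \<Rightarrow> complex \<times> complex" where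
  "curve r s = (\<lambda>t. (poly r t, poly s t))"

lemma curve_inj: "curve r s = curve r' s' \<longleftrightarrow> r = r' \<and> s = s'"
  by (auto simp: curve_def fun_eq_iff intro: poly_ext)

abbreviation line :: "complex \<Rightarrow> complex \<Rightarrow> complex \<times> complex" where
  "line c \<equiv> curve [:0, 1:] [:0, c:]"

text \<open>Half of a ping-pong on polynomial curves: if the second component is not dominated, a
  letter of the left factor makes the first one strictly dominate, and the second stays
  nonconstant.\<close>

definition raises_fst :: "(complex \<times> complex \<Rightarrow> complex \<times> complex) \<Rightarrow> bool" where
  "raises_fst a \<longleftrightarrow> (\<forall>r s. degree s \<ge> degree r \<longrightarrow> degree s \<ge> 1 \<longrightarrow>
     (\<exists>r' s'. a \<circ> curve r s = curve r' s' \<and> degree r' > degree s' \<and> degree s' \<ge> 1))"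

text \<open>
  In the second conjunct the finite set removes the lines on which the second coordinate of a linear
  map vanishes.
\<close>

definition raises_snd :: "(complex \<times> complex \<Rightarrow> complex \<times> complex) \<Rightarrow> bool" where
  "raises_snd b \<longleftrightarrow> (\<forall>r s. degree r > degree s \<longrightarrow>
     (\<exists>r' s'. b \<circ> curve r s = curve r' s' \<and> degree s' \<ge> degree r' \<and> degree s' \<ge> degree r)) \<and>
     (\<exists>Z. finite Z \<and> (\<forall>c. c \<notin> Z \<longrightarrow> (\<exists>r' s'. b \<circ> line c = curve r' s' \<and> degree s' \<ge> degree r' \<and> degree s' \<ge> 1)))"

lemma raises_fst_jonq_p:
  assumes "\<alpha> \<noteq> 0" "\<beta> \<noteq> 0" "degree f \<ge> 2" shows "raises_fst (jonq_p \<alpha> f \<beta>)"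
  unfolding raises_fst_def
proof (intro allI impI)
  fix r s :: "complex poly" assume rs: "degree s \<ge> degree r" "degree s \<ge> 1"
  have "jonq_p \<alpha> f \<beta> \<circ> curve r s = curve (smult \<alpha> r + f \<circ>\<^sub>p s) (smult \<beta> s)"
    by (auto simp: jonq_p_def curve_def poly_pcompose)
  moreover have "degree (f \<circ>\<^sub>p s) > degree s" using assms(3) rs(2) by (simp add: degree_pcompose)
  then have "degree (smult \<alpha> r + f \<circ>\<^sub>p s) > degree (smult \<beta> s)"
    using assms rs by (subst degree_add_eq_right) auto
  ultimately show "\<exists>r' s'. jonq_p \<alpha> f \<beta> \<circ> curve r s = curve r' s' \<and> degree r' > degree s' \<and> degree s' \<ge> 1"
    using assms rs by (auto simp: curve_inj)
qed

lemma raises_snd_jonq_m: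
  assumes "\<alpha> \<noteq> 0" "\<beta> \<noteq> 0" "degree f \<ge> 2" shows "raises_snd (jonq_m \<alpha> f \<beta>)"
proof -
  have *: "\<exists>r' s'. jonq_m \<alpha> f \<beta> \<circ> curve r s = curve r' s' \<and> degree s' \<ge> degree r' \<and> degree s' \<ge> degree r"
    if rs: "degree r \<ge> degree s" "degree r \<ge> 1" for r s
  proof -
    have "jonq_m \<alpha> f \<beta> \<circ> curve r s = curve (smult \<alpha> r) (smult \<beta> s + f \<circ>\<^sub>p r)"
      by (auto simp: jonq_m_def curve_def poly_pcompose)
    moreover have "degree (f \<circ>\<^sub>p r) > degree r" using assms(3) rs(2) by (simp add: degree_pcompose)
    then have "degree (smult \<beta> s + f \<circ>\<^sub>p r) > degree (smult \<alpha> r)"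
      using assms rs by (subst degree_add_eq_right) auto
    ultimately show ?thesis using assms rs by (auto simp: curve_inj)
  qed
  have "\<exists>r' s'. jonq_m \<alpha> f \<beta> \<circ> line c = curve r' s' \<and> degree s' \<ge> degree r' \<and> degree s' \<ge> 1" for c
    using *[of "[:0, c:]" "[:0, 1:]"] by auto
  then show ?thesis using * unfolding raises_snd_def by (intro conjI exI[of _ "{}"]) auto
qed

text \<open>A nonzero entry c carries the dominating leading term of r into the second component,
  where nothing can cancel it.\<close>

lemma raises_snd_linear_map:
  assumes "c \<noteq> 0" shows "raises_snd (linear_map a b c d)"
  unfolding raises_snd_def
proof (intro conjI allI impI)
  fix r s :: "complex poly" assume rs: "degree r > degree s"
  have "linear_map a b c d \<circ> curve r s = curve (smult a r + smult b s) (smult c r + smult d s)"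
    by (auto simp: linear_map_def curve_def)
  moreover have "degree (smult c r + smult d s) = degree r"
    using rs assms degree_smult_le[of d s] by (subst degree_add_eq_left) auto
  moreover have "degree (smult a r + smult b s) \<le> degree r"
    using rs degree_smult_le[of a r] degree_smult_le[of b s] by (intro degree_add_le) auto
  ultimately show "\<exists>r' s'. linear_map a b c d \<circ> curve r s = curve r' s' \<and> degree s' \<ge> degree r' \<and> degree s' \<ge> degree r"
    by (auto simp: curve_inj)
next
  have "finite {x. d * x = - c}"
  proof (cases "d = 0")
    case False
    then have "{x. d * x = - c} \<subseteq> {- c / d}" by (auto simp: field_simps)
    then show ?thesis by (rule finite_subset) simp
  qed (use assms in auto)
  moreover have "\<exists>r' s'. linear_map a b c d \<circ> line x = curve r' s' \<and> degree s' \<ge> degree r' \<and> degree s' \<ge> 1" if "x \<notin> {x. d * x = - c}" for x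
  proof -
    have "c + d * x \<noteq> 0" using that by (auto simp: add_eq_0_iff2 add_eq_0_iff)
    moreover have "linear_map a b c d \<circ> line x = curve [:0, a + b * x:] [:0, c + d * x:]"
      by (auto simp: linear_map_def curve_def algebra_simps)
    ultimately show ?thesis by (auto simp: curve_inj)
  qed
  ultimately show "\<exists>Z. finite Z \<and> (\<forall>x. x \<notin> Z \<longrightarrow> (\<exists>r' s'. linear_map a b c d \<circ> line x = curve r' s' \<and> degree s' \<ge> degree r' \<and> degree s' \<ge> 1))"
    by blast
qed

context cyclic_quotient
begin

section \<open>Cosets and the factors of the quotient\<close>

definition coset :: "(complex \<times> complex \<Rightarrow> complex \<times> complex) \<Rightarrow> (complex \<times> complex \<Rightarrow> complex \<times> complex) set" where
  "coset f = G_grp d e #>\<^bsub>Aut_A2\<^esub> f"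

abbreviation "K \<equiv> quot (N_aut d e) d e"

text \<open>The product of cosets does not depend on H, so all the quotients are one structure with
  different carriers, as the locale on amalgamated pairs requires.\<close>

lemma quot_eq: "quot H d e = K\<lparr>carrier := coset ` H\<rparr>"
  by (auto simp: quot_def FactGroup_def RCOSETS_def coset_def r_coset_def set_mult_def fun_eq_iff)

lemma normal_G: "G_grp d e \<lhd> Aut_A2\<lparr>carrier := N_aut d e\<rparr>"
proof -
  interpret N: group "Aut_A2\<lparr>carrier := N_aut d e\<rparr>" by (rule AG.subgroup_imp_group[OF subgroup_N_aut])
  show ?thesis unfolding N.normal_inv_iff
  proof (intro conjI ballI)
    show "subgroup (G_grp d e) (Aut_A2\<lparr>carrier := N_aut d e\<rparr>)" unfolding G_eq
      by (rule AG.subgroup_incl[OF subgroup_range_gen_pow subgroup_N_aut]) (auto intro: gen_pow_N_aut)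
  next
    fix f g assume "f \<in> carrier (Aut_A2\<lparr>carrier := N_aut d e\<rparr>)" "g \<in> G_grp d e"
    then obtain j where f: "f \<in> N_aut d e" and g: "g = gen_pow j" by (auto simp: G_eq)
    then obtain k where k: "f \<circ> gen_pow 1 = gen_pow k \<circ> f" by (auto simp: N_aut_iff)
    note i = N_aut_inverse[OF f]
    have "f \<circ> gen_pow j \<circ> inv\<^bsub>Aut_A2\<^esub> f = gen_pow (k * j)" unfolding conj_power[OF k] comp_assoc i by simp
    then show "f \<otimes>\<^bsub>Aut_A2\<lparr>carrier := N_aut d e\<rparr>\<^esub> g \<otimes>\<^bsub>Aut_A2\<lparr>carrier := N_aut d e\<rparr>\<^esub> inv\<^bsub>Aut_A2\<lparr>carrier := N_aut d e\<rparr>\<^esub> f \<in> G_grp d e"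
      using f i(1) AG.m_inv_consistent[OF subgroup_N_aut f]
      by (simp add: g mult_Aut_A2 N_aut_carrier gen_pow_carrier comp_closed G_eq)
  qed
qed

lemma group_K: "group K"
  unfolding quot_def by (rule normal.factorgroup_is_group[OF normal_G])

lemma coset_hom: "group_hom (Aut_A2\<lparr>carrier := N_aut d e\<rparr>) K coset"
proof -
  have "(\<lambda>a. G_grp d e #>\<^bsub>Aut_A2\<lparr>carrier := N_aut d e\<rparr>\<^esub> a) \<in> hom (Aut_A2\<lparr>carrier := N_aut d e\<rparr>) K"
    unfolding quot_def by (rule normal.r_coset_hom_Mod[OF normal_G])
  moreover have "(\<lambda>a. G_grp d e #>\<^bsub>Aut_A2\<lparr>carrier := N_aut d e\<rparr>\<^esub> a) = coset"
    by (auto simp: coset_def r_coset_def fun_eq_iff)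
  ultimately show ?thesis unfolding group_hom_def group_hom_axioms_def
    using group_K AG.subgroup_imp_group[OF subgroup_N_aut] by simp
qed

lemma coset_mult: "f \<in> N_aut d e \<Longrightarrow> g \<in> N_aut d e \<Longrightarrow> coset f \<otimes>\<^bsub>K\<^esub> coset g = coset (f \<circ> g)"
  using group_hom.hom_mult[OF coset_hom, of f g] by (simp add: mult_Aut_A2 N_aut_carrier)

lemma one_K: "\<one>\<^bsub>K\<^esub> = G_grp d e"
  by (simp add: quot_def)

lemma coset_alt: "f \<in> N_aut d e \<Longrightarrow> coset f = (\<lambda>k. gen_pow k \<circ> f) ` UNIV"
  by (auto simp: coset_def r_coset_def G_eq mult_Aut_A2 N_aut_carrier gen_pow_carrier)

lemma coset_self: "f \<in> N_aut d e \<Longrightarrow> f \<in> coset f"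
  unfolding coset_alt by (rule image_eqI[of _ _ 0]) auto

lemma coset_subgroup:
  assumes "subgroup H Aut_A2" "H \<subseteq> N_aut d e" shows "subgroup (coset ` H) K"
  using group_hom.subgroup_img_is_subgroup[OF coset_hom] AG.subgroup_incl[OF assms(1) subgroup_N_aut assms(2)] by blast

lemma coset_eqD:
  assumes "subgroup H Aut_A2" "range gen_pow \<subseteq> H" "f \<in> H" "g \<in> N_aut d e" "f \<in> N_aut d e" "coset f = coset g"
  shows "g \<in> H"
proof -
  have "g \<in> coset f" using coset_self assms by simp
  then obtain k where "g = gen_pow k \<circ> f" using coset_alt[OF assms(5)] by auto
  then show ?thesis using subgroup.m_closed[OF assms(1), of "gen_pow k" f] assms by (auto simp: mult_Aut_A2 gen_pow_carrier N_aut_carrier)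
qed

text \<open>As H contains G it is a union of cosets, so a representative from H' of a shared coset
  already lies in H.\<close>

lemma coset_Int:
  assumes "subgroup H Aut_A2" "range gen_pow \<subseteq> H" "H \<subseteq> N_aut d e" "H' \<subseteq> N_aut d e"
  shows "coset ` (H \<inter> H') = coset ` H \<inter> coset ` H'"
proof (intro equalityI subsetI)
  fix x assume "x \<in> coset ` H \<inter> coset ` H'"
  then obtain f g where fg: "f \<in> H" "g \<in> H'" "x = coset f" "x = coset g" by auto
  then have "g \<in> H" using coset_eqD[OF assms(1,2), of f g] assms by auto
  then show "x \<in> coset ` (H \<inter> H')" using fg by auto
qed auto

text \<open>The head of the word acts last and decides which component dominates. The clause
  \<open>degree s \<ge> 2\<close> separates longer words starting on the right from linear maps:
  their second component inherits a degree that strictly exceeded a positive one.\<close>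

lemma alternating_word:
  assumes HA: "HA \<subseteq> N_aut d e" and HB: "HB \<subseteq> N_aut d e" and HC: "HC \<subseteq> N_aut d e"
    and A: "\<And>a. a \<in> HA - HC \<Longrightarrow> raises_fst a" and B: "\<And>b. b \<in> HB - HC \<Longrightarrow> raises_snd b"
    and w: "reduced (\<lambda>s. (if s then coset ` HA else coset ` HB) - coset ` HC) w"
  shows "\<exists>f\<in>N_aut d e. word_val K w = coset f \<and> (\<exists>Z. finite Z \<and> (\<forall>c. c \<notin> Z \<longrightarrow> (\<exists>r s. f \<circ> line c = curve r s \<and>
     (if isl (hd w) then degree r > degree s \<and> degree s \<ge> 1
      else degree s \<ge> degree r \<and> degree s \<ge> 1 \<and> (length w \<ge> 2 \<longrightarrow> degree s \<ge> 2)))))"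
  using w
proof (induction "\<lambda>s. (if s then coset ` HA else coset ` HB) - coset ` HC" w rule: reduced.induct)
  case (2 l)
  have K1: "coset f \<otimes>\<^bsub>K\<^esub> \<one>\<^bsub>K\<^esub> = coset f" if "f \<in> N_aut d e" for f
    using group.is_monoid[OF group_K] group_hom.hom_closed[OF coset_hom, of f] that by (simp add: monoid.r_one)
  show ?case
  proof (cases l)
    case (Inl x)
    then obtain a where a: "a \<in> HA - HC" "x = coset a" using 2 by auto
    have "\<exists>r s. a \<circ> line c = curve r s \<and> degree r > degree s \<and> degree s \<ge> 1" if "c \<notin> {0}" for c
      using A[OF a(1)] that unfolding raises_fst_def by auto
    then show ?thesis using a HA K1[of a] Inl by (intro bexI[of _ a] conjI exI[of _ "{0}"]) auto
  next
    case (Inr x)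
    then obtain b where b: "b \<in> HB - HC" "x = coset b" using 2 by auto
    obtain Z where "finite Z" "\<And>c. c \<notin> Z \<Longrightarrow> \<exists>r' s'. b \<circ> line c = curve r' s' \<and> degree s' \<ge> degree r' \<and> degree s' \<ge> 1"
      using B[OF b(1)] unfolding raises_snd_def by auto
    then show ?thesis using b HB K1[of b] Inr by (intro bexI[of _ b] conjI exI[of _ Z]) auto
  qed
next
  case (3 l l' w)
  then have IH: "isl l \<noteq> isl l'" and "\<exists>f\<in>N_aut d e. word_val K (l' # w) = coset f \<and> (\<exists>Z. finite Z \<and> (\<forall>c. c \<notin> Z \<longrightarrow> (\<exists>r s. f \<circ> line c = curve r s \<and>
     (if isl l' then degree r > degree s \<and> degree s \<ge> 1
      else degree s \<ge> degree r \<and> degree s \<ge> 1))))" by (auto split: if_splits) metis+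
  then obtain f Z where f: "f \<in> N_aut d e" "word_val K (l' # w) = coset f" "finite Z" 
     "\<And>c. c \<notin> Z \<Longrightarrow> \<exists>r s. f \<circ> line c = curve r s \<and>
     (if isl l' then degree r > degree s \<and> degree s \<ge> 1
      else degree s \<ge> degree r \<and> degree s \<ge> 1)" by blast
  show ?case
  proof (cases l)
    case (Inl x)
    then obtain a where a: "a \<in> HA - HC" "x = coset a" using 3 by auto
    have "\<exists>r s. (a \<circ> f) \<circ> line c = curve r s \<and> degree r > degree s \<and> degree s \<ge> 1" if c: "c \<notin> Z" for c
    proof -
      obtain r s where rs: "f \<circ> line c = curve r s" "degree s \<ge> degree r" "degree s \<ge> 1"
        using f(4)[OF c] IH Inl by auto
      then show ?thesis using A[OF a(1)] unfolding raises_fst_def comp_assoc by auto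
    qed
    moreover have af: "a \<circ> f \<in> N_aut d e" using a HA f subgroup.m_closed[OF subgroup_N_aut, of a f] by (auto simp: mult_Aut_A2 N_aut_carrier subset_iff)
    moreover have "word_val K (l # l' # w) = coset (a \<circ> f)" using f(2) a HA f(1) coset_mult[of a f] Inl by auto
    ultimately show ?thesis using f(3) Inl by (intro bexI[of _ "a \<circ> f"] conjI exI[of _ Z]) auto
  next
    case (Inr x)
    then obtain b where b: "b \<in> HB - HC" "x = coset b" using 3 by auto
    have "\<exists>r s. (b \<circ> f) \<circ> line c = curve r s \<and> degree s \<ge> degree r \<and> degree s \<ge> 2" if c: "c \<notin> Z" for c
    proof -
      obtain r s where rs: "f \<circ> line c = curve r s" "degree r > degree s" "degree s \<ge> 1"
        using f(4)[OF c] IH Inr by auto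
      then obtain r' s' where "b \<circ> curve r s = curve r' s'" "degree s' \<ge> degree r'" "degree s' \<ge> degree r"
        using B[OF b(1)] unfolding raises_snd_def by blast
      then show ?thesis using rs unfolding comp_assoc by (intro exI[of _ r'] exI[of _ s']) auto
    qed
    moreover have bf: "b \<circ> f \<in> N_aut d e" using b HB f subgroup.m_closed[OF subgroup_N_aut, of b f] by (auto simp: mult_Aut_A2 N_aut_carrier subset_iff)
    moreover have "word_val K (l # l' # w) = coset (b \<circ> f)" using f(2) b HB f(1) coset_mult[of b f] Inr by auto
    ultimately show ?thesis using f(3) Inr by (intro bexI[of _ "b \<circ> f"] conjI exI[of _ Z]) (auto, fastforce)
  qed
qed simp

theorem quot_amalg:
  assumes A: "subgroup HA Aut_A2" "HA \<subseteq> N_aut d e" and B: "subgroup HB Aut_A2" "HB \<subseteq> N_aut d e"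
    and G: "range gen_pow \<subseteq> HA" "range gen_pow \<subseteq> HB"
    and raise: "\<And>a. a \<in> HA - HB \<Longrightarrow> raises_fst a" "\<And>b. b \<in> HB - HA \<Longrightarrow> raises_snd b"
    and gen: "\<And>M. subgroup M Aut_A2 \<Longrightarrow> HA \<subseteq> M \<Longrightarrow> HB \<subseteq> M \<Longrightarrow> N_aut d e \<subseteq> M"
  shows "K \<cong> amalg (quot HA d e) (quot (HA \<inter> HB) d e) (quot HB d e)"
proof -
  interpret K: group K by (rule group_K)
  interpret amalgamated_pair K "coset ` HA" "coset ` HB" "coset ` (HA \<inter> HB)"
  proof (intro amalgamated_pair.intro amalgamated_pair_axioms.intro)
    show "group K" by (rule group_K)
    show "subgroup (coset ` HA) K" "subgroup (coset ` HB) K" using A B coset_subgroup by auto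
    show "coset ` (HA \<inter> HB) = coset ` HA \<inter> coset ` HB" using coset_Int[OF A(1) G(1) A(2) B(2)] .
  next
    fix w assume w: "reduced (\<lambda>s. (if s then coset ` HA else coset ` HB) - coset ` (HA \<inter> HB)) w"
    have CC: "HA \<inter> HB \<subseteq> N_aut d e" using A by auto
    have ra: "raises_fst a" if "a \<in> HA - HA \<inter> HB" for a using raise(1)[of a] that by blast
    have rb: "raises_snd b" if "b \<in> HB - HA \<inter> HB" for b using raise(2)[of b] that by blast
    obtain f Z where f: "f \<in> N_aut d e" "word_val K w = coset f" "finite Z" 
      "\<And>c. c \<notin> Z \<Longrightarrow> \<exists>r s. f \<circ> line c = curve r s \<and> (if isl (hd w) then degree r > degree s \<and> degree s \<ge> 1
      else degree s \<ge> degree r \<and> degree s \<ge> 1 \<and> (length w \<ge> 2 \<longrightarrow> degree s \<ge> 2))"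
      using alternating_word[OF A(2) B(2) CC ra rb w] by blast
    show "word_val K w \<noteq> \<one>\<^bsub>K\<^esub>"
    proof
      assume v: "word_val K w = \<one>\<^bsub>K\<^esub>"
      then have "f \<in> range gen_pow" using coset_self[OF f(1)] f(2) by (simp add: one_K G_eq)
      then obtain k where k: "f = gen_pow k" by blast
      obtain c where c: "c \<notin> insert 0 Z" using f(3) ex_new_if_finite infinite_UNIV_char_0 by (metis finite_insert)
      have "gen_pow k \<circ> line c = curve [:0, zeta ^ (e * k):] [:0, zeta ^ k * c:]"
        by (auto simp: gen_pow_def curve_def)
      \<comment> \<open>A power of g keeps both components in degree one, which leaves only a single
        right letter. That letter would be the identity, an element of the common subgroup.\<close>
      then have "\<not> isl (hd w) \<and> length w < 2" using f(4)[of c] c k by (auto simp: curve_inj split: if_splits)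
      then obtain x where "w = [Inr x]" using w by (cases w; cases "tl w"; cases "hd w") auto
      then have "x \<in> coset ` HB - coset ` (HA \<inter> HB)" "word_val K w = x" using w f(2) v K.r_one 
          group_hom.hom_closed[OF coset_hom] B(2) by (auto simp: subset_iff)
      moreover have "\<one>\<^bsub>K\<^esub> \<in> coset ` (HA \<inter> HB)"
      proof -
        have "coset (gen_pow 0) = G_grp d e" unfolding coset_alt[OF gen_pow_N_aut] by (simp add: G_eq)
        then show ?thesis unfolding one_K using G by (metis IntI image_eqI rangeI subsetD)
      qed
      ultimately show False using v by simp
    qed
  next
    fix M assume M: "subgroup M K" "coset ` HA \<subseteq> M" "coset ` HB \<subseteq> M"
    let ?M = "{f \<in> N_aut d e. coset f \<in> M}"
    have "subgroup ?M Aut_A2"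
    proof
      show "?M \<subseteq> carrier Aut_A2" using N_aut_carrier by auto
      show "f \<otimes>\<^bsub>Aut_A2\<^esub> g \<in> ?M" if "f \<in> ?M" "g \<in> ?M" for f g
        using that subgroup.m_closed[OF subgroup_N_aut, of f g] subgroup.m_closed[OF M(1), of "coset f" "coset g"] coset_mult[of f g]
        by (auto simp: mult_Aut_A2 N_aut_carrier)
      have "gen_pow 0 \<in> HA" using G(1) by blast
      then have "coset (gen_pow 0) \<in> M" using M(2) by blast
      then show "\<one>\<^bsub>Aut_A2\<^esub> \<in> ?M" using gen_pow_N_aut[of 0] by simp
      show "inv\<^bsub>Aut_A2\<^esub> f \<in> ?M" if "f \<in> ?M" for f
        using that N_aut_inverse[of f] subgroup.m_inv_closed[OF M(1), of "coset f"] group_hom.hom_inv[OF coset_hom, of f]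
          AG.m_inv_consistent[OF subgroup_N_aut, of f] by auto
    qed
    moreover have "HA \<subseteq> ?M" "HB \<subseteq> ?M" using M(2,3) A(2) B(2) by blast+
    ultimately have "N_aut d e \<subseteq> ?M" by (rule gen)
    moreover have "carrier K = coset ` N_aut d e" by (subst quot_eq) simp
    ultimately have "carrier K \<subseteq> M" by auto
    then show "M = carrier K" using subgroup.subset[OF M(1)] by auto
  qed
  show ?thesis using iso_amalg unfolding quot_eq[of HA] quot_eq[of HB] quot_eq[of "HA \<inter> HB"] .
qed

section \<open>Normalizing shears of low degree\<close>

lemma jonq_p_coeff:
  "coeff (coeff (const2 \<alpha> * X2 + map_poly (\<lambda>c. [:c:]) f) j) i =
     (if j = 0 \<and> i = 1 then \<alpha> else 0) + (if i = 0 then coeff f j else 0)"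
  by (auto simp: coeff_map_poly coeff_pCons split: nat.splits)

lemma jonq_m_coeff:
  "coeff (coeff (const2 \<beta> * Y2 + [:f:]) j) i = (if j = 1 \<and> i = 0 then \<beta> else 0) + (if j = 0 then coeff f i else 0)"
  by (auto simp: coeff_pCons split: nat.splits)

lemma degree_le_1: "degree (f :: complex poly) \<le> 1 \<Longrightarrow> f = [:coeff f 0, coeff f 1:]"
  by (intro poly_eqI) (auto simp: coeff_pCons coeff_eq_0 split: nat.splits)

text \<open>The term \<alpha> x fixes the character of the first coordinate, and each monomial of f
  must share it. The negative version compares with \<beta> y instead.\<close>

lemma jonq_p_N_aut_coeff:
  assumes "\<alpha> \<noteq> 0" "jonq_p \<alpha> f \<beta> \<in> N_aut d e" "coeff f j \<noteq> 0" shows "[j = e] (mod d)"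
proof -
  obtain k where k: "polymap (const2 \<alpha> * X2 + map_poly (\<lambda>c. [:c:]) f) (const2 \<beta> * Y2) \<circ> gen_pow 1 = gen_pow k \<circ> polymap (const2 \<alpha> * X2 + map_poly (\<lambda>c. [:c:]) f) (const2 \<beta> * Y2)"
    using assms unfolding N_aut_iff jonq_p_polymap by blast
  have "[e * 1 + 0 = e * k] (mod d)" by (intro semi_inv_coeff(1)[OF k]) (use assms in \<open>simp only: jonq_p_coeff\<close>, simp)
  moreover have "[e * 0 + j = e * k] (mod d)" by (intro semi_inv_coeff(1)[OF k]) (use assms in \<open>simp only: jonq_p_coeff\<close>, simp)
  ultimately show ?thesis using cong_trans cong_sym by (metis add.left_neutral add.right_neutral mult_1_right mult_zero_right)
qed

lemma jonq_m_N_aut_coeff: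
  assumes "\<beta> \<noteq> 0" "jonq_m \<alpha> f \<beta> \<in> N_aut d e" "coeff f i \<noteq> 0" shows "[e * i = 1] (mod d)"
proof -
  obtain k where k: "polymap (const2 \<alpha> * X2) (const2 \<beta> * Y2 + [:f:]) \<circ> gen_pow 1 = gen_pow k \<circ> polymap (const2 \<alpha> * X2) (const2 \<beta> * Y2 + [:f:])"
    using assms unfolding N_aut_iff jonq_m_polymap by blast
  have "[e * 0 + 1 = k] (mod d)" by (intro semi_inv_coeff(2)[OF k]) (use assms in \<open>simp only: jonq_m_coeff\<close>, simp)
  moreover have "[e * i + 0 = k] (mod d)" by (intro semi_inv_coeff(2)[OF k]) (use assms in \<open>simp only: jonq_m_coeff\<close>, simp)
  ultimately show ?thesis using cong_trans cong_sym by (metis add.left_neutral add.right_neutral mult_zero_right)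
qed

text \<open>A constant would need d to divide e, and a linear term needs e = 1 because e < d. It
  ensures that shears outside the common subgroup have degree at least 2, as
  \<open>raises_fst_jonq_p\<close> demands.\<close>

lemma jonq_p_N_aut_degree_le_1:
  assumes "\<alpha> \<noteq> 0" "jonq_p \<alpha> f \<beta> \<in> N_aut d e" "degree f \<le> 1" 
  shows "\<exists>c. f = [:0, c:] \<and> (e \<noteq> 1 \<longrightarrow> c = 0)"
proof -
  have "coeff f 0 = 0"
  proof (rule ccontr)
    assume "coeff f 0 \<noteq> 0"
    then have "[0 = e] (mod d)" using jonq_p_N_aut_coeff assms by blast
    then show False using d_not_dvd_e cong_0_iff cong_sym by metis
  qed
  moreover have "coeff f 1 = 0" if "e \<noteq> 1"
  proof (rule ccontr)
    assume "coeff f 1 \<noteq> 0"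
    then have "[1 = e] (mod d)" using jonq_p_N_aut_coeff assms by blast
    then show False using that e1 ed by (simp add: cong_def)
  qed
  ultimately show ?thesis using degree_le_1[OF assms(3)] by metis
qed

lemma jonq_m_N_aut_degree_le_1:
  assumes "\<beta> \<noteq> 0" "jonq_m \<alpha> f \<beta> \<in> N_aut d e" "degree f \<le> 1" "e \<noteq> 1"
  shows "f = 0"
proof -
  have "coeff f 0 = 0"
  proof (rule ccontr)
    assume "coeff f 0 \<noteq> 0"
    then have "[e * 0 = 1] (mod d)" using jonq_m_N_aut_coeff assms by blast
    then show False using e1 ed by (simp add: cong_def)
  qed
  moreover have "coeff f 1 = 0"
  proof (rule ccontr)
    assume "coeff f 1 \<noteq> 0"
    then have "[e * 1 = 1] (mod d)" using jonq_m_N_aut_coeff assms by blast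
    then show False using assms(4) e1 ed by (simp add: cong_def)
  qed
  ultimately show ?thesis using degree_le_1[OF assms(3)] by simp
qed

lemma Torus_jonq_p: "Torus = {jonq_p a 0 b | a b. a \<noteq> 0 \<and> b \<noteq> 0}" and Torus_jonq_m: "Torus = {jonq_m a 0 b | a b. a \<noteq> 0 \<and> b \<noteq> 0}"
  by (simp_all add: Torus_def jonq_p_def jonq_m_def)

lemma gen_pow_Torus: "gen_pow k \<in> Torus"
  unfolding Torus_def by (intro CollectI exI[of _ "zeta ^ (e * k)"] exI[of _ "zeta ^ k"] conjI) (auto simp: gen_pow_def)

lemma Torus_N: "Torus \<subseteq> N_aut_plus d e" "Torus \<subseteq> N_aut_minus d e"
proof -
  have J: "Torus \<subseteq> Jonq_plus" "Torus \<subseteq> Jonq_minus" unfolding Torus_jonq_p Jonq_plus_jonq_p by blast (unfold Torus_jonq_p[symmetric] Torus_jonq_m Jonq_minus_jonq_m, blast)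
  moreover have "f \<in> N_aut d e" if f: "f \<in> Torus" for f
  proof -
    have "f \<circ> gen_pow 1 = gen_pow 1 \<circ> f" using f by (auto simp: Torus_jonq_p jonq_p_def gen_pow_def fun_eq_iff)
    then show ?thesis unfolding N_aut_iff using f J(1) subgroup.mem_carrier[OF subgroup_Jonq_plus] by blast
  qed
  ultimately show "Torus \<subseteq> N_aut_plus d e" "Torus \<subseteq> N_aut_minus d e" unfolding N_aut_plus_def N_aut_minus_def by blast+
qed

lemma Jonq_Int: "Jonq_plus \<inter> Jonq_minus \<subseteq> Torus"
proof
  fix f assume "f \<in> Jonq_plus \<inter> Jonq_minus"
  then obtain a p b a' q b' where f: "f = jonq_p a p b" "f = jonq_m a' q b'" "a \<noteq> 0" "b \<noteq> 0"
    unfolding Jonq_plus_jonq_p Jonq_minus_jonq_m by blast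
  then have "jonq_p a p b (0, y) = jonq_m a' q b' (0, y)" for y by simp
  then have "p = 0" by (intro poly_ext) (simp add: jonq_p_def jonq_m_def)
  then show "f \<in> Torus" unfolding Torus_jonq_p using f by blast
qed

lemma plus_minus_Int: "N_aut_plus d e \<inter> N_aut_minus d e = Torus"
  using Jonq_Int Torus_N by (auto simp: N_aut_plus_def N_aut_minus_def)

lemma subgroup_N_aut_plus: "subgroup (N_aut_plus d e) Aut_A2"
  unfolding N_aut_plus_def by (rule AG.subgroups_Inter_pair[OF subgroup_N_aut subgroup_Jonq_plus])
lemma subgroup_N_aut_minus: "subgroup (N_aut_minus d e) Aut_A2"
  unfolding N_aut_minus_def by (rule AG.subgroups_Inter_pair[OF subgroup_N_aut subgroup_Jonq_minus])
lemma subgroup_N_lin: "subgroup (N_lin d e) Aut_A2"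
  unfolding N_lin_eq by (rule AG.subgroups_Inter_pair[OF subgroup_N_aut subgroup_GL2])

lemma Aut_X_amalg:
  assumes "K \<cong> P" shows "Aut (X_var d e) \<cong> P"
proof -
  have "Aut (X_var d e) \<cong> K" using group.iso_sym[OF group_K quot_N_aut_iso] .
  then show ?thesis using assms by (rule iso_trans)
qed

theorem generic_case:
  assumes e2: "\<not> [e ^ 2 = 1] (mod d)"
  shows "Aut (X_var d e) \<cong> amalg (quot (N_aut_plus d e) d e) (quot Torus d e) (quot (N_aut_minus d e) d e)"
proof (rule Aut_X_amalg)
  \<comment> \<open>With e = 1 excluded, a normalizing shear of degree at most one is diagonal, so
    the common subgroup is the torus.\<close>
  have "e \<noteq> 1" using e2 by auto
  have "K \<cong> amalg (quot (N_aut_plus d e) d e) (quot (N_aut_plus d e \<inter> N_aut_minus d e) d e) (quot (N_aut_minus d e) d e)"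
  proof (rule quot_amalg[OF subgroup_N_aut_plus _ subgroup_N_aut_minus])
    fix f assume f: "f \<in> N_aut_plus d e - N_aut_minus d e"
    then obtain a p b where p: "f = jonq_p a p b" "a \<noteq> 0" "b \<noteq> 0" "f \<in> N_aut d e" by (auto simp: N_aut_plus_def Jonq_plus_jonq_p)
    have "degree p \<ge> 2"
    proof (rule ccontr)
      assume "\<not> degree p \<ge> 2"
      then have "p = 0" using jonq_p_N_aut_degree_le_1[of a p b] p \<open>e \<noteq> 1\<close> by auto
      then have "f \<in> Torus" using p unfolding Torus_jonq_p by blast
      then show False using f Torus_N by blast
    qed
    then show "raises_fst f" using p raises_fst_jonq_p by blast
  next
    fix f assume f: "f \<in> N_aut_minus d e - N_aut_plus d e"
    then obtain a p b where p: "f = jonq_m a p b" "a \<noteq> 0" "b \<noteq> 0" "f \<in> N_aut d e" by (auto simp: N_aut_minus_def Jonq_minus_jonq_m)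
    have "degree p \<ge> 2"
    proof (rule ccontr)
      assume "\<not> degree p \<ge> 2"
      then have "p = 0" using jonq_m_N_aut_degree_le_1[of b a p] p \<open>e \<noteq> 1\<close> by auto
      then have "f \<in> Torus" using p unfolding Torus_jonq_m by blast
      then show False using f Torus_N by blast
    qed
    then show "raises_snd f" using p raises_snd_jonq_m by blast
  next
    fix M assume "subgroup M Aut_A2" "N_aut_plus d e \<subseteq> M" "N_aut_minus d e \<subseteq> M"
    then show "N_aut d e \<subseteq> M" using N_aut_generated e2 by blast
  qed (use gen_pow_Torus Torus_N in \<open>auto simp: N_aut_plus_def N_aut_minus_def\<close>)
  then show "K \<cong> amalg (quot (N_aut_plus d e) d e) (quot Torus d e) (quot (N_aut_minus d e) d e)"
    unfolding plus_minus_Int .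
qed

theorem involutive_case:
  assumes e2: "[e ^ 2 = 1] (mod d)"
  shows "Aut (X_var d e) \<cong> amalg (quot (N_aut_plus d e) d e) (quot (N_lin_plus d e) d e) (quot (N_lin d e) d e)"
proof (rule Aut_X_amalg)
  have Int: "N_aut_plus d e \<inter> N_lin d e = N_lin_plus d e"
    unfolding N_aut_plus_def N_lin_plus_def N_lin_eq by blast
  have "K \<cong> amalg (quot (N_aut_plus d e) d e) (quot (N_aut_plus d e \<inter> N_lin d e) d e) (quot (N_lin d e) d e)"
  proof (rule quot_amalg[OF subgroup_N_aut_plus _ subgroup_N_lin])
    fix f assume f: "f \<in> N_aut_plus d e - N_lin d e"
    then obtain a p b where p: "f = jonq_p a p b" "a \<noteq> 0" "b \<noteq> 0" "f \<in> N_aut d e" by (auto simp: N_aut_plus_def Jonq_plus_jonq_p)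
    have "degree p \<ge> 2"
    proof (rule ccontr)
      assume "\<not> degree p \<ge> 2"
      then obtain c where "p = [:0, c:]" using jonq_p_N_aut_degree_le_1[of a p b] p by auto
      then have "f = linear_map a c 0 b" by (auto simp: p(1) jonq_p_def linear_map_def fun_eq_iff)
      moreover have "a * b - c * 0 \<noteq> 0" using p by simp
      ultimately have "f \<in> GL2" unfolding GL2_linear_map by blast
      then show False using f p by (simp add: N_lin_eq)
    qed
    then show "raises_fst f" using p raises_fst_jonq_p by blast
  next
    fix f assume f: "f \<in> N_lin d e - N_aut_plus d e"
    then obtain a b c d' where l: "f = linear_map a b c d'" "a * d' - b * c \<noteq> 0" "f \<in> N_aut d e" by (auto simp: N_lin_eq GL2_linear_map)
    \<comment> \<open>An invertible matrix with c = 0 is upper triangular and would lie in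
      \<open>Jonq_plus\<close>.\<close>
    have "c \<noteq> 0"
    proof
      assume "c = 0"
      then have "f = jonq_p a [:0, b:] d'" "a \<noteq> 0" "d' \<noteq> 0" using l(2) by (auto simp: l(1) jonq_p_def linear_map_def fun_eq_iff)
      then have "f \<in> Jonq_plus" unfolding Jonq_plus_jonq_p by blast
      then show False using f l by (simp add: N_aut_plus_def)
    qed
    then show "raises_snd f" using l raises_snd_linear_map by blast
  next
    fix M assume M: "subgroup M Aut_A2" "N_aut_plus d e \<subseteq> M" "N_lin d e \<subseteq> M"
    \<comment> \<open>Conjugation by the swap, a linear normalizing map here, turns a negative
      triangular map into a positive one that is already in \<open>M\<close>.\<close>
    have "N_aut_minus d e \<subseteq> M"
    proof
      fix f assume "f \<in> N_aut_minus d e"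
      then obtain a p b where p: "f = jonq_m a p b" "a \<noteq> 0" "b \<noteq> 0" "f \<in> N_aut d e" by (auto simp: N_aut_minus_def Jonq_minus_jonq_m)
      have sw: "prod.swap \<in> N_lin d e" by (rule swap_N_lin[OF e2])
      then have swN: "prod.swap \<in> N_aut d e" by (simp add: N_lin_eq)
      have comp: "g \<circ> h \<in> H" if "subgroup H Aut_A2" "g \<in> H" "h \<in> H" for g h H
        using subgroup.m_closed[OF that] subgroup.mem_carrier[OF that(1)] that(2,3) by (simp add: mult_Aut_A2)
      have eq: "prod.swap \<circ> (f \<circ> prod.swap) = jonq_p b p a" by (auto simp: p(1) jonq_p_def jonq_m_def fun_eq_iff)
      have "jonq_p b p a \<in> N_aut d e" unfolding eq[symmetric] using swN p(4) by (intro comp[OF subgroup_N_aut])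
      moreover have "jonq_p b p a \<in> Jonq_plus" unfolding Jonq_plus_jonq_p using p by blast
      ultimately have "jonq_p b p a \<in> M" using M(2) by (auto simp: N_aut_plus_def)
      moreover have "f = prod.swap \<circ> (jonq_p b p a \<circ> prod.swap)" by (auto simp: p(1) jonq_p_def jonq_m_def fun_eq_iff)
      moreover have "prod.swap \<in> M" using M(3) sw by blast
      ultimately show "f \<in> M" using comp[OF M(1)] by simp
    qed
    then show "N_aut d e \<subseteq> M" using N_aut_generated M by blast
  qed (use gen_pow_Torus Torus_N gen_pow_GL2 gen_pow_N_aut in \<open>auto simp: N_aut_plus_def N_lin_eq\<close>)
  then show "K \<cong> amalg (quot (N_aut_plus d e) d e) (quot (N_lin_plus d e) d e) (quot (N_lin d e) d e)"
    unfolding Int .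
qed

end

theorem theorem4p2:
  fixes d e :: nat
  assumes "coprime d e" and "1 \<le> e" and "e < d"
  shows "(\<not> [e ^ 2 = 1] (mod d) \<longrightarrow>
           Aut (X_var d e) \<cong>
             (quot (N_aut_plus d e) d e) *\<^bsub>quot Torus d e\<^esub> (quot (N_aut_minus d e) d e)) \<and>
         ([e ^ 2 = 1] (mod d) \<longrightarrow>
           Aut (X_var d e) \<cong>
             (quot (N_aut_plus d e) d e) *\<^bsub>quot (N_lin_plus d e) d e\<^esub> (quot (N_lin d e) d e))"
proof -
  interpret cyclic_quotient d e using assms by unfold_locales
  show ?thesis using generic_case involutive_case by blast
qed

end
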